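(* Let $u$ be a weak supersolution of $A_{\mu,p}u=0$ in $\Omega$ such that $u\ge0$ in $B_R(x_0)\subset\Omega$. Suppose that $\zeta\ge0$ and there exists $\sigma\in(0,1]$ such that $$|\{u\ge\zeta\}\cap B_r(x_0)|\ge\sigma|B_r(x_0)|$$ for some $r\in(0,1]$ with $0<16r<R$. Then there exists a constant $\delta\in(0,\frac14)$ such that $$\operatorname*{ess\,inf}_{B_{4r}(x_0)}u\ge\delta\zeta-\sup_{s\in\Sigma}\left(\frac rR\right)^{\frac{sp}{p-1}}\operatorname{Tail}(u_-;x_0,R).$$
   Context: Setting: $p\in(1,\infty)$, $\Omega\subset\mathbb{R}^N$ is a bounded domain, and $\mu$ is a nonnegative finite Borel measure on $[0,1]$, nontrivial on $(0,1)$, with $\mu(\{0\})=0$ and $\alpha:=\mu(\{1\})>0$; $\Sigma:=\operatorname{supp}\mu$. The operator is $A_{\mu,p}u=\int_{(0,1)}(-\Delta)_p^su\,d\mu(s)-\alpha\Delta_pu$. The normalizing constant (written $C_{N,s,p}$ or $C_{N,p,s}$) is $$C_{N,s,p}=\frac{\frac{sp}{2}(1-s)2^{2s-1}}{\pi^{\frac{N-1}{2}}}\,\frac{\Gamma(\frac{N+ps}{2})}{\Gamma(\frac{p+1}{2})\Gamma(2-s)}.$$ $B_r(x_0)$ is the open ball of center $x_0$ and radius $r>0$; $u_-=\max\{-u,0\}$; $|E|$ is the Lebesgue measure of $E$. Tail: for $u\in L^{p-1}_{loc}(\mathbb{R}^N)$, $$\operatorname{Tail}(u;x_0,r)=\left[\int_{(0,1)}C_{N,s,p}\,r^{sp}\left(\int_{\mathbb{R}^N\setminus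 B_r(x_0)}\frac{|u(y)|^{p-1}}{|y-x_0|^{N+sp}}\,dy\right)d\mu(s)\right]^{\frac1{p-1}},$$ and $L^{p-1}_{sp,\mu}(\mathbb{R}^N)$ is the set of $u\in L^{p-1}_{loc}(\mathbb{R}^N)$ with $\operatorname{Tail}(u;x,r)<\infty$ for all $x\in\mathbb{R}^N$, $r\in(0,\infty)$. Weak solutions: $W_0^{1,p}(\Omega')$ is the standard Sobolev space, its elements being taken equal to $0$ in $\mathbb{R}^N\setminus\Omega'$. A function $u\in W^{1,p}_{loc}(\Omega)\cap L^{p-1}_{sp,\mu}(\mathbb{R}^N)$ is a weak supersolution of $A_{\mu,p}u=0$ in $\Omega$ if for every $\Omega'\Subset\Omega$ and every nonnegative $v\in W_0^{1,p}(\Omega')$, $$\int_{(0,1)}C_{N,s,p}\left(\iint_{\mathbb{R}^{2N}}\frac{|u(x)-u(y)|^{p-2}(u(x)-u(y))(v(x)-v(y))}{|x-y|^{N+sp}}\,dx\,dy\right)d\mu(s)+\alpha\int_\Omega|\nabla u|^{p-2}\nabla u\cdot\nabla v\,dx\ge0.$$ *)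

theory Defs
  imports "HOL-Probability.Essential_Supremum"
begin

section \<open>Lebesgue and Sobolev spaces\<close>

text \<open>
  The dimension is \<open>N = DIM('a)\<close>.  Elements of the function spaces are represented by Lebesgue
  measurable functions; sign conditions on them are understood almost everywhere.
\<close>

definition Lp :: "real \<Rightarrow> 'a::euclidean_space set \<Rightarrow> ('a \<Rightarrow> 'b::euclidean_space) \<Rightarrow> bool" where
  "Lp p U f \<longleftrightarrow> set_borel_measurable lebesgue U f
     \<and> set_integrable lebesgue U (\<lambda>x. norm (f x) powr p)"

definition Lp_loc :: "real \<Rightarrow> 'a::euclidean_space set \<Rightarrow> ('a \<Rightarrow> 'b::euclidean_space) \<Rightarrow> bool" where
  "Lp_loc p U f \<longleftrightarrow> (\<forall>K. compact K \<and> K \<subseteq> U \<longrightarrow> Lp p K f)"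

primrec Ck :: "nat \<Rightarrow> ('a::euclidean_space \<Rightarrow> real) \<Rightarrow> bool" where
  "Ck 0 f \<longleftrightarrow> continuous_on UNIV f"
| "Ck (Suc k) f \<longleftrightarrow> (\<forall>x. f differentiable (at x))
     \<and> (\<forall>i\<in>Basis. Ck k (\<lambda>x. frechet_derivative f (at x) i))"

definition grad :: "('a::euclidean_space \<Rightarrow> real) \<Rightarrow> 'a \<Rightarrow> 'a" where
  "grad f x = (\<Sum>i\<in>Basis. frechet_derivative f (at x) i *\<^sub>R i)"

definition test_functions :: "'a::euclidean_space set \<Rightarrow> ('a \<Rightarrow> real) set" where
  "test_functions U = {\<phi>. (\<forall>k. Ck k \<phi>)
     \<and> compact (closure {x. \<phi> x \<noteq> 0}) \<and> closure {x. \<phi> x \<noteq> 0} \<subseteq> U}"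

text \<open>
  Weak gradients on an open set \<open>U\<close> are determined up to null sets, so they are
  treated as a relation rather than selecting a representative.
\<close>

definition is_weak_gradient ::
    "'a::euclidean_space set \<Rightarrow> ('a \<Rightarrow> real) \<Rightarrow> ('a \<Rightarrow> 'a) \<Rightarrow> bool" where
  "is_weak_gradient U u g \<longleftrightarrow> Lp_loc 1 U u \<and> Lp_loc 1 U g
     \<and> (\<forall>\<phi>\<in>test_functions U.
          (LINT x:U|lebesgue. u x *\<^sub>R grad \<phi> x) = - (LINT x:U|lebesgue. \<phi> x *\<^sub>R g x))"

definition W1p_loc :: "real \<Rightarrow> 'a::euclidean_space set \<Rightarrow> ('a \<Rightarrow> real) set" where
  "W1p_loc p U = {u. Lp_loc p U u \<and> (\<exists>g. is_weak_gradient U u g \<and> Lp_loc p U g)}"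

text \<open>
  The closure of the test functions in \<open>W\<^bsup>1,p\<^esup>(U)\<close>, with its elements extended by \<open>0\<close>.
\<close>

definition W1p_0 :: "real \<Rightarrow> 'a::euclidean_space set \<Rightarrow> ('a \<Rightarrow> real) set" where
  "W1p_0 p U = {v. (\<forall>x. x \<notin> U \<longrightarrow> v x = 0) \<and> Lp p U v
     \<and> (\<exists>g. is_weak_gradient U v g \<and> Lp p U g
          \<and> (\<exists>\<phi>. (\<forall>n::nat. \<phi> n \<in> test_functions U)
               \<and> (\<lambda>n. LINT x:U|lebesgue. \<bar>\<phi> n x - v x\<bar> powr p) \<longlonglongrightarrow> 0
               \<and> (\<lambda>n. LINT x:U|lebesgue. norm (grad (\<phi> n) x - g x) powr p) \<longlonglongrightarrow> 0))}"

definition ess_inf_on :: "'a::euclidean_space set \<Rightarrow> ('a \<Rightarrow> real) \<Rightarrow> ereal" where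
  "ess_inf_on S f = - esssup (restrict_space lebesgue S) (\<lambda>x. - ereal (f x))"


section \<open>The nonlocal tail and weak supersolutions\<close>

definition measure_support :: "real measure \<Rightarrow> real set" where
  "measure_support \<mu> =
     {s \<in> space \<mu>. \<forall>U. open U \<and> s \<in> U \<longrightarrow> emeasure \<mu> (U \<inter> space \<mu>) > 0}"

definition C_norm :: "nat \<Rightarrow> real \<Rightarrow> real \<Rightarrow> real" where
  "C_norm N s p =
     (s * p / 2 * (1 - s) * 2 powr (2 * s - 1)) / pi powr ((real N - 1) / 2)
     * (Gamma ((real N + p * s) / 2) / (Gamma ((p + 1) / 2) * Gamma (2 - s)))"

text \<open>The tail may be infinite, hence it takes values in the extended nonnegative reals.\<close>

definition Tail ::
    "real measure \<Rightarrow> real \<Rightarrow> ('a::euclidean_space \<Rightarrow> real) \<Rightarrow> 'a \<Rightarrow> real \<Rightarrow> ennreal" where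
  "Tail \<mu> p u x0 r =
     (let I = (\<integral>\<^sup>+s\<in>{0<..<1}. ennreal (C_norm DIM('a) s p * r powr (s * p))
                 * (\<integral>\<^sup>+y\<in>- ball x0 r.
                      ennreal (\<bar>u y\<bar> powr (p - 1) / norm (y - x0) powr (real DIM('a) + s * p))
                    \<partial>lebesgue) \<partial>\<mu>)
      in if I = \<infinity> then \<infinity> else ennreal (enn2real I powr (1 / (p - 1))))"

definition tail_space :: "real measure \<Rightarrow> real \<Rightarrow> ('a::euclidean_space \<Rightarrow> real) set" where
  "tail_space \<mu> p = {u. Lp_loc (p - 1) UNIV u \<and> (\<forall>x. \<forall>r>0. Tail \<mu> p u x r < \<infinity>)}"

text \<open>
  In the two energies below, \<open>0 powr a = 0\<close> for every \<open>a\<close>, so that \<open>\<bar>t\<bar> powr (p - 2) * t\<close> is \<open>0\<close>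
  at \<open>t = 0\<close> also for \<open>p < 2\<close>.  For \<open>u\<close> and \<open>v\<close> as in \<open>weak_supersolution\<close> the integrands are
  absolutely integrable on the product of \<open>(0,1)\<close> with the squared space, respectively on \<open>\<Omega>\<close>;
  in particular the inner double integral exists for almost every \<open>s\<close>.
\<close>

definition nonlocal_energy ::
    "real measure \<Rightarrow> real \<Rightarrow> ('a::euclidean_space \<Rightarrow> real) \<Rightarrow> ('a \<Rightarrow> real) \<Rightarrow> real" where
  "nonlocal_energy \<mu> p u v =
     (LINT s:{0<..<1}|\<mu>. C_norm DIM('a) s p *
        (LINT z|(lebesgue :: ('a \<times> 'a) measure).
           \<bar>u (fst z) - u (snd z)\<bar> powr (p - 2) * (u (fst z) - u (snd z)) * (v (fst z) - v (snd z))
           / norm (fst z - snd z) powr (real DIM('a) + s * p)))"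

definition local_energy ::
    "real \<Rightarrow> 'a::euclidean_space set \<Rightarrow> ('a \<Rightarrow> 'a) \<Rightarrow> ('a \<Rightarrow> 'a) \<Rightarrow> real" where
  "local_energy p \<Omega> Gu Gv =
     (LINT x:\<Omega>|lebesgue. (norm (Gu x) powr (p - 2) *\<^sub>R Gu x) \<bullet> Gv x)"

definition weak_supersolution ::
    "real measure \<Rightarrow> real \<Rightarrow> 'a::euclidean_space set \<Rightarrow> ('a \<Rightarrow> real) \<Rightarrow> bool" where
  "weak_supersolution \<mu> p \<Omega> u \<longleftrightarrow>
     u \<in> W1p_loc p \<Omega> \<inter> tail_space \<mu> p \<and>
     (\<forall>\<Omega>' v Gu Gv.
        open \<Omega>' \<and> compact (closure \<Omega>') \<and> closure \<Omega>' \<subseteq> \<Omega>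
        \<and> v \<in> W1p_0 p \<Omega>' \<and> (AE x in lebesgue. 0 \<le> v x)
        \<and> is_weak_gradient \<Omega> u Gu \<and> is_weak_gradient \<Omega> v Gv
        \<longrightarrow> 0 \<le> nonlocal_energy \<mu> p u v + measure \<mu> {1} * local_energy p \<Omega> Gu Gv)"

end

theory Submission
  imports Defs
begin

text \<open>
  Let \<open>N\<close> be the dimension, \<open>C\<^sub>s\<close> the constant \<open>C_norm N s p\<close>, and \<open>d = \<delta> * \<zeta>\<close>. Write \<open>S\<close> for the
  supremum and \<open>T\<close> for the tail in the theorem. If \<open>S * T \<ge> d\<close>, the asserted bound is at most \<open>0\<close>
  and holds because \<open>u \<ge> 0\<close> in the large ball. Otherwise the claim follows from \<open>u \<ge> d\<close> almost
  everywhere in the ball of radius \<open>4 * r\<close>, and \<open>S * T < d\<close> implies (\<open>tail_scaling\<close>) that \<open>r\<^bsup>p\<^esup>\<close>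
  times the integral of \<open>C\<^sub>s * u\<^sub>-\<^bsup>p-1\<^esup> * |y - x0|\<^bsup>-N-sp\<^esup>\<close> over \<open>s\<close> and over the \<open>y\<close> outside the
  large ball is at most \<open>d\<^bsup>p-1\<^esup>\<close>: at scale \<open>r\<close> the far negative values of \<open>u\<close> are dominated by the
  shift \<open>d\<close>. The proof works with \<open>t = u + d\<close>.

  The equation is used once. Testing with \<open>\<eta>\<^bsup>p\<^esup> * t\<^bsup>1-p\<^esup> * (1 - q * t)\<^sub>+\<^sup>2\<close>, where \<open>\<eta>\<close> is a cutoff
  with slope at most \<open>L\<close>, \<open>L \<ge> 1 / r\<close>, supported in a ball of radius \<open>\<rho>\<close>, and \<open>q \<ge> 0\<close>, gives a
  Caccioppoli inequality (\<open>caccioppoli\<close>): the integral of \<open>(\<eta> * |\<nabla>u| / t)\<^bsup>p\<^esup> * (1 - q * t)\<^sub>+\<^sup>2\<close> is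
  at most \<open>K * L\<^bsup>p\<^esup>\<close> times the measure of the set where \<open>q * t < 1\<close> in the ball of radius \<open>\<rho>\<close>. The
  gradient term comes from the local part of the operator, which is present because \<open>\<mu> {1} > 0\<close>.
  The nonlocal part only has to be bounded from above. Its integrand is estimated pointwise
  (\<open>log_type_inequality\<close>, \<open>nonlocal_pointwise\<close>) by \<open>|\<eta> x - \<eta> y|\<^bsup>p\<^esup>\<close> and a tail term, and the
  integrals of the former against the kernels are bounded uniformly in \<open>s\<close>, since the factor \<open>s *
  (1 - s)\<close> in \<open>C\<^sub>s\<close> compensates their blow-up as \<open>s\<close> tends to \<open>0\<close> or \<open>1\<close> (\<open>kernel_constant\<close>).

  Two choices of \<open>q\<close> give the theorem. With \<open>q = 0\<close> the gradient of \<open>ln t\<close> is of order \<open>1 / r\<close> on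
  average. Comparing \<open>ln t\<close> at points with \<open>t < 4 * d\<close> with \<open>ln t\<close> at points of the set \<open>u \<ge> \<zeta>\<close>,
  which fills a fixed portion of the ball of radius \<open>r\<close>, shows that the former set occupies an
  arbitrarily small part of the ball of radius \<open>5 * r\<close> if \<open>\<zeta> / d\<close> is large enough (\<open>log_step\<close>).
  With \<open>q = 1 / \<kappa>\<close>, for levels \<open>\<kappa>\<close> decreasing from \<open>4 * d\<close> to \<open>2 * d\<close> in balls of radii decreasing
  from \<open>5 * r\<close> to \<open>4 * r\<close>, the inequality yields a De Giorgi recursion for the measures of the
  sublevel sets (\<open>de_giorgi_step\<close>), which tend to \<open>0\<close> because the first of them is small. Hence \<open>t
  \<ge> 2 * d\<close>, that is, \<open>u \<ge> d\<close>, almost everywhere in the ball of radius \<open>4 * r\<close>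
  (\<open>measure_to_pointwise\<close>).

  Both steps pass from gradients to functions by the translation estimate
  \<open>weak_translation_bound\<close>: the \<open>L\<^sup>1\<close> norm of \<open>v (x + h) - v x\<close> is at most \<open>|h|\<close> times that of the
  gradient. It gives the comparison of values in the first step, and a Faber-Krahn inequality for
  functions supported in sets of small measure (\<open>faber_krahn_translation\<close>) in the second. The
  remaining preparation is about Sobolev functions: mollification shows that compactly supported
  ones are limits of test functions (\<open>W1p_0I\<close>), hence admissible in the equation, and it proves
  the chain rule that makes the test functions and \<open>ln t\<close> Sobolev functions
  (\<open>weak_gradient_chain\<close>).
\<close>

section \<open>Smooth functions\<close>

definition smooth :: "('a::euclidean_space \<Rightarrow> real) \<Rightarrow> bool" where
  "smooth f \<longleftrightarrow> (\<forall>k. Ck k f)"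

text \<open>
  A set of differentiable functions that is closed under partial derivatives consists of smooth
  functions. Exhibiting such a set avoids formulas for higher derivatives.
\<close>

lemma smooth_coinduct:
  assumes "f \<in> S"
    and diff: "\<And>f x. f \<in> S \<Longrightarrow> f differentiable (at x)"
    and part: "\<And>f i. f \<in> S \<Longrightarrow> i \<in> Basis \<Longrightarrow> (\<lambda>x. frechet_derivative f (at x) i) \<in> S"
  shows "smooth f"
proof -
  have "Ck k f" if "f \<in> S" for k f
    using that
  proof (induction k arbitrary: f)
    case 0
    then show ?case
      using diff differentiable_imp_continuous_within
      by (fastforce simp: continuous_on_eq_continuous_at)
  next
    case (Suc k)
    then show ?case using diff part by auto
  qed
  then show ?thesis using assms(1) by (simp add: smooth_def)
qed

lemma smooth_differentiable: "smooth f \<Longrightarrow> f differentiable (at x)"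
  by (metis Ck.simps(2) smooth_def)

lemma smooth_partial: "smooth f \<Longrightarrow> i \<in> Basis \<Longrightarrow> smooth (\<lambda>x. frechet_derivative f (at x) i)"
  unfolding smooth_def by (metis Ck.simps(2))

lemma smooth_continuous: "smooth f \<Longrightarrow> continuous_on A f"
  unfolding smooth_def by (metis Ck.simps(1) continuous_on_subset subset_UNIV)

lemma grad_inner_Basis: "i \<in> Basis \<Longrightarrow> grad f x \<bullet> i = frechet_derivative f (at x) i"
  unfolding grad_def by (simp add: inner_sum_left inner_Basis if_distrib cong: if_cong)

lemma has_derivative_grad:
  assumes "f differentiable (at x)"
  shows "(f has_derivative (\<lambda>h. grad f x \<bullet> h)) (at x)"
proof -
  have d: "(f has_derivative frechet_derivative f (at x)) (at x)"
    using assms frechet_derivative_works by blast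
  then have lin: "linear (frechet_derivative f (at x))"
    using has_derivative_linear by blast
  have "frechet_derivative f (at x) h = grad f x \<bullet> h" for h
  proof -
    have "frechet_derivative f (at x) h = frechet_derivative f (at x) (\<Sum>i\<in>Basis. (h \<bullet> i) *\<^sub>R i)"
      by (simp add: euclidean_representation)
    also have "\<dots> = (\<Sum>i\<in>Basis. (h \<bullet> i) * frechet_derivative f (at x) i)"
      by (simp add: linear_sum[OF lin] linear_cmul[OF lin])
    also have "\<dots> = grad f x \<bullet> h"
      by (simp add: grad_def inner_sum_left inner_sum_right mult.commute inner_commute)
    finally show ?thesis .
  qed
  then have "frechet_derivative f (at x) = (\<lambda>h. grad f x \<bullet> h)" by auto
  with d show ?thesis by simp
qed

lemma grad_unique:
  assumes "(f has_derivative (\<lambda>h. g \<bullet> h)) (at x)"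
  shows "grad f x = g"
proof -
  have "frechet_derivative f (at x) = (\<lambda>h. g \<bullet> h)"
    using assms frechet_derivative_at by metis
  then show ?thesis
    by (simp add: grad_def euclidean_representation)
qed

lemma smooth_grad_continuous:
  assumes "smooth f"
  shows "continuous_on A (grad f)"
  unfolding grad_def
  using assms by (intro continuous_intros smooth_continuous smooth_partial)

text \<open>
  The factor \<open>k\<close> makes the family closed under differentiation: each derivative produces one more
  factor \<open>c\<close>.
\<close>

lemma smooth_affine:
  fixes a :: "'a::euclidean_space"
  assumes "smooth f"
  shows "smooth (\<lambda>x. k * f (a + c *\<^sub>R x))"
proof (rule smooth_coinduct)
  show "(\<lambda>x. k * f (a + c *\<^sub>R x)) \<in> {(\<lambda>x. k * f (a + c *\<^sub>R x)) |k f. smooth f}"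
    using assms by blast
next
  fix h :: "'a \<Rightarrow> real" and x
  assume "h \<in> {(\<lambda>x. k * f (a + c *\<^sub>R x)) |k f. smooth f}"
  then obtain k f where h: "h = (\<lambda>x. k * f (a + c *\<^sub>R x))" and f: "smooth f" by blast
  have f': "(f has_derivative (\<lambda>h. grad f z \<bullet> h)) (at z)" for z
    by (rule has_derivative_grad[OF smooth_differentiable[OF f]])
  have "(h has_derivative (\<lambda>v. k * (grad f (a + c *\<^sub>R x) \<bullet> (c *\<^sub>R v)))) (at x)" for x
    unfolding h
    by (rule has_derivative_mult_right)
      (rule has_derivative_compose[OF _ f'], auto intro!: derivative_eq_intros)
  then have D: "(h has_derivative (\<lambda>v. (k * c) * (grad f (a + c *\<^sub>R x) \<bullet> v))) (at x)" for x
    by (simp add: mult.assoc)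
  show "h differentiable (at x)" using D differentiable_def by blast
  fix i :: 'a assume i: "i \<in> Basis"
  have "(\<lambda>x. frechet_derivative h (at x) i) = (\<lambda>x. (k * c) * frechet_derivative f (at (a + c *\<^sub>R x)) i)"
    using frechet_derivative_at[OF D] i by (metis grad_inner_Basis)
  then show "(\<lambda>x. frechet_derivative h (at x) i) \<in> {(\<lambda>x. k * f (a + c *\<^sub>R x)) |k f. smooth f}"
    using smooth_partial[OF f i] by (intro CollectI exI[of _ "k * c"] exI[of _ "\<lambda>x. frechet_derivative f (at x) i"]) auto
qed

lemma test_functionsI:
  assumes "smooth \<phi>" "\<And>x. \<phi> x \<noteq> 0 \<Longrightarrow> x \<in> K" "compact K" "K \<subseteq> U"
  shows "\<phi> \<in> test_functions U"
proof -
  have "closure {x. \<phi> x \<noteq> 0} \<subseteq> K"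
    using assms by (intro closure_minimal) (auto simp: compact_imp_closed)
  moreover have "compact (closure {x. \<phi> x \<noteq> 0})"
    using calculation assms(3) compact_Int_closed[of K "closure {x. \<phi> x \<noteq> 0}"] by (simp add: Int_absorb1)
  ultimately show ?thesis
    using assms by (auto simp: test_functions_def smooth_def)
qed

lemma test_functionsD:
  assumes "\<phi> \<in> test_functions U"
  obtains K where "smooth \<phi>" "compact K" "K \<subseteq> U" "\<And>x. x \<notin> K \<Longrightarrow> \<phi> x = 0" "\<And>x. x \<notin> K \<Longrightarrow> grad \<phi> x = 0"
proof
  let ?K = "closure {x. \<phi> x \<noteq> 0}"
  show "smooth \<phi>" "compact ?K" "?K \<subseteq> U" using assms by (auto simp: test_functions_def smooth_def)
  show z: "\<phi> x = 0" if "x \<notin> ?K" for x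
    using that closure_subset[of "{x. \<phi> x \<noteq> 0}"] by blast
  show "grad \<phi> x = 0" if "x \<notin> ?K" for x
  proof (rule grad_unique)
    have d: "((\<lambda>_. 0::real) has_derivative (\<lambda>h. 0 \<bullet> h)) (at x)" by simp
    (* Off the support the function vanishes on an open set, so its gradient is zero there too. *)
    have o: "open (- ?K)" by (rule open_Compl[OF closed_closure])
    have xK: "x \<in> - ?K" using that by (simp only: Compl_iff not_False_eq_True)
    have z': "0 = \<phi> y" if "y \<in> - ?K" for y using z[OF ComplD[OF that]] by (rule sym)
    show "(\<phi> has_derivative (\<lambda>h. 0 \<bullet> h)) (at x)"
      by (rule has_derivative_transform_within_open[OF d o xK z'])
  qed
qed

text \<open>
  The classical function \<open>exp (- 1 / t)\<close> with all its derivatives vanishing at \<open>0\<close>. The powers of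
  \<open>1 / t\<close> are included because they appear when \<open>flat 0\<close> is differentiated.
\<close>

definition flat :: "nat \<Rightarrow> real \<Rightarrow> real" where
  "flat m t = (if t > 0 then inverse t ^ m * exp (- inverse t) else 0)"

lemma flat_tendsto_0: "(flat m \<longlongrightarrow> 0) (at 0)"
proof -
  have "((\<lambda>y. y ^ m / exp y) \<longlongrightarrow> (0::real)) at_top"
    by (rule tendsto_power_div_exp_0)
  then have "((\<lambda>t. inverse t ^ m / exp (inverse t)) \<longlongrightarrow> (0::real)) (at_right 0)"
    by (rule filterlim_compose[OF _ filterlim_inverse_at_top_right])
  then have "(flat m \<longlongrightarrow> 0) (at_right 0)"
    by (rule Lim_transform_eventually)
      (auto simp: flat_def eventually_at_filter exp_minus divide_inverse)
  moreover have "(flat m \<longlongrightarrow> 0) (at_left 0)"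
    by (rule Lim_transform_eventually[of "\<lambda>_. 0"]) (auto simp: flat_def eventually_at_filter)
  ultimately show ?thesis by (simp add: filterlim_split_at)
qed

lemma flat_deriv: "(flat m has_real_derivative (flat (m + 2) t - m * flat (m + 1) t)) (at t)"
proof -
  consider "t > 0" | "t < 0" | "t = 0" by linarith
  then show ?thesis
  proof cases
    case 1
    have p: "real m * inverse t ^ (m - 1) * inverse t = real m * inverse t ^ m"
      by (cases m) auto
    have "((\<lambda>t. inverse t ^ m * exp (- inverse t)) has_real_derivative
        (real m * (- (inverse t * 1 * inverse t) * inverse t ^ (m - 1)) * exp (- inverse t)
          + inverse t ^ m * (exp (- inverse t) * - (- (inverse t * 1 * inverse t))))) (at t)"
      using 1 by (auto intro!: derivative_eq_intros)
    also have "real m * (- (inverse t * 1 * inverse t) * inverse t ^ (m - 1)) * exp (- inverse t)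
          + inverse t ^ m * (exp (- inverse t) * - (- (inverse t * 1 * inverse t)))
        = - ((real m * inverse t ^ (m - 1) * inverse t) * inverse t * exp (- inverse t))
          + inverse t ^ (m + 2) * exp (- inverse t)"
      by (simp add: algebra_simps)
    also have "\<dots> = flat (m + 2) t - m * flat (m + 1) t"
      unfolding p using 1 by (simp add: flat_def algebra_simps)
    finally have "((\<lambda>t. inverse t ^ m * exp (- inverse t)) has_real_derivative
        (flat (m + 2) t - m * flat (m + 1) t)) (at t)" .
    then show ?thesis
      by (rule has_field_derivative_transform_within_open[where S="{0<..}"]) (use 1 in \<open>auto simp: flat_def\<close>)
  next
    case 2
    have "((\<lambda>_. 0::real) has_real_derivative 0) (at t)" by simp
    then have "(flat m has_real_derivative 0) (at t)"
      by (rule has_field_derivative_transform_within_open[where S="{..<0}"]) (use 2 in \<open>auto simp: flat_def\<close>)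
    then show ?thesis using 2 by (simp add: flat_def)
  next
    case 3
    (* The difference quotient of flat m at 0 is flat (m + 1). *)
    have "((\<lambda>y. (flat m y - flat m 0) / (y - 0)) \<longlongrightarrow> 0) (at 0)"
      by (rule Lim_transform_eventually[OF flat_tendsto_0[of "m+1"]])
        (auto simp: flat_def eventually_at_filter field_simps)
    then show ?thesis using 3 by (simp add: flat_def has_field_derivative_iff)
  qed
qed

text \<open>
  An algebra of functions that contains the bump \<open>flat 0 (1 - x \<bullet> x)\<close> and that is closed under
  partial derivatives, so that \<open>smooth_coinduct\<close> applies to it.
\<close>

inductive_set bump_class :: "('a::euclidean_space \<Rightarrow> real) set" where
  const: "(\<lambda>x. c) \<in> bump_class"
| coord: "(\<lambda>x. x \<bullet> b) \<in> bump_class"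
| flat: "(\<lambda>x. flat m (1 - x \<bullet> x)) \<in> bump_class"
| add: "f \<in> bump_class \<Longrightarrow> g \<in> bump_class \<Longrightarrow> (\<lambda>x. f x + g x) \<in> bump_class"
| mult: "f \<in> bump_class \<Longrightarrow> g \<in> bump_class \<Longrightarrow> (\<lambda>x. f x * g x) \<in> bump_class"

lemma bump_class_derivative:
  assumes "f \<in> bump_class"
  shows "\<exists>D. (\<forall>x. (f has_derivative D x) (at x)) \<and> (\<forall>i. (\<lambda>x. D x i) \<in> bump_class)"
  using assms
proof induction
  case (const c)
  show ?case by (intro exI[of _ "\<lambda>x h. 0"] conjI allI bump_class.const) auto
next
  case (coord b)
  show ?case
    by (intro exI[of _ "\<lambda>x h. h \<bullet> b"] conjI allI bump_class.const) (auto intro!: derivative_eq_intros)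
next
  case (flat m)
  let ?D = "\<lambda>x h. (flat (m + 2) (1 - x \<bullet> x) + (- real m) * flat (m + 1) (1 - x \<bullet> x)) * ((-2) * (x \<bullet> h))"
  have "((\<lambda>x. flat m (1 - x \<bullet> x)) has_derivative ?D x) (at x)" for x :: 'a
  proof -
    have d: "((\<lambda>x. 1 - x \<bullet> x) has_derivative (\<lambda>h. (-2) * (x \<bullet> h))) (at x)"
      by (auto intro!: derivative_eq_intros simp: inner_commute)
    have f: "(flat m has_derivative (\<lambda>h. (flat (m + 2) (1 - x \<bullet> x) - real m * flat (m + 1) (1 - x \<bullet> x)) * h)) (at (1 - x \<bullet> x))"
      by (rule has_field_derivative_imp_has_derivative[OF flat_deriv])
    show ?thesis using has_derivative_compose[OF d f] by simp
  qed
  moreover have "(\<lambda>x. ?D x i) \<in> bump_class" for i :: 'a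
    by (rule bump_class.mult[OF bump_class.add[OF bump_class.flat bump_class.mult[OF bump_class.const bump_class.flat]] bump_class.mult[OF bump_class.const bump_class.coord[of i]]])
  ultimately show ?case by (intro exI[of _ ?D] conjI allI)
next
  case (add f g)
  then obtain D E where "\<forall>x. (f has_derivative D x) (at x)" "\<forall>i. (\<lambda>x. D x i) \<in> bump_class"
    "\<forall>x. (g has_derivative E x) (at x)" "\<forall>i. (\<lambda>x. E x i) \<in> bump_class" by blast
  then show ?case
    by (intro exI[of _ "\<lambda>x h. D x h + E x h"] conjI allI has_derivative_add bump_class.add) auto
next
  case (mult f g)
  then obtain D E where "\<forall>x. (f has_derivative D x) (at x)" "\<forall>i. (\<lambda>x. D x i) \<in> bump_class"
    "\<forall>x. (g has_derivative E x) (at x)" "\<forall>i. (\<lambda>x. E x i) \<in> bump_class" by blast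
  then show ?case using mult.hyps
    by (intro exI[of _ "\<lambda>x h. f x * E x h + D x h * g x"] conjI allI has_derivative_mult
        bump_class.add bump_class.mult) auto
qed

lemma smooth_bump: "smooth (\<lambda>x::'a::euclidean_space. flat 0 (1 - x \<bullet> x))"
proof (rule smooth_coinduct[OF bump_class.flat])
  fix f :: "'a \<Rightarrow> real" and x
  assume "f \<in> bump_class"
  then obtain D where D: "\<And>x. (f has_derivative D x) (at x)" "\<And>i. (\<lambda>x. D x i) \<in> bump_class"
    using bump_class_derivative by blast
  show "f differentiable (at x)" using D(1) differentiable_def by blast
  fix i :: 'a
  have "(\<lambda>x. frechet_derivative f (at x) i) = (\<lambda>x. D x i)"
    using frechet_derivative_at[OF D(1)] by metis
  then show "(\<lambda>x. frechet_derivative f (at x) i) \<in> bump_class" using D(2) by simp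
qed

section \<open>Convolution with a smooth kernel\<close>

lemma smooth_bounded:
  assumes "smooth \<phi>" "\<And>x. e \<le> norm x \<Longrightarrow> \<phi> x = 0"
  obtains M where "0 \<le> M" "\<And>x. \<bar>\<phi> x\<bar> \<le> M"
proof -
  have "bounded (\<phi> ` cball 0 e)"
    using assms(1) by (intro compact_imp_bounded compact_continuous_image smooth_continuous) auto
  then obtain M where M: "\<And>x. x \<in> cball 0 e \<Longrightarrow> norm (\<phi> x) \<le> M"
    unfolding bounded_iff by blast
  have "\<bar>\<phi> x\<bar> \<le> max M 0" for x
    using M[of x] assms(2)[of x] by (cases "e \<le> norm x") auto
  then show ?thesis by (intro that[of "max M 0"]) auto
qed

lemma partial_eq_0_outside:
  assumes "\<And>x. e \<le> norm x \<Longrightarrow> \<phi> x = (0::real)" "e < norm x"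
  shows "frechet_derivative \<phi> (at x) i = 0"
proof -
  have "((\<lambda>_. 0::real) has_derivative (\<lambda>h. 0)) (at x)" by simp
  then have "(\<phi> has_derivative (\<lambda>h. 0)) (at x)"
    by (rule has_derivative_transform_within_open[where s="- cball 0 e"]) (use assms in auto)
  then show ?thesis using frechet_derivative_at by metis
qed

lemma partial_bounded:
  assumes "smooth \<phi>" "\<And>x. e \<le> norm x \<Longrightarrow> \<phi> x = 0" "i \<in> Basis"
  obtains M where "0 \<le> M" "\<And>x. \<bar>frechet_derivative \<phi> (at x) i\<bar> \<le> M"
proof -
  have "frechet_derivative \<phi> (at x) i = 0" if "e + 1 \<le> norm x" for x
    by (rule partial_eq_0_outside[of e]) (use assms(2) that in auto)
  then show ?thesis
    using smooth_bounded[OF smooth_partial[OF assms(1,3)], of "e + 1"] that by blast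
qed

lemma grad_bounded:
  assumes "smooth \<phi>" "\<And>x. e \<le> norm x \<Longrightarrow> \<phi> x = 0"
  obtains M where "0 \<le> M" "\<And>x. norm (grad \<phi> x) \<le> M"
proof -
  have "\<exists>B. 0 \<le> B \<and> (\<forall>x. \<bar>frechet_derivative \<phi> (at x) i\<bar> \<le> B)" if "i \<in> Basis" for i
    using partial_bounded[OF assms that] by metis
  then obtain B where B: "\<And>i. i \<in> Basis \<Longrightarrow> 0 \<le> B i" "\<And>i x. i \<in> Basis \<Longrightarrow> \<bar>frechet_derivative \<phi> (at x) i\<bar> \<le> B i"
    by metis
  have "norm (grad \<phi> x) \<le> (\<Sum>j\<in>Basis. B j)" for x
    unfolding grad_def by (rule sum_norm_le) (simp add: B)
  moreover have "0 \<le> (\<Sum>j\<in>Basis. B j)" by (simp add: B(1) sum_nonneg)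
  ultimately show ?thesis using that by blast
qed

definition conv :: "('a::euclidean_space \<Rightarrow> real) \<Rightarrow> ('a \<Rightarrow> 'b::euclidean_space) \<Rightarrow> 'a \<Rightarrow> 'b" where
  "conv \<phi> f x = (\<integral>y. \<phi> (x - y) *\<^sub>R f y \<partial>lborel)"

lemma integrable_scaleR_bounded:
  fixes f :: "'a::euclidean_space \<Rightarrow> 'b::euclidean_space" and M :: real
  assumes "integrable lborel f" "w \<in> borel_measurable borel" "\<And>x. \<bar>w x\<bar> \<le> M"
  shows "integrable lborel (\<lambda>x. w x *\<^sub>R f x)"
proof (rule Bochner_Integration.integrable_bound)
  show "integrable lborel (\<lambda>x. M * norm (f x))" using assms(1) by simp
  show "(\<lambda>x. w x *\<^sub>R f x) \<in> borel_measurable lborel" using assms by auto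
  have "norm (w x *\<^sub>R f x) \<le> norm (M * norm (f x))" for x
    using assms(3)[of x] by (simp add: mult_right_mono abs_mult)
  then show "AE x in lborel. norm (w x *\<^sub>R f x) \<le> norm (M * norm (f x))" by simp
qed

lemma smooth_borel: "smooth \<phi> \<Longrightarrow> \<phi> \<in> borel_measurable borel"
  by (rule borel_measurable_continuous_onI[OF smooth_continuous])

lemma smooth_shift_borel: "smooth \<phi> \<Longrightarrow> (\<lambda>y. \<phi> (x - y)) \<in> borel_measurable borel"
  using smooth_borel by (rule measurable_compose[rotated]) auto

lemma integrable_conv:
  fixes f :: "'a::euclidean_space \<Rightarrow> 'b::euclidean_space"
  assumes "integrable lborel f" "smooth \<phi>" "\<And>x. e \<le> norm x \<Longrightarrow> \<phi> x = 0"
  shows "integrable lborel (\<lambda>y. \<phi> (x - y) *\<^sub>R f y)"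
proof -
  obtain M where "\<And>x. \<bar>\<phi> x\<bar> \<le> M" using smooth_bounded[OF assms(2,3)] by metis
  then show ?thesis
    by (intro integrable_scaleR_bounded[OF assms(1) smooth_shift_borel[OF assms(2)], where M=M]) auto
qed

lemma grad_lipschitz:
  fixes \<phi> :: "'a::euclidean_space \<Rightarrow> real"
  assumes "smooth \<phi>" "\<And>x. e \<le> norm x \<Longrightarrow> \<phi> x = 0"
  obtains M where "0 \<le> M" "\<And>x y. norm (grad \<phi> x - grad \<phi> y) \<le> M * norm (x - y)"
proof -
  have "\<exists>M. \<forall>x y. \<bar>frechet_derivative \<phi> (at x) i - frechet_derivative \<phi> (at y) i\<bar> \<le> M * norm (x - y)"
    if i: "i \<in> Basis" for i
  proof -
    let ?d = "\<lambda>x. frechet_derivative \<phi> (at x) i"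
    have s: "smooth ?d" by (rule smooth_partial[OF assms(1) i])
    have z: "?d x = 0" if "e + 1 \<le> norm x" for x
      by (rule partial_eq_0_outside[of e]) (use assms(2) that in auto)
    obtain B where "norm (grad ?d x) \<le> B" for x
      using grad_bounded[OF s z] by metis
    then have "norm (?d x - ?d y) \<le> B * norm (x - y)" for x y
      by (intro differentiable_bound[where f'="\<lambda>x h. grad ?d x \<bullet> h" and S=UNIV])
        (auto intro!: has_derivative_grad smooth_differentiable[OF s] onorm_le
          order_trans[OF Cauchy_Schwarz_ineq2] mult_right_mono)
    then show ?thesis by auto
  qed
  then obtain M where M: "\<And>i x y. i \<in> Basis \<Longrightarrow>
      \<bar>frechet_derivative \<phi> (at x) i - frechet_derivative \<phi> (at y) i\<bar> \<le> M i * norm (x - y)" by metis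
  have "norm (grad \<phi> x - grad \<phi> y) \<le> (\<Sum>i\<in>Basis. M i) * norm (x - y)" for x y
    unfolding grad_def sum_subtractf[symmetric] scaleR_diff_left[symmetric] sum_distrib_right
    by (rule sum_norm_le) (simp add: M)
  moreover have "norm (grad \<phi> x - grad \<phi> y) \<le> max 0 (\<Sum>i\<in>Basis. M i) * norm (x - y)" for x y
    using calculation[of x y] by (rule order_trans) (simp add: mult_right_mono)
  ultimately show ?thesis by (intro that[of "max 0 (\<Sum>i\<in>Basis. M i)"]) auto
qed

text \<open>
  A second-order remainder that is uniform in \<open>x\<close>. Differentiation under the convolution integral
  rests on it.
\<close>

lemma smooth_taylor:
  fixes \<phi> :: "'a::euclidean_space \<Rightarrow> real"
  assumes "smooth \<phi>" "\<And>x y. norm (grad \<phi> x - grad \<phi> y) \<le> M * norm (x - y)"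
  shows "\<bar>\<phi> (x + h) - \<phi> x - grad \<phi> x \<bullet> h\<bar> \<le> M * (norm h)\<^sup>2"
proof -
  have M: "0 \<le> M \<or> h = 0"
    using assms(2)[of h 0] by (metis diff_zero mult_less_0_iff norm_ge_zero norm_le_zero_iff not_le order_trans)
  have "norm (\<phi> (x + h) - \<phi> x - grad \<phi> x \<bullet> ((x + h) - x)) \<le> norm ((x + h) - x) * (M * norm h)"
  proof (rule differentiable_bound_linearization[where S="cball x (norm h)" and f'="\<lambda>x h. grad \<phi> x \<bullet> h"])
    show "x + t *\<^sub>R (x + h - x) \<in> cball x (norm h)" if "t \<in> {0..1}" for t
      using that by (simp add: dist_norm mult_left_le_one_le)
    show "(\<phi> has_derivative (\<lambda>h. grad \<phi> z \<bullet> h)) (at z within cball x (norm h))" for z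
      by (rule has_derivative_at_withinI[OF has_derivative_grad[OF smooth_differentiable[OF assms(1)]]])
    fix z assume "z \<in> cball x (norm h)"
    then have z: "norm (z - x) \<le> norm h" by (simp add: dist_norm norm_minus_commute)
    have "norm (grad \<phi> z - grad \<phi> x) \<le> M * norm h"
      using assms(2)[of z x] z M by (metis (no_types, opaque_lifting) mult_left_mono norm_zero order_trans mult_zero_right norm_le_zero_iff)
    then show "onorm ((\<lambda>h. grad \<phi> z \<bullet> h) - (\<lambda>h. grad \<phi> x \<bullet> h)) \<le> M * norm h"
      by (intro onorm_le) (auto simp: inner_diff_left[symmetric] intro!: order_trans[OF Cauchy_Schwarz_ineq2] mult_right_mono)
  qed simp
  then show ?thesis by (simp add: power2_eq_square algebra_simps)
qed

lemma integrable_grad_conv: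
  fixes f :: "'a::euclidean_space \<Rightarrow> real"
  assumes "integrable lborel f" "smooth \<phi>" "\<And>x. e \<le> norm x \<Longrightarrow> \<phi> x = 0"
  shows "integrable lborel (\<lambda>y. f y *\<^sub>R grad \<phi> (x - y))"
  proof -
  obtain B where gb: "norm (grad \<phi> x) \<le> B" for x
    using grad_bounded[OF assms(2,3)] by metis
  show ?thesis
  proof (rule Bochner_Integration.integrable_bound)
    show "integrable lborel (\<lambda>y. B * norm (f y))" using assms(1) by simp
    have [measurable]: "(\<lambda>y. grad \<phi> (x - y)) \<in> borel_measurable borel"
      using borel_measurable_continuous_onI[OF smooth_grad_continuous[OF assms(2)]]
      by (rule measurable_compose[rotated]) auto
    show "(\<lambda>y. f y *\<^sub>R grad \<phi> (x - y)) \<in> borel_measurable lborel" using assms(1) by auto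
    have "norm (f y *\<^sub>R grad \<phi> (x - y)) \<le> norm (B * norm (f y))" for y
      using mult_right_mono[OF gb[of "x - y"], of "\<bar>f y\<bar>"] order_trans[OF norm_ge_zero gb]
      by (simp add: abs_mult mult.commute)
    then show "AE y in lborel. norm (f y *\<^sub>R grad \<phi> (x - y)) \<le> norm (B * norm (f y))"
      by simp
  qed
qed

text \<open>
  By the uniform Taylor estimate the linearisation error of the convolution is at most \<open>M * (norm
  h)\<^sup>2\<close> times the \<open>L\<^sup>1\<close> norm of \<open>f\<close>.
\<close>

lemma conv_has_derivative:
  fixes f :: "'a::euclidean_space \<Rightarrow> real"
  assumes "integrable lborel f" "smooth \<phi>" "\<And>x. e \<le> norm x \<Longrightarrow> \<phi> x = 0"
  shows "(conv \<phi> f has_derivative (\<lambda>h. (\<integral>y. f y *\<^sub>R grad \<phi> (x - y) \<partial>lborel) \<bullet> h)) (at x)"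
proof -
  obtain M where M: "0 \<le> M" "\<And>x y. norm (grad \<phi> x - grad \<phi> y) \<le> M * norm (x - y)"
    using grad_lipschitz[OF assms(2,3)] by metis
  note gi = integrable_grad_conv[OF assms(1,2,3)]
  let ?I = "\<integral>y. \<bar>f y\<bar> \<partial>lborel"
  have I0: "0 \<le> ?I" by simp
  have main: "\<bar>conv \<phi> f (x + h) - conv \<phi> f x - (\<integral>y. f y *\<^sub>R grad \<phi> (x - y) \<partial>lborel) \<bullet> h\<bar> \<le> M * ?I * (norm h)\<^sup>2" for h
  proof -
    have i1: "integrable lborel (\<lambda>y. \<phi> (z - y) * f y)" for z
      using integrable_conv[OF assms(1,2,3)] by simp
    have i2: "integrable lborel (\<lambda>y. (f y *\<^sub>R grad \<phi> (x - y)) \<bullet> h)"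
      by (intro integrable_inner_left gi)
    have "conv \<phi> f (x + h) - conv \<phi> f x - (\<integral>y. f y *\<^sub>R grad \<phi> (x - y) \<partial>lborel) \<bullet> h
        = (\<integral>y. \<phi> (x + h - y) * f y - \<phi> (x - y) * f y - (f y *\<^sub>R grad \<phi> (x - y)) \<bullet> h \<partial>lborel)"
      by (simp add: conv_def i1 gi integral_inner_left[OF gi] Bochner_Integration.integral_diff i2 del: inner_scaleR_left)
    also have "\<bar>\<dots>\<bar> \<le> (\<integral>y. (M * (norm h)\<^sup>2) * \<bar>f y\<bar> \<partial>lborel)"
    proof (rule integral_abs_bound[THEN order_trans], rule integral_mono)
      show "integrable lborel (\<lambda>y. (M * (norm h)\<^sup>2) * \<bar>f y\<bar>)" using assms(1) by simp
      show "integrable lborel (\<lambda>y. \<bar>\<phi> (x + h - y) * f y - \<phi> (x - y) * f y - (f y *\<^sub>R grad \<phi> (x - y)) \<bullet> h\<bar>)"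
        by (intro integrable_abs Bochner_Integration.integrable_diff i1 i2)
      fix y
      have "\<phi> (x + h - y) * f y - \<phi> (x - y) * f y - (f y *\<^sub>R grad \<phi> (x - y)) \<bullet> h
          = f y * (\<phi> ((x - y) + h) - \<phi> (x - y) - grad \<phi> (x - y) \<bullet> h)"
        by (simp add: algebra_simps)
      then show "\<bar>\<phi> (x + h - y) * f y - \<phi> (x - y) * f y - (f y *\<^sub>R grad \<phi> (x - y)) \<bullet> h\<bar> \<le> M * (norm h)\<^sup>2 * \<bar>f y\<bar>"
        using mult_right_mono[OF smooth_taylor[OF assms(2) M(2), of "x - y" h], of "\<bar>f y\<bar>"]
        by (simp add: abs_mult mult.commute)
    qed
    finally show ?thesis by (simp add: mult_ac)
  qed
  show ?thesis
    unfolding has_derivative_at_alt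
  proof (intro conjI allI impI)
    show "bounded_linear (\<lambda>h. (\<integral>y. f y *\<^sub>R grad \<phi> (x - y) \<partial>lborel) \<bullet> h)"
      by (rule bounded_linear_inner_right)
    fix c :: real assume c: "c > 0"
    show "\<exists>d>0. \<forall>y. norm (y - x) < d \<longrightarrow>
          norm (conv \<phi> f y - conv \<phi> f x - (\<integral>y. f y *\<^sub>R grad \<phi> (x - y) \<partial>lborel) \<bullet> (y - x)) \<le> c * norm (y - x)"
    proof (intro exI[of _ "c / (M * ?I + 1)"] conjI allI impI)
      have pos: "M * ?I + 1 > 0" using M(1) I0 by (simp add: add_nonneg_pos)
      show "c / (M * ?I + 1) > 0" using c pos by simp
      fix y assume y: "norm (y - x) < c / (M * ?I + 1)"
      have "M * ?I * norm (y - x) \<le> (M * ?I + 1) * norm (y - x)" by (simp add: algebra_simps)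
      also have "\<dots> \<le> c" using y pos by (simp add: field_simps)
      finally have "M * ?I * norm (y - x) * norm (y - x) \<le> c * norm (y - x)"
        by (rule mult_right_mono) simp
      then show "norm (conv \<phi> f y - conv \<phi> f x - (\<integral>y. f y *\<^sub>R grad \<phi> (x - y) \<partial>lborel) \<bullet> (y - x)) \<le> c * norm (y - x)"
        using main[of "y - x"] by (simp add: power2_eq_square mult.assoc)
    qed
  qed
qed

lemma grad_conv:
  fixes f :: "'a::euclidean_space \<Rightarrow> real"
  assumes "integrable lborel f" "smooth \<phi>" "\<And>x. e \<le> norm x \<Longrightarrow> \<phi> x = 0"
  shows "grad (conv \<phi> f) x = (\<integral>y. f y *\<^sub>R grad \<phi> (x - y) \<partial>lborel)"
  by (rule grad_unique[OF conv_has_derivative[OF assms]])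

text \<open>
  Derivatives of a convolution fall on the kernel, so the convolutions of \<open>f\<close> with smooth kernels
  that vanish outside some ball are closed under partial derivatives.
\<close>

lemma smooth_conv:
  fixes f :: "'a::euclidean_space \<Rightarrow> real"
  assumes f: "integrable lborel f" and "smooth \<phi>" "\<And>x. e \<le> norm x \<Longrightarrow> \<phi> x = 0"
  shows "smooth (conv \<phi> f)"
proof (rule smooth_coinduct)
  let ?S = "{conv \<phi> f |\<phi> e. smooth \<phi> \<and> (\<forall>x. e \<le> norm x \<longrightarrow> \<phi> x = 0)}"
  show "conv \<phi> f \<in> ?S" using assms by blast
  fix g :: "'a \<Rightarrow> real" and x
  assume "g \<in> ?S"
  then obtain \<phi> e where g: "g = conv \<phi> f" and \<phi>: "smooth \<phi>" "\<And>x. e \<le> norm x \<Longrightarrow> \<phi> x = 0" by blast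
  note D = conv_has_derivative[OF f \<phi>]
  show "g differentiable (at x)" using D g differentiable_def by blast
  fix i :: 'a assume i: "i \<in> Basis"
  have "frechet_derivative g (at x) i = conv (\<lambda>x. frechet_derivative \<phi> (at x) i) f x" for x
  proof -
    have "(\<integral>y. f y *\<^sub>R grad \<phi> (x - y) \<partial>lborel) \<bullet> i = (\<integral>y. (f y *\<^sub>R grad \<phi> (x - y)) \<bullet> i \<partial>lborel)"
      by (rule integral_inner_left[symmetric]) (rule integrable_grad_conv[OF f \<phi>])
    then show ?thesis
      using frechet_derivative_at[OF D[where x=x], symmetric] i
      by (simp add: g conv_def grad_inner_Basis mult.commute)
  qed
  then have "(\<lambda>x. frechet_derivative g (at x) i) = conv (\<lambda>x. frechet_derivative \<phi> (at x) i) f" by auto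
  moreover have "smooth (\<lambda>x. frechet_derivative \<phi> (at x) i)" by (rule smooth_partial[OF \<phi>(1) i])
  (* The radius is enlarged since the derivative is only known to vanish where the kernel vanishes
     nearby. *)
  moreover have "\<forall>x. e + 1 \<le> norm x \<longrightarrow> frechet_derivative \<phi> (at x) i = 0"
    using partial_eq_0_outside[of e \<phi>, OF \<phi>(2)] by auto
  ultimately show "(\<lambda>x. frechet_derivative g (at x) i) \<in> ?S" by blast
qed

section \<open>Translations, reflections, and inequalities for powers\<close>

lemma lborel_distr_reflect: "distr lborel borel (\<lambda>y. x - y) = (lborel :: 'a::euclidean_space measure)"
  using lborel_affine[of "-1" x] by (simp add: density_1)

lemma lborel_distr_shift: "distr lborel borel (\<lambda>y. y + h) = (lborel :: 'a::euclidean_space measure)"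
  using lborel_affine[of 1 h] by (simp add: density_1 add.commute)

lemma nn_integral_reflect:
  fixes f :: "'a::euclidean_space \<Rightarrow> ennreal"
  assumes "f \<in> borel_measurable borel"
  shows "(\<integral>\<^sup>+y. f (x - y) \<partial>lborel) = (\<integral>\<^sup>+y. f y \<partial>lborel)"
  using nn_integral_distr[of "\<lambda>y. x - y" lborel borel f] assms by (simp add: lborel_distr_reflect)

lemma nn_integral_shift:
  fixes f :: "'a::euclidean_space \<Rightarrow> ennreal"
  assumes "f \<in> borel_measurable borel"
  shows "(\<integral>\<^sup>+y. f (y + h) \<partial>lborel) = (\<integral>\<^sup>+y. f y \<partial>lborel)"
  using nn_integral_distr[of "\<lambda>y. y + h" lborel borel f] assms by (simp add: lborel_distr_shift)

lemma integral_reflect: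
  fixes f :: "'a::euclidean_space \<Rightarrow> 'b::euclidean_space"
  assumes "f \<in> borel_measurable borel"
  shows "(\<integral>y. f (x - y) \<partial>lborel) = (\<integral>y. f y \<partial>lborel)"
  using integral_distr[of "\<lambda>y. x - y" lborel borel f] assms by (simp add: lborel_distr_reflect)

lemma integral_shift:
  fixes f :: "'a::euclidean_space \<Rightarrow> 'b::euclidean_space"
  assumes "f \<in> borel_measurable borel"
  shows "(\<integral>y. f (y + h) \<partial>lborel) = (\<integral>y. f y \<partial>lborel)"
  using integral_distr[of "\<lambda>y. y + h" lborel borel f] assms by (simp add: lborel_distr_shift)

lemma integrable_shift:
  fixes f :: "'a::euclidean_space \<Rightarrow> 'b::euclidean_space"
  assumes "integrable lborel f"
  shows "integrable lborel (\<lambda>y. f (y + h))"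
  using integrable_distr_eq[of "\<lambda>y. y + h" lborel borel f] assms by (simp add: lborel_distr_shift)

lemma integrable_reflect:
  fixes f :: "'a::euclidean_space \<Rightarrow> 'b::euclidean_space"
  assumes "integrable lborel f"
  shows "integrable lborel (\<lambda>y. f (x - y))"
  using integrable_distr_eq[of "\<lambda>y. x - y" lborel borel f] assms by (simp add: lborel_distr_reflect)

lemma powr_add3_le:
  fixes a b c p :: real
  assumes "0 \<le> a" "0 \<le> b" "0 \<le> c" "0 \<le> p"
  shows "(a + b + c) powr p \<le> 3 powr p * (a powr p + b powr p + c powr p)"
proof -
  let ?m = "max a (max b c)"
  have "(a + b + c) powr p \<le> (3 * ?m) powr p" using assms by (intro powr_mono2) auto
  also have "\<dots> = 3 powr p * ?m powr p" using assms by (simp add: powr_mult)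
  also have "?m powr p \<le> a powr p + b powr p + c powr p"
    using powr_ge_zero[of a p] powr_ge_zero[of b p] powr_ge_zero[of c p] unfolding max_def
    by auto
  finally show ?thesis by (simp add: mult_left_mono)
qed

lemma powr_Young:
  fixes a m p :: real
  assumes "1 \<le> p" "0 \<le> a" "0 \<le> m"
  shows "a * m powr (p - 1) \<le> a powr p / p + m powr p * (1 - 1 / p)"
proof (cases "p = 1")
  case True
  then show ?thesis using assms by (cases "m = 0") (auto simp: powr_one)
next
  case False
  with assms have p: "1 < p" by simp
  let ?q = "p / (p - 1)"
  have "a * m powr (p - 1) \<le> a powr p / p + (m powr (p - 1)) powr ?q / ?q"
    using p assms by (intro Youngs_inequality) (auto simp: field_simps)
  also have "(m powr (p - 1)) powr ?q = m powr p" using p by (simp add: powr_powr)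
  also have "m powr p / ?q = m powr p * (1 - 1 / p)" using p by (simp add: field_simps)
  finally show ?thesis .
qed

text \<open>
  With \<open>m\<close> the weighted mean of \<open>F\<close>, Young's inequality \<open>F * m\<^bsup>p-1\<^esup> \<le> F\<^bsup>p\<^esup> / p + (1 - 1 / p) *
  m\<^bsup>p\<^esup>\<close> is integrated against the weight. If one of the integrands is not integrable, then the
  right-hand side is infinite or the integral on the left is \<open>0\<close>.
\<close>

lemma Jensen_powr:
  fixes w F :: "'a \<Rightarrow> real"
  assumes p: "1 \<le> p" and w: "integrable M w" "(\<integral>x. w x \<partial>M) = 1" "\<And>x. 0 \<le> w x"
    and F: "F \<in> borel_measurable M" "\<And>x. 0 \<le> F x"
  shows "ennreal ((\<integral>x. w x * F x \<partial>M) powr p) \<le> (\<integral>\<^sup>+x. ennreal (w x * F x powr p) \<partial>M)"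
proof (cases "integrable M (\<lambda>x. w x * F x powr p) \<and> integrable M (\<lambda>x. w x * F x)")
  case True
  let ?m = "\<integral>x. w x * F x \<partial>M"
  have m0: "0 \<le> ?m" using w F by (intro integral_nonneg_AE) auto
  have "?m * ?m powr (p - 1) = (\<integral>x. w x * F x * ?m powr (p - 1) \<partial>M)" by simp
  also have "\<dots> \<le> (\<integral>x. w x * F x powr p * (1 / p) + w x * (?m powr p * (1 - 1 / p)) \<partial>M)"
  proof (rule integral_mono)
    fix x
    have "w x * (F x * ?m powr (p - 1)) \<le> w x * (F x powr p / p + ?m powr p * (1 - 1 / p))"
      by (rule mult_left_mono[OF powr_Young[OF p F(2) m0] w(3)])
    then show "w x * F x * ?m powr (p - 1) \<le> w x * F x powr p * (1 / p) + w x * (?m powr p * (1 - 1 / p))"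
      by (simp add: distrib_left divide_inverse mult_ac)
  qed (use True w(1) in auto)
  also have "\<dots> = (\<integral>x. w x * F x powr p \<partial>M) * (1 / p) + (\<integral>x. w x \<partial>M) * (?m powr p * (1 - 1 / p))"
    using True w(1) by (subst Bochner_Integration.integral_add) auto
  finally have "?m powr p \<le> (\<integral>x. w x * F x powr p \<partial>M) * (1 / p) + ?m powr p * (1 - 1 / p)"
    using m0 w(2) by (simp add: powr_mult_base)
  then have "?m powr p * (1 / p) \<le> (\<integral>x. w x * F x powr p \<partial>M) * (1 / p)"
    by (simp add: algebra_simps)
  then have "?m powr p \<le> (\<integral>x. w x * F x powr p \<partial>M)"
    using p by (simp add: divide_le_cancel)
  then have "ennreal (?m powr p) \<le> ennreal (\<integral>x. w x * F x powr p \<partial>M)" by (rule ennreal_leI)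
  also have "\<dots> = (\<integral>\<^sup>+x. ennreal (w x * F x powr p) \<partial>M)"
    using True w F by (intro nn_integral_eq_integral[symmetric]) auto
  finally show ?thesis .
next
  case False
  show ?thesis
  proof (cases "integrable M (\<lambda>x. w x * F x)")
    case True
    then have "\<not> integrable M (\<lambda>x. w x * F x powr p)" using False by simp
    moreover have "(\<lambda>x. w x * F x powr p) \<in> borel_measurable M" using w F by measurable
    ultimately have "(\<integral>\<^sup>+x. ennreal (w x * F x powr p) \<partial>M) = \<infinity>"
      using w(3) by (subst (asm) integrable_iff_bounded) (auto simp: abs_mult less_top[symmetric])
    then show ?thesis by simp
  next
    case False
    then show ?thesis using p by (simp add: not_integrable_integral_eq)
  qed
qed

section \<open>Mollification in the Lebesgue spaces\<close>

text \<open>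
  The bump rescaled to the ball of radius \<open>\<epsilon>\<close> and normalised to have integral \<open>1\<close>.
\<close>

definition mol :: "real \<Rightarrow> 'a::euclidean_space \<Rightarrow> real" where
  "mol \<epsilon> x = flat 0 (1 - ((1 / \<epsilon>) *\<^sub>R x) \<bullet> ((1 / \<epsilon>) *\<^sub>R x))
    / (\<integral>x. flat 0 (1 - ((1 / \<epsilon>) *\<^sub>R x) \<bullet> ((1 / \<epsilon>) *\<^sub>R (x :: 'a))) \<partial>lborel)"

lemma flat_nonneg: "0 \<le> flat m t"
  by (simp add: flat_def)

lemma mol_smooth: "smooth (mol \<epsilon> :: 'a::euclidean_space \<Rightarrow> real)"
  using smooth_affine[OF smooth_bump, of "1 / (\<integral>x. flat 0 (1 - ((1 / \<epsilon>) *\<^sub>R x) \<bullet> ((1 / \<epsilon>) *\<^sub>R (x :: 'a))) \<partial>lborel)" 0 "1 / \<epsilon>"]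
  by (simp add: mol_def[abs_def])

lemma mol_nonneg: "0 \<le> mol \<epsilon> x"
  by (simp add: mol_def flat_nonneg)

lemma bump_support:
  fixes x :: "'a::euclidean_space"
  assumes "0 < \<epsilon>"
  shows "flat 0 (1 - ((1 / \<epsilon>) *\<^sub>R x) \<bullet> ((1 / \<epsilon>) *\<^sub>R x)) > 0 \<longleftrightarrow> norm x < \<epsilon>"
proof -
  have "((1 / \<epsilon>) *\<^sub>R x) \<bullet> ((1 / \<epsilon>) *\<^sub>R x) = (norm x / \<epsilon>)\<^sup>2"
    using power2_norm_eq_inner[of "(1 / \<epsilon>) *\<^sub>R x"] assms by simp
  then show ?thesis using assms by (simp add: flat_def abs_square_less_1)
qed

lemma mol_support: "0 < \<epsilon> \<Longrightarrow> \<epsilon> \<le> norm x \<Longrightarrow> mol \<epsilon> x = 0"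
  using bump_support[of \<epsilon> x] flat_nonneg[of 0] unfolding mol_def by (metis divide_eq_0_iff leD less_eq_real_def)

lemma integrable_smooth:
  assumes "smooth \<phi>" "\<And>x. e \<le> norm x \<Longrightarrow> \<phi> x = (0::real)"
  shows "integrable lborel \<phi>"
proof -
  obtain M where M: "\<And>x. \<bar>\<phi> x\<bar> \<le> M" "0 \<le> M" using smooth_bounded[OF assms] by metis
  show ?thesis
  proof (rule Bochner_Integration.integrable_bound)
    show "integrable lborel (\<lambda>x. M * indicator (cball 0 e) x)"
      using emeasure_lborel_cball_finite[of 0 e] by (intro integrable_mult_right integrable_real_indicator) auto
    show "\<phi> \<in> borel_measurable lborel" using smooth_borel[OF assms(1)] by simp
    show "AE x in lborel. norm (\<phi> x) \<le> norm (M * indicator (cball 0 e) x)"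
      using M assms(2) by (auto simp: indicator_def)
  qed
qed

lemma mol_integral:
  assumes "0 < \<epsilon>"
  shows "integrable lborel (mol \<epsilon> :: 'a::euclidean_space \<Rightarrow> real)" "(\<integral>x. mol \<epsilon> (x::'a) \<partial>lborel) = 1"
proof -
  show int: "integrable lborel (mol \<epsilon> :: 'a \<Rightarrow> real)"
    by (rule integrable_smooth[OF mol_smooth mol_support[OF assms]])
  let ?f = "\<lambda>x::'a. flat 0 (1 - ((1 / \<epsilon>) *\<^sub>R x) \<bullet> ((1 / \<epsilon>) *\<^sub>R x))"
  have s: "smooth ?f" using smooth_affine[OF smooth_bump, of 1 0 "1 / \<epsilon>"] by simp
  have i: "integrable lborel ?f"
  proof (rule integrable_smooth[OF s])
    fix x :: 'a assume "\<epsilon> \<le> norm x"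
    then show "?f x = 0" using bump_support[OF assms, of x] flat_nonneg by (metis leD less_eq_real_def)
  qed
  have "(\<integral>x. ?f x \<partial>lborel) \<noteq> 0"
  proof
    assume "(\<integral>x. ?f x \<partial>lborel) = 0"
    then have "AE x in lborel. ?f x = 0"
      using integral_nonneg_eq_0_iff_AE[OF i] flat_nonneg by auto
    then have "AE x in lborel. (x::'a) \<notin> ball 0 \<epsilon>"
      by eventually_elim (use bump_support[OF assms] in \<open>auto simp: less_le\<close>)
    then have "emeasure lborel (ball (0::'a) \<epsilon>) = 0"
      by (subst (asm) AE_iff_measurable[OF _ refl]) (auto simp: ball_def)
    then show False using assms content_ball_gt_0_iff[of "0::'a" \<epsilon>] by (simp add: measure_def)
  qed
  then show "(\<integral>x. mol \<epsilon> (x::'a) \<partial>lborel) = 1"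
    unfolding mol_def[abs_def] by simp
qed

text \<open>
  The function is truncated in its domain and in its values. The truncation is almost everywhere a
  limit of continuous functions; after these are pulled into a fixed ball of values and cut off in
  space, dominated convergence gives convergence in \<open>L\<^sup>p\<close>.
\<close>

lemma Lp_dense_continuous:
  fixes f :: "'a::euclidean_space \<Rightarrow> 'b::euclidean_space"
  assumes [measurable]: "f \<in> borel_measurable borel" and p: "0 < p"
    and fin: "(\<integral>\<^sup>+x. ennreal (norm (f x) powr p) \<partial>lborel) < \<infinity>" and e: "0 < e"
  obtains g K where "continuous_on UNIV g" "\<And>x. K < norm x \<Longrightarrow> g x = 0"
    "(\<integral>\<^sup>+x. ennreal (norm (f x - g x) powr p) \<partial>lborel) < e"
proof -
  define c where "c = 3 powr p"
  have c: "0 < c" by (simp add: c_def)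
  obtain e' :: real where e': "0 < e'" "ennreal (c * (2 * e')) < e"
  proof -
    obtain r where r: "0 < r" "r < e" using dense[OF e] by blast
    then obtain r' where r': "r = ennreal r'" "0 < r'" by (cases r) (auto simp: top.not_eq_extremum)
    show thesis using that[of "r' / (2 * c)"] r r' c by simp
  qed
  define F where "F n x = (if norm x \<le> real n \<and> norm (f x) \<le> real n then f x else 0)" for n x
  have [measurable]: "F n \<in> borel_measurable borel" for n unfolding F_def by measurable
  have "(\<lambda>n. \<integral>\<^sup>+x. ennreal (norm (f x - F n x) powr p) \<partial>lborel) \<longlonglongrightarrow> (\<integral>\<^sup>+(x::'a). 0 \<partial>lborel)"
  proof (rule nn_integral_dominated_convergence[where w="\<lambda>x. ennreal (norm (f x) powr p)"])
    show "AE x in lborel. ennreal (norm (f x - F j x) powr p) \<le> ennreal (norm (f x) powr p)" for j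
      by (auto simp: F_def)
    have "(\<lambda>i. ennreal (norm (f x - F i x) powr p)) \<longlonglongrightarrow> 0" for x
    proof (rule tendsto_eventually)
      show "\<forall>\<^sub>F i in sequentially. ennreal (norm (f x - F i x) powr p) = 0"
        using eventually_ge_at_top[of "nat \<lceil>max (norm x) (norm (f x))\<rceil>"]
        by eventually_elim (auto simp: F_def)
    qed
    then show "AE x in lborel. (\<lambda>i. ennreal (norm (f x - F i x) powr p)) \<longlonglongrightarrow> 0" by simp
  qed (use fin in auto)
  then have "(\<lambda>n. \<integral>\<^sup>+x. ennreal (norm (f x - F n x) powr p) \<partial>lborel) \<longlonglongrightarrow> 0" by simp
  then have "\<forall>\<^sub>F n in sequentially. (\<integral>\<^sup>+x. ennreal (norm (f x - F n x) powr p) \<partial>lborel) < ennreal e'"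
    using e'(1) by (intro order_tendstoD) auto
  then obtain n where n: "(\<integral>\<^sup>+x. ennreal (norm (f x - F n x) powr p) \<partial>lborel) < ennreal e'"
    by (auto simp: eventually_sequentially)
  have "F n \<in> borel_measurable lebesgue" using measurable_completion[of "F n" lborel borel] by simp
  then have "F n measurable_on UNIV" by (intro lebesgue_measurable_imp_measurable_on) auto
  then obtain N g where N: "negligible N" and g: "\<And>k. continuous_on UNIV (g k)"
    "\<And>x. x \<notin> N \<Longrightarrow> (\<lambda>k. g k x) \<longlonglongrightarrow> F n x"
    by (auto simp: measurable_on_def)
  (* T is the radial retraction of the target space onto the ball of radius n; it fixes the values
     of F n. *)
  define T where "T y = (real n / max (real n) (norm y)) *\<^sub>R y" for y :: 'b
  define cut where "cut x = max 0 (min 1 (real n + 1 - norm x))" for x :: 'a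
  define h where "h k x = cut x *\<^sub>R T (g k x)" for k x
  have h: "continuous_on UNIV (h k)" if "n > 0" for k
    unfolding h_def cut_def T_def using that by (intro continuous_intros g) (auto simp: max_def)
  have T: "norm (T y) \<le> real n" for y
    by (auto simp: T_def field_simps max_def)
  have hb: "norm (h k x) \<le> real n" "real n + 1 < norm x \<Longrightarrow> h k x = 0" for k x
  proof -
    have "\<bar>cut x\<bar> \<le> 1" by (auto simp: cut_def)
    then show "norm (h k x) \<le> real n" using T[of "g k x"] mult_mono[of "\<bar>cut x\<bar>" 1 "norm (T (g k x))" n] by (simp add: h_def)
  qed (simp add: h_def cut_def)
  have "\<exists>k K. continuous_on UNIV k \<and> (\<forall>x. K < norm x \<longrightarrow> k x = 0) \<and> (\<integral>\<^sup>+x. ennreal (norm (F n x - k x) powr p) \<partial>lborel) < ennreal e'"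
  proof (cases "n = 0")
    case True
    then have "F n x = 0" for x by (auto simp: F_def)
    then show ?thesis using e'(1) by (intro exI[of _ "\<lambda>_. 0"]) auto
  next
    case False
    then have n0: "n > 0" by simp
    have [measurable]: "h k \<in> borel_measurable borel" for k by (rule borel_measurable_continuous_onI[OF h[OF n0]])
    have "(\<lambda>k. \<integral>\<^sup>+x. ennreal (norm (F n x - h k x) powr p) \<partial>lborel) \<longlonglongrightarrow> (\<integral>\<^sup>+(x::'a). 0 \<partial>lborel)"
    proof (rule nn_integral_dominated_convergence[where w="\<lambda>x. ennreal ((2 * n) powr p) * indicator (cball 0 (real n + 1)) x"])
      have b: "norm (F n x - h j x) powr p \<le> (2 * n) powr p" for x j
        using norm_triangle_ineq4[of "F n x" "h j x"] hb(1)[of j x] p by (intro powr_mono2) (auto simp: F_def split: if_splits)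
      have z: "F n x - h j x = 0" if "x \<notin> cball 0 (real n + 1)" for x j
        using hb(2)[of x j] that by (auto simp: F_def)
      have "ennreal (norm (F n x - h j x) powr p) \<le> ennreal ((2 * n) powr p) * indicator (cball 0 (real n + 1)) x" for x j
        using ennreal_leI[OF b[of x j]] z[of x j] p by (cases "x \<in> cball 0 (real n + 1)") auto
      then show "AE x in lborel. ennreal (norm (F n x - h j x) powr p) \<le> ennreal ((2 * n) powr p) * indicator (cball 0 (real n + 1)) x" for j
        by simp
      show "(\<integral>\<^sup>+x. ennreal ((2 * n) powr p) * indicator (cball 0 (real n + 1)) x \<partial>(lborel::'a measure)) < \<infinity>"
        using emeasure_lborel_cball_finite[of "0::'a" "real n + 1"]
        by (subst nn_integral_cmult_indicator) (auto simp: ennreal_mult_less_top top.not_eq_extremum)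
      have "(\<lambda>k. ennreal (norm (F n x - h k x) powr p)) \<longlonglongrightarrow> 0" if "x \<notin> N" for x
      proof -
        have "(\<lambda>k. h k x) \<longlonglongrightarrow> cut x *\<^sub>R ((real n / max (real n) (norm (F n x))) *\<^sub>R F n x)"
          unfolding h_def T_def using n0 by (intro tendsto_intros g that) auto
        also have "cut x *\<^sub>R ((real n / max (real n) (norm (F n x))) *\<^sub>R F n x) = F n x"
          using n0 by (auto simp: F_def cut_def max_def)
        finally have "(\<lambda>k. norm (F n x - h k x)) \<longlonglongrightarrow> norm (F n x - F n x)"
          by (intro tendsto_intros)
        then have "(\<lambda>k. norm (F n x - h k x) powr p) \<longlonglongrightarrow> 0 powr p"
          using p by (intro tendsto_powr') auto
        then show ?thesis using p by (intro tendsto_ennrealI[where x=0, simplified]) simp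
      qed
      note lim = this
      have "AE x in lebesgue. x \<notin> N"
        by (rule AE_not_in[OF negligible_iff_null_sets[THEN iffD1, OF N]])
      then have "AE x in lborel. x \<notin> N" by (rule AE_completion_iff[THEN iffD1])
      then show "AE x in lborel. (\<lambda>k. ennreal (norm (F n x - h k x) powr p)) \<longlonglongrightarrow> 0"
        by eventually_elim (rule lim)
      show "(\<lambda>x. ennreal (norm (F n x - h i x) powr p)) \<in> borel_measurable lborel" for i by measurable
      show "(\<lambda>x::'a. 0::ennreal) \<in> borel_measurable lborel" by measurable
      show "(\<lambda>x::'a. ennreal ((2 * n) powr p) * indicator (cball 0 (real n + 1)) x) \<in> borel_measurable lborel"
        by (intro borel_measurable_times_ennreal borel_measurable_const borel_measurable_indicator) simp
    qed
    then have "(\<lambda>k. \<integral>\<^sup>+x. ennreal (norm (F n x - h k x) powr p) \<partial>lborel) \<longlonglongrightarrow> 0" by simp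
    then have "\<forall>\<^sub>F k in sequentially. (\<integral>\<^sup>+x. ennreal (norm (F n x - h k x) powr p) \<partial>lborel) < ennreal e'"
      using e'(1) by (intro order_tendstoD) auto
    then obtain k where "(\<integral>\<^sup>+x. ennreal (norm (F n x - h k x) powr p) \<partial>lborel) < ennreal e'"
      by (auto simp: eventually_sequentially)
    then show ?thesis using h[OF n0] hb(2) by blast
  qed
  then obtain k K where k: "continuous_on UNIV k" "\<And>x. K < norm x \<Longrightarrow> k x = 0"
    "(\<integral>\<^sup>+x. ennreal (norm (F n x - k x) powr p) \<partial>lborel) < ennreal e'" by blast
  have [measurable]: "k \<in> borel_measurable borel" by (rule borel_measurable_continuous_onI[OF k(1)])
  have "(\<integral>\<^sup>+x. ennreal (norm (f x - k x) powr p) \<partial>lborel)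
      \<le> (\<integral>\<^sup>+x. ennreal c * (ennreal (norm (f x - F n x) powr p) + ennreal (norm (F n x - k x) powr p)) \<partial>lborel)"
  proof (rule nn_integral_mono)
    fix x
    have "norm (f x - k x) powr p \<le> (norm (f x - F n x) + norm (F n x - k x) + 0) powr p"
      using p norm_triangle_ineq[of "f x - F n x" "F n x - k x"] by (intro powr_mono2) auto
    also have "\<dots> \<le> c * (norm (f x - F n x) powr p + norm (F n x - k x) powr p + 0 powr p)"
      unfolding c_def using p by (intro powr_add3_le) auto
    finally show "ennreal (norm (f x - k x) powr p) \<le> ennreal c * (ennreal (norm (f x - F n x) powr p) + ennreal (norm (F n x - k x) powr p))"
      using p c by (simp add: ennreal_plus[symmetric] ennreal_mult[symmetric] ennreal_leI del: ennreal_plus)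
  qed
  also have "\<dots> = ennreal c * ((\<integral>\<^sup>+x. ennreal (norm (f x - F n x) powr p) \<partial>lborel) + (\<integral>\<^sup>+x. ennreal (norm (F n x - k x) powr p) \<partial>lborel))"
    by (subst nn_integral_cmult) (auto simp: nn_integral_add)
  also have "\<dots> \<le> ennreal c * (ennreal e' + ennreal e')"
    using n k(3) by (intro mult_left_mono add_mono) auto
  also have "\<dots> = ennreal (c * (2 * e'))"
    using c e' by (simp add: ennreal_plus[symmetric] ennreal_mult[symmetric] del: ennreal_plus)
  also have "\<dots> < e" by (rule e'(2))
  finally show thesis using that k by blast
qed

lemma nn_integral_bounded_support:
  fixes f :: "'a::euclidean_space \<Rightarrow> real"
  assumes "\<And>x. f x \<le> c" "\<And>x. K < norm x \<Longrightarrow> f x = 0" "0 \<le> c"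
  shows "(\<integral>\<^sup>+x. ennreal (f x) \<partial>lborel) \<le> ennreal (c * measure lborel (cball (0::'a) K))"
proof -
  have "(\<integral>\<^sup>+x. ennreal (f x) \<partial>lborel) \<le> (\<integral>\<^sup>+x. ennreal c * indicator (cball 0 K) x \<partial>(lborel::'a measure))"
    using assms by (intro nn_integral_mono) (auto simp: indicator_def not_le intro!: ennreal_leI)
  also have "\<dots> = ennreal c * emeasure lborel (cball (0::'a) K)" by (simp add: nn_integral_cmult_indicator)
  also have "\<dots> = ennreal (c * measure lborel (cball (0::'a) K))"
    using emeasure_lborel_cball_finite[of "0::'a" K] assms(3)
    by (simp add: emeasure_eq_ennreal_measure ennreal_mult top.not_eq_extremum)
  finally show ?thesis .
qed

text \<open>
  Continuous functions with bounded support are uniformly continuous, so the assertion holds for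
  them; the general case follows by density, the \<open>L\<^sup>p\<close> distance being translation invariant.
\<close>

lemma Lp_translation:
  fixes f :: "'a::euclidean_space \<Rightarrow> 'b::euclidean_space"
  assumes f[measurable]: "f \<in> borel_measurable borel" and p: "0 < p"
    and fin: "(\<integral>\<^sup>+x. ennreal (norm (f x) powr p) \<partial>lborel) < \<infinity>" and e: "0 < e"
  shows "\<exists>d>0. \<forall>z. norm z < d \<longrightarrow> (\<integral>\<^sup>+x. ennreal (norm (f (x - z) - f x) powr p) \<partial>lborel) \<le> ennreal e"
proof -
  define c where "c = 3 powr p"
  have c: "0 < c" by (simp add: c_def)
  define e' where "e' = e / (3 * c)"
  have e': "0 < e'" using e c by (simp add: e'_def)
  obtain g K where g: "continuous_on UNIV g" "\<And>x. K < norm x \<Longrightarrow> g x = 0"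
    "(\<integral>\<^sup>+x. ennreal (norm (f x - g x) powr p) \<partial>lborel) < ennreal e'"
    using Lp_dense_continuous[OF f p fin, of "ennreal e'"] e' by auto
  have [measurable]: "g \<in> borel_measurable borel" by (rule borel_measurable_continuous_onI[OF g(1)])
  define V where "V = measure lborel (cball (0::'a) (K + 1))"
  have V: "0 \<le> V" by (simp add: V_def)
  define \<eta> where "\<eta> = (e' / (V + 1)) powr (1 / p)"
  have \<eta>: "0 < \<eta>" using e' V by (simp add: \<eta>_def)
  have \<eta>p: "\<eta> powr p * V \<le> e'"
    using e' V p by (simp add: \<eta>_def powr_powr field_simps)
  have "uniformly_continuous_on (cball 0 (K + 2)) g"
    by (rule compact_uniformly_continuous[OF continuous_on_subset[OF g(1)]]) auto
  then obtain d where d: "d > 0" "\<And>x y. x \<in> cball 0 (K + 2) \<Longrightarrow> y \<in> cball 0 (K + 2) \<Longrightarrow> dist y x < d \<Longrightarrow> dist (g y) (g x) < \<eta>"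
    using \<eta> unfolding uniformly_continuous_on_def by metis
  show ?thesis
  proof (intro exI[of _ "min d 1"] conjI allI impI)
    show "0 < min d 1" using d by simp
    fix z :: 'a assume z: "norm z < min d 1"
    have gz: "norm (g (x - z) - g x) \<le> \<eta>" "K + 1 < norm x \<Longrightarrow> g (x - z) - g x = 0" for x
    proof -
      have n: "norm (x - z) \<le> norm x + 1" "norm x \<le> norm (x - z) + 1"
        using z norm_triangle_ineq4[of x z] norm_triangle_ineq[of "x - z" z] by auto
      show "norm (g (x - z) - g x) \<le> \<eta>"
      proof (cases "norm x \<le> K + 1")
        case True
        then have "dist (g (x - z)) (g x) < \<eta>"
          using n z by (intro d(2)) (auto simp: mem_cball_0 dist_norm simp del: mem_cball)
        then show ?thesis by (simp add: dist_norm)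
      next
        case False
        then show ?thesis using g(2)[of x] g(2)[of "x - z"] n \<eta> by auto
      qed
      show "g (x - z) - g x = 0" if "K + 1 < norm x"
        using g(2)[of x] g(2)[of "x - z"] n that by auto
    qed
    have A: "(\<integral>\<^sup>+x. ennreal (norm (g (x - z) - g x) powr p) \<partial>lborel) \<le> ennreal e'"
    proof -
      have "(\<integral>\<^sup>+x. ennreal (norm (g (x - z) - g x) powr p) \<partial>lborel) \<le> ennreal (\<eta> powr p * V)"
        unfolding V_def using gz p \<eta> by (intro nn_integral_bounded_support powr_mono2) auto
      also have "\<dots> \<le> ennreal e'" by (rule ennreal_leI[OF \<eta>p])
      finally show ?thesis .
    qed
    have B: "(\<integral>\<^sup>+x. ennreal (norm (f (x - z) - g (x - z)) powr p) \<partial>lborel) \<le> ennreal e'"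
      using nn_integral_shift[of "\<lambda>x. ennreal (norm (f x - g x) powr p)" "- z"] g(3) by simp
    have C: "(\<integral>\<^sup>+x. ennreal (norm (f x - g x) powr p) \<partial>lborel) \<le> ennreal e'" using g(3) by simp
    have "(\<integral>\<^sup>+x. ennreal (norm (f (x - z) - f x) powr p) \<partial>lborel)
      \<le> (\<integral>\<^sup>+x. ennreal c * (ennreal (norm (f (x - z) - g (x - z)) powr p) + ennreal (norm (g (x - z) - g x) powr p)
            + ennreal (norm (f x - g x) powr p)) \<partial>lborel)"
    proof (rule nn_integral_mono)
      fix x
      have "norm (f (x - z) - f x) powr p \<le> (norm (f (x - z) - g (x - z)) + norm (g (x - z) - g x) + norm (f x - g x)) powr p"
        using p norm_triangle_ineq[of "f (x - z) - g (x - z) + (g (x - z) - g x)" "g x - f x"]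
          norm_triangle_ineq[of "f (x - z) - g (x - z)" "g (x - z) - g x"]
        by (intro powr_mono2) (auto simp: norm_minus_commute)
      also have "\<dots> \<le> c * (norm (f (x - z) - g (x - z)) powr p + norm (g (x - z) - g x) powr p + norm (f x - g x) powr p)"
        unfolding c_def using p by (intro powr_add3_le) auto
      finally show "ennreal (norm (f (x - z) - f x) powr p) \<le> ennreal c * (ennreal (norm (f (x - z) - g (x - z)) powr p)
          + ennreal (norm (g (x - z) - g x) powr p) + ennreal (norm (f x - g x) powr p))"
        using p c by (simp add: ennreal_plus[symmetric] ennreal_mult[symmetric] ennreal_leI del: ennreal_plus)
    qed
    also have "\<dots> = ennreal c * ((\<integral>\<^sup>+x. ennreal (norm (f (x - z) - g (x - z)) powr p) \<partial>lborel)
        + (\<integral>\<^sup>+x. ennreal (norm (g (x - z) - g x) powr p) \<partial>lborel) + (\<integral>\<^sup>+x. ennreal (norm (f x - g x) powr p) \<partial>lborel))"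
      by (subst nn_integral_cmult) (auto simp: nn_integral_add)
    also have "\<dots> \<le> ennreal c * (ennreal e' + ennreal e' + ennreal e')"
      using A B C by (intro mult_left_mono add_mono) auto
    also have "\<dots> = ennreal (c * (3 * e'))"
      using c e' by (simp add: ennreal_plus[symmetric] ennreal_mult[symmetric] del: ennreal_plus)
    also have "c * (3 * e') = e" using c by (simp add: e'_def)
    finally show "(\<integral>\<^sup>+x. ennreal (norm (f (x - z) - f x) powr p) \<partial>lborel) \<le> ennreal e" .
  qed
qed

lemma tendsto_0_if_eventually_le:
  fixes f :: "nat \<Rightarrow> ennreal"
  assumes "\<And>e::real. 0 < e \<Longrightarrow> \<forall>\<^sub>F n in sequentially. f n \<le> ennreal e"
  shows "f \<longlonglongrightarrow> 0"
proof (rule order_tendstoI)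
  fix a :: ennreal assume "0 < a"
  then obtain r where r: "0 < r" "r < a" using dense by blast
  then obtain r' where "r = ennreal r'" "0 < r'" by (cases r) (auto simp: top.not_eq_extremum)
  then show "\<forall>\<^sub>F n in sequentially. f n < a"
    using assms[of r'] r by (auto elim!: eventually_mono)
qed auto

lemma conv_alt:
  fixes f :: "'a::euclidean_space \<Rightarrow> 'b::euclidean_space"
  assumes [measurable]: "f \<in> borel_measurable borel" "\<phi> \<in> borel_measurable borel"
  shows "conv \<phi> f x = (\<integral>z. \<phi> z *\<^sub>R f (x - z) \<partial>lborel)"
  unfolding conv_def using integral_reflect[of "\<lambda>z. \<phi> z *\<^sub>R f (x - z)" x] by simp

lemma integrable_conv_alt:
  fixes f :: "'a::euclidean_space \<Rightarrow> 'b::euclidean_space"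
  assumes "integrable lborel f" "0 < \<epsilon>"
  shows "integrable lborel (\<lambda>z. mol \<epsilon> z *\<^sub>R f (x - z))"
proof -
  have "integrable lborel (\<lambda>y. mol \<epsilon> (x - y) *\<^sub>R f y)"
    by (rule integrable_conv[OF assms(1) mol_smooth mol_support[OF assms(2)]])
  from integrable_reflect[OF this, where x=x] show ?thesis by simp
qed

text \<open>
  The error \<open>conv (mol \<epsilon>) f x - f x\<close> is the average of \<open>f (x - z) - f x\<close> over \<open>norm z < \<epsilon>\<close>.
  Jensen's inequality and Fubini's theorem bound its \<open>L\<^sup>p\<close> norm by that of the translation errors.
\<close>

lemma mollification_Lp:
  fixes f :: "'a::euclidean_space \<Rightarrow> 'b::euclidean_space"
  assumes int: "integrable lborel f" and p: "1 \<le> p"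
    and fin: "(\<integral>\<^sup>+x. ennreal (norm (f x) powr p) \<partial>lborel) < \<infinity>"
    and \<epsilon>: "\<And>n. 0 < \<epsilon> n" "\<epsilon> \<longlonglongrightarrow> 0"
  shows "(\<lambda>n. \<integral>\<^sup>+x. ennreal (norm (conv (mol (\<epsilon> n)) f x - f x) powr p) \<partial>lborel) \<longlonglongrightarrow> 0"
proof (rule tendsto_0_if_eventually_le)
  have f[measurable]: "f \<in> borel_measurable borel" using int by auto
  have m[measurable]: "mol \<epsilon> \<in> borel_measurable borel" for \<epsilon> by (rule smooth_borel[OF mol_smooth])
  fix e :: real assume e: "0 < e"
  obtain d where d: "d > 0" "\<And>z. norm z < d \<Longrightarrow> (\<integral>\<^sup>+x. ennreal (norm (f (x - z) - f x) powr p) \<partial>lborel) \<le> ennreal e"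
    using Lp_translation[OF f _ fin e] p by auto
  have "\<forall>\<^sub>F n in sequentially. \<epsilon> n < d" using \<epsilon>(2) d(1) by (rule order_tendstoD)
  then show "\<forall>\<^sub>F n in sequentially. (\<integral>\<^sup>+x. ennreal (norm (conv (mol (\<epsilon> n)) f x - f x) powr p) \<partial>lborel) \<le> ennreal e"
  proof eventually_elim
    case (elim n)
    let ?m = "mol (\<epsilon> n) :: 'a \<Rightarrow> real"
    note mi = mol_integral[OF \<epsilon>(1)[of n], where 'a='a]
    have "(\<integral>\<^sup>+x. ennreal (norm (conv ?m f x - f x) powr p) \<partial>lborel)
      \<le> (\<integral>\<^sup>+x. \<integral>\<^sup>+z. ennreal (?m z * norm (f (x - z) - f x) powr p) \<partial>lborel \<partial>lborel)"
    proof (rule nn_integral_mono)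
      fix x
      have "conv ?m f x - f x = (\<integral>z. ?m z *\<^sub>R f (x - z) \<partial>lborel) - (\<integral>z. ?m z *\<^sub>R f x \<partial>lborel)"
        using mi by (simp add: conv_alt)
      also have "\<dots> = (\<integral>z. ?m z *\<^sub>R (f (x - z) - f x) \<partial>lborel)"
        using mi(1) by (subst Bochner_Integration.integral_diff[symmetric, OF integrable_conv_alt[OF int \<epsilon>(1)]])
          (auto simp: scaleR_diff_right)
      finally have "norm (conv ?m f x - f x) \<le> (\<integral>z. norm (?m z *\<^sub>R (f (x - z) - f x)) \<partial>lborel)"
        using integral_norm_bound by metis
      also have "\<dots> = (\<integral>z. ?m z * norm (f (x - z) - f x) \<partial>lborel)" by (simp add: mol_nonneg)
      finally have "norm (conv ?m f x - f x) powr p \<le> (\<integral>z. ?m z * norm (f (x - z) - f x) \<partial>lborel) powr p"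
        using p by (intro powr_mono2) auto
      also have "ennreal \<dots> \<le> (\<integral>\<^sup>+z. ennreal (?m z * norm (f (x - z) - f x) powr p) \<partial>lborel)"
        by (rule Jensen_powr[OF p mi mol_nonneg]) auto
      finally show "ennreal (norm (conv ?m f x - f x) powr p) \<le> (\<integral>\<^sup>+z. ennreal (?m z * norm (f (x - z) - f x) powr p) \<partial>lborel)"
        by (simp add: ennreal_leI)
    qed
    also have "\<dots> = (\<integral>\<^sup>+z. \<integral>\<^sup>+x. ennreal (?m z * norm (f (x - z) - f x) powr p) \<partial>lborel \<partial>lborel)"
      by (rule lborel_pair.Fubini'[symmetric]) measurable
    also have "\<dots> \<le> (\<integral>\<^sup>+z. ennreal (?m z) * ennreal e \<partial>lborel)"
    proof (rule nn_integral_mono)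
      fix z
      have "(\<integral>\<^sup>+x. ennreal (?m z * norm (f (x - z) - f x) powr p) \<partial>lborel)
          = ennreal (?m z) * (\<integral>\<^sup>+x. ennreal (norm (f (x - z) - f x) powr p) \<partial>lborel)"
        by (simp add: ennreal_mult mol_nonneg nn_integral_cmult)
      also have "\<dots> \<le> ennreal (?m z) * ennreal e"
      proof (cases "norm z < \<epsilon> n")
        case True
        then show ?thesis using d(2)[of z] elim by (intro mult_left_mono) auto
      next
        case False
        then show ?thesis using mol_support[OF \<epsilon>(1), of n z] by simp
      qed
      finally show "(\<integral>\<^sup>+x. ennreal (?m z * norm (f (x - z) - f x) powr p) \<partial>lborel) \<le> ennreal (?m z) * ennreal e" .
    qed
    also have "\<dots> = (\<integral>\<^sup>+z. ennreal (?m z) \<partial>lborel) * ennreal e"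
      by (rule nn_integral_multc) measurable
    also have "(\<integral>\<^sup>+z. ennreal (?m z) \<partial>lborel) = 1"
      using mi by (subst nn_integral_eq_integral) (auto simp: mol_nonneg)
    finally show ?case by simp
  qed
qed

section \<open>Weak gradients and the closure of the test functions\<close>

lemma borel_imp_lebesgue: "f \<in> borel_measurable borel \<Longrightarrow> f \<in> borel_measurable lebesgue"
  by (rule measurable_completion) (simp only: measurable_lborel2)

lemma set_integral_lebesgue_lborel:
  fixes f :: "'a::euclidean_space \<Rightarrow> 'b::euclidean_space"
  assumes "U \<in> sets borel" "f \<in> borel_measurable borel"
  shows "(LINT x:U|lebesgue. f x) = (\<integral>x. indicator U x *\<^sub>R f x \<partial>lborel)"
  unfolding set_lebesgue_integral_def using assms by (intro integral_completion) simp

lemma borel_indicator_powr: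
  fixes f :: "'a::euclidean_space \<Rightarrow> 'b::euclidean_space"
  assumes "f \<in> borel_measurable borel" "U \<in> sets borel"
  shows "(\<lambda>x. indicator U x *\<^sub>R norm (f x) powr p) \<in> borel_measurable lborel"
proof -
  have "(\<lambda>x. norm (f x) powr p) \<in> borel_measurable lborel" using assms(1) by measurable
  moreover have "U \<in> sets lborel" using assms(2) by simp
  ultimately show ?thesis by (intro borel_measurable_scaleR borel_measurable_indicator)
qed

lemma LpI:
  fixes f :: "'a::euclidean_space \<Rightarrow> 'b::euclidean_space"
  assumes [measurable]: "f \<in> borel_measurable borel" "U \<in> sets borel"
    and fin: "(\<integral>\<^sup>+x. ennreal (norm (f x) powr p) * indicator U x \<partial>lborel) < \<infinity>"
  shows "Lp p U f"
  unfolding Lp_def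
proof
  show "set_borel_measurable lebesgue U f"
    unfolding set_borel_measurable_def by (intro borel_imp_lebesgue) measurable
  have "integrable lborel (\<lambda>x. indicator U x *\<^sub>R norm (f x) powr p)"
  proof (rule integrableI_bounded)
    have "(\<integral>\<^sup>+x. ennreal (norm (indicator U x *\<^sub>R norm (f x) powr p)) \<partial>lborel)
      = (\<integral>\<^sup>+x. ennreal (norm (f x) powr p) * indicator U x \<partial>lborel)"
      by (intro nn_integral_cong) (auto simp: indicator_def)
    then show "(\<integral>\<^sup>+x. ennreal (norm (indicator U x *\<^sub>R norm (f x) powr p)) \<partial>lborel) < \<infinity>"
      using fin by simp
    show "(\<lambda>x. indicator U x *\<^sub>R norm (f x) powr p) \<in> borel_measurable lborel"
      by (rule borel_indicator_powr[OF assms(1,2)])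
  qed
  then show "set_integrable lebesgue U (\<lambda>x. norm (f x) powr p)"
    unfolding set_integrable_def
    by (rule integrable_completion[OF borel_indicator_powr[OF assms(1,2)], THEN iffD2])
qed

lemma LpD:
  fixes f :: "'a::euclidean_space \<Rightarrow> 'b::euclidean_space"
  assumes "Lp p U f" and [measurable]: "f \<in> borel_measurable borel" "U \<in> sets borel"
  shows "(\<integral>\<^sup>+x. ennreal (norm (f x) powr p) * indicator U x \<partial>lborel) < \<infinity>"
proof -
  let ?f = "\<lambda>x. indicator U x *\<^sub>R norm (f x) powr p"
  have "integrable lebesgue ?f"
    using assms(1) unfolding Lp_def set_integrable_def by (rule conjunct2)
  then have "integrable lborel ?f"
    by (rule integrable_completion[OF borel_indicator_powr[OF assms(2,3)], THEN iffD1])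
  then have fin: "(\<integral>\<^sup>+x. ennreal (norm (?f x)) \<partial>lborel) < \<infinity>"
    unfolding integrable_iff_bounded by (rule conjunct2)
  have "(\<integral>\<^sup>+x. ennreal (norm (f x) powr p) * indicator U x \<partial>lborel) = (\<integral>\<^sup>+x. ennreal (norm (?f x)) \<partial>lborel)"
    by (intro nn_integral_cong) (auto simp: indicator_def)
  with fin show ?thesis by (simp only:)
qed

lemma integrable_imp_Lp_loc_1:
  fixes f :: "'a::euclidean_space \<Rightarrow> 'b::euclidean_space"
  assumes "integrable lborel f"
  shows "Lp_loc 1 U f"
  unfolding Lp_loc_def
proof (intro allI impI LpI)
  fix K assume "compact K \<and> K \<subseteq> U"
  then show "K \<in> sets borel" by (auto simp: compact_imp_closed)
  have "(\<integral>\<^sup>+x. ennreal (norm (f x) powr 1) * indicator K x \<partial>lborel) \<le> (\<integral>\<^sup>+x. ennreal (norm (f x)) \<partial>lborel)"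
    by (intro nn_integral_mono) (auto simp: indicator_def)
  also have "\<dots> < \<infinity>" using assms by (simp add: integrable_iff_bounded)
  finally show "(\<integral>\<^sup>+x. ennreal (norm (f x) powr 1) * indicator K x \<partial>lborel) < \<infinity>" .
  show "f \<in> borel_measurable borel" using borel_measurable_integrable[OF assms] by simp
qed

lemma is_weak_gradient_subset:
  assumes "is_weak_gradient U u g" "V \<subseteq> U"
  shows "is_weak_gradient V u g"
  unfolding is_weak_gradient_def
proof (intro conjI ballI)
  show "Lp_loc 1 V u" "Lp_loc 1 V g"
    using assms unfolding is_weak_gradient_def Lp_loc_def by blast+
  fix \<phi> assume \<phi>: "\<phi> \<in> test_functions V"
  then obtain K where K: "K \<subseteq> V" "\<And>x. x \<notin> K \<Longrightarrow> \<phi> x = 0" "\<And>x. x \<notin> K \<Longrightarrow> grad \<phi> x = 0"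
    by (rule test_functionsD) blast
  have "\<phi> \<in> test_functions U" using \<phi> assms(2) unfolding test_functions_def by blast
  then have "(LINT x:U|lebesgue. u x *\<^sub>R grad \<phi> x) = - (LINT x:U|lebesgue. \<phi> x *\<^sub>R g x)"
    using assms(1) unfolding is_weak_gradient_def by blast
  moreover have "indicator U x *\<^sub>R u x *\<^sub>R grad \<phi> x = indicator V x *\<^sub>R u x *\<^sub>R grad \<phi> x"
    "indicator U x *\<^sub>R \<phi> x *\<^sub>R g x = indicator V x *\<^sub>R \<phi> x *\<^sub>R g x" for x
    using K(1) K(2,3)[of x] assms(2) by (cases "x \<in> K"; auto simp: indicator_def)+
  ultimately show "(LINT x:V|lebesgue. u x *\<^sub>R grad \<phi> x) = - (LINT x:V|lebesgue. \<phi> x *\<^sub>R g x)"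
    unfolding set_lebesgue_integral_def by (simp only:)
qed

text \<open>
  For fixed \<open>x\<close> the kernel \<open>mol \<epsilon> (x - y)\<close> is, as a function of \<open>y\<close>, a test function on \<open>U\<close>; the
  definition of the weak gradient moves the derivative from it to \<open>u\<close>. Functions are restricted to
  \<open>W\<close> to make them globally integrable, and near \<open>x\<close> the restriction is invisible.
\<close>

lemma grad_mollification:
  fixes u :: "'a::euclidean_space \<Rightarrow> real"
  assumes wg: "is_weak_gradient U u g" and U: "U \<in> sets borel" and W: "W \<in> sets borel" "W \<subseteq> U"
    and [measurable]: "u \<in> borel_measurable borel" "g \<in> borel_measurable borel"
    and int: "integrable lborel (\<lambda>x. indicator W x *\<^sub>R u x)"
    and \<epsilon>: "0 < \<epsilon>" "cball x \<epsilon> \<subseteq> W"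
  shows "grad (conv (mol \<epsilon>) (\<lambda>x. indicator W x *\<^sub>R u x)) x = conv (mol \<epsilon>) (\<lambda>x. indicator W x *\<^sub>R g x) x"
proof -
  define \<phi> where "\<phi> y = mol \<epsilon> (x - y)" for y
  have sm: "smooth (mol \<epsilon> :: 'a \<Rightarrow> real)" by (rule mol_smooth)
  have s\<phi>: "smooth \<phi>"
    using smooth_affine[OF sm, of 1 x "-1"] by (simp add: \<phi>_def[abs_def])
  have supp: "\<phi> y = 0" if "y \<notin> cball x \<epsilon>" for y
    using that \<epsilon>(1) by (auto simp: \<phi>_def dist_norm intro!: mol_support)
  have gs: "grad (mol \<epsilon>) (x - y) = 0" if "y \<notin> cball x \<epsilon>" for y
    unfolding grad_def using that \<epsilon>(1)
    by (intro sum.neutral) (auto simp: dist_norm intro!: partial_eq_0_outside[of \<epsilon>] mol_support)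
  have g\<phi>: "grad \<phi> y = - grad (mol \<epsilon>) (x - y)" for y
  proof (rule grad_unique)
    have "((\<lambda>y. mol \<epsilon> (x - y)) has_derivative (\<lambda>h. grad (mol \<epsilon>) (x - y) \<bullet> (- h))) (at y)"
      by (rule has_derivative_compose[OF _ has_derivative_grad[OF smooth_differentiable[OF sm]]])
        (auto intro!: derivative_eq_intros)
    then show "(\<phi> has_derivative (\<lambda>h. - grad (mol \<epsilon>) (x - y) \<bullet> h)) (at y)"
      by (simp add: \<phi>_def[abs_def])
  qed
  have [measurable]: "\<phi> \<in> borel_measurable borel" "grad \<phi> \<in> borel_measurable borel"
    by (rule smooth_borel[OF s\<phi>], rule borel_measurable_continuous_onI[OF smooth_grad_continuous[OF s\<phi>]])
  have "\<phi> \<in> test_functions U"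
    using W(2) \<epsilon>(2) supp by (intro test_functionsI[OF s\<phi>, where K="cball x \<epsilon>"]) auto
  then have eq: "(\<integral>y. indicator U y *\<^sub>R (u y *\<^sub>R grad \<phi> y) \<partial>lborel) = - (\<integral>y. indicator U y *\<^sub>R (\<phi> y *\<^sub>R g y) \<partial>lborel)"
  proof -
    have "(LINT x:U|lebesgue. u x *\<^sub>R grad \<phi> x) = - (LINT x:U|lebesgue. \<phi> x *\<^sub>R g x)"
      using wg \<open>\<phi> \<in> test_functions U\<close> unfolding is_weak_gradient_def by blast
    moreover have "(LINT x:U|lebesgue. u x *\<^sub>R grad \<phi> x) = (\<integral>y. indicator U y *\<^sub>R (u y *\<^sub>R grad \<phi> y) \<partial>lborel)"
      by (rule set_integral_lebesgue_lborel[OF U]) measurable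
    moreover have "(LINT x:U|lebesgue. \<phi> x *\<^sub>R g x) = (\<integral>y. indicator U y *\<^sub>R (\<phi> y *\<^sub>R g y) \<partial>lborel)"
      by (rule set_integral_lebesgue_lborel[OF U]) measurable
    ultimately show ?thesis by (simp only:)
  qed
  have "grad (conv (mol \<epsilon>) (\<lambda>x. indicator W x *\<^sub>R u x)) x
      = (\<integral>y. (indicator W y *\<^sub>R u y) *\<^sub>R grad (mol \<epsilon>) (x - y) \<partial>lborel)"
    by (rule grad_conv[OF int sm mol_support[OF \<epsilon>(1)]])
  also have "\<dots> = (\<integral>y. - (indicator U y *\<^sub>R (u y *\<^sub>R grad \<phi> y)) \<partial>lborel)"
  proof (intro Bochner_Integration.integral_cong refl)
    fix y show "(indicator W y *\<^sub>R u y) *\<^sub>R grad (mol \<epsilon>) (x - y) = - (indicator U y *\<^sub>R (u y *\<^sub>R grad \<phi> y))"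
      using W(2) \<epsilon>(2) gs[of y] by (cases "y \<in> cball x \<epsilon>") (auto simp: g\<phi> indicator_def)
  qed
  also have "\<dots> = (\<integral>y. indicator U y *\<^sub>R (\<phi> y *\<^sub>R g y) \<partial>lborel)"
    using eq by (subst integral_minus) simp
  also have "\<dots> = conv (mol \<epsilon>) (\<lambda>x. indicator W x *\<^sub>R g x) x"
    unfolding conv_def
  proof (intro Bochner_Integration.integral_cong refl)
    fix y show "indicator U y *\<^sub>R (\<phi> y *\<^sub>R g y) = mol \<epsilon> (x - y) *\<^sub>R indicator W y *\<^sub>R g y"
      using W(2) \<epsilon>(2) supp[of y] by (cases "y \<in> cball x \<epsilon>") (auto simp: \<phi>_def indicator_def)
  qed
  finally show ?thesis .
qed

lemma conv_eq_0:
  assumes "\<And>y. y \<notin> K \<Longrightarrow> f y = 0" "0 < \<epsilon>" "\<And>y. y \<in> K \<Longrightarrow> \<epsilon> \<le> dist x y"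
  shows "conv (mol \<epsilon>) f x = 0"
proof -
  have "mol \<epsilon> (x - y) *\<^sub>R f y = 0" for y
    using assms mol_support[of \<epsilon> "x - y"] by (cases "y \<in> K") (auto simp: dist_norm)
  then have "(\<lambda>y. mol \<epsilon> (x - y) *\<^sub>R f y) = (\<lambda>y. 0)" by auto
  then show ?thesis unfolding conv_def by (simp only: integral_zero)
qed

lemma LINT_powr_tendsto_0:
  fixes f :: "nat \<Rightarrow> 'a::euclidean_space \<Rightarrow> 'b::euclidean_space"
  assumes [measurable]: "\<And>n. f n \<in> borel_measurable borel" "U \<in> sets borel"
    and lim: "(\<lambda>n. \<integral>\<^sup>+x. ennreal (norm (f n x) powr p) \<partial>lborel) \<longlonglongrightarrow> 0"
  shows "(\<lambda>n. LINT x:U|lebesgue. norm (f n x) powr p) \<longlonglongrightarrow> 0"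
proof (subst ennreal_tendsto_0_iff[symmetric])
  show "0 \<le> (LINT x:U|lebesgue. norm (f n x) powr p)" for n
    unfolding set_lebesgue_integral_def by (intro integral_nonneg_AE) auto
  show "(\<lambda>n. ennreal (LINT x:U|lebesgue. norm (f n x) powr p)) \<longlonglongrightarrow> 0"
  proof (rule tendsto_sandwich[OF _ _ tendsto_const lim])
    have "ennreal (LINT x:U|lebesgue. norm (f n x) powr p) \<le> (\<integral>\<^sup>+x. ennreal (norm (f n x) powr p) \<partial>lborel)" for n
    proof (cases "integrable lborel (\<lambda>x. indicator U x *\<^sub>R norm (f n x) powr p)")
      case True
      have "ennreal (LINT x:U|lebesgue. norm (f n x) powr p) = (\<integral>\<^sup>+x. ennreal (indicator U x *\<^sub>R norm (f n x) powr p) \<partial>lborel)"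
        using True by (subst set_integral_lebesgue_lborel) (auto intro!: nn_integral_eq_integral[symmetric])
      also have "\<dots> \<le> (\<integral>\<^sup>+x. ennreal (norm (f n x) powr p) \<partial>lborel)"
        by (intro nn_integral_mono) (auto simp: indicator_def)
      finally show ?thesis .
    next
      case False
      then show ?thesis by (subst set_integral_lebesgue_lborel) (auto simp: not_integrable_integral_eq)
    qed
    then show "\<forall>\<^sub>F n in sequentially. ennreal (LINT x:U|lebesgue. norm (f n x) powr p) \<le> (\<integral>\<^sup>+x. ennreal (norm (f n x) powr p) \<partial>lborel)"
      by simp
  qed simp
qed

lemma conv_borel:
  fixes f :: "'a::euclidean_space \<Rightarrow> 'b::euclidean_space"
  assumes [measurable]: "f \<in> borel_measurable borel"
  shows "conv (mol \<epsilon>) f \<in> borel_measurable borel"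
proof -
  have [measurable]: "mol \<epsilon> \<in> borel_measurable borel" by (rule smooth_borel[OF mol_smooth])
  have "(\<lambda>x. conv (mol \<epsilon>) f x) \<in> borel_measurable lborel"
    unfolding conv_def by (rule lborel.borel_measurable_lebesgue_integral) measurable
  then show ?thesis by simp
qed

text \<open>
  Mollifying at a scale below the distance from \<open>K\<close> to the complement of \<open>U\<close> yields test functions
  on \<open>U\<close>, and both they and their gradients, which are the mollified weak gradients, converge in
  \<open>L\<^sup>p\<close>.
\<close>

lemma W1p_0I:
  fixes v :: "'a::euclidean_space \<Rightarrow> real"
  assumes U: "open U" and K: "compact K" "K \<subseteq> U" "\<And>x. x \<notin> K \<Longrightarrow> v x = 0" and p: "1 \<le> p"
    and wg: "is_weak_gradient UNIV v g" and int: "integrable lborel v" "integrable lborel g"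
    and fin: "(\<integral>\<^sup>+x. ennreal (norm (v x) powr p) \<partial>lborel) < \<infinity>"
       "(\<integral>\<^sup>+x. ennreal (norm (g x) powr p) \<partial>lborel) < \<infinity>"
  shows "v \<in> W1p_0 p U"
proof -
  have [measurable]: "v \<in> borel_measurable borel" "g \<in> borel_measurable borel" using int by auto
  have [measurable]: "U \<in> sets borel" using U by simp
  obtain e where e: "e > 0" "(\<Union>x\<in>K. cball x e) \<subseteq> U"
    using compact_subset_open_imp_cball_epsilon_subset[OF K(1) U K(2)] by blast
  define \<epsilon> where "\<epsilon> n = e / real (Suc n)" for n
  have \<epsilon>: "0 < \<epsilon> n" "\<epsilon> n \<le> e" for n using e(1) by (auto simp: \<epsilon>_def field_simps)
  have \<epsilon>lim: "\<epsilon> \<longlonglongrightarrow> 0"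
    unfolding \<epsilon>_def using tendsto_mult[OF tendsto_const[of e] LIMSEQ_Suc[OF lim_1_over_n]] by simp
  define \<phi> where "\<phi> n = conv (mol (\<epsilon> n)) v" for n
  have sm: "smooth (\<phi> n)" for n
    unfolding \<phi>_def by (rule smooth_conv[OF int(1) mol_smooth mol_support[OF \<epsilon>(1)]])
  have gr: "grad (\<phi> n) x = conv (mol (\<epsilon> n)) g x" for n x
    using grad_mollification[OF wg, of UNIV "\<epsilon> n" x] int \<epsilon>(1) unfolding \<phi>_def by simp
  have test: "\<phi> n \<in> test_functions U" for n
  proof (rule test_functionsI[OF sm])
    show "compact {x + y |x y. x \<in> K \<and> y \<in> cball 0 e}" by (intro compact_sums K) simp
    show "{x + y |x y. x \<in> K \<and> y \<in> cball 0 e} \<subseteq> U"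
      using e(2) by (force simp: dist_norm)
    fix x assume "\<phi> n x \<noteq> 0"
    then obtain y where y: "y \<in> K" "dist x y < \<epsilon> n"
      using conv_eq_0[OF K(3) \<epsilon>(1)[of n], where x=x] unfolding \<phi>_def by (meson not_le)
    then have "x = y + (x - y)" "x - y \<in> cball 0 e" using \<epsilon>(2)[of n] by (auto simp: dist_norm norm_minus_commute)
    then show "x \<in> {x + y |x y. x \<in> K \<and> y \<in> cball 0 e}" using y(1) by blast
  qed
  have [measurable]: "\<phi> n \<in> borel_measurable borel" "grad (\<phi> n) \<in> borel_measurable borel" for n
    by (rule smooth_borel[OF sm], rule borel_measurable_continuous_onI[OF smooth_grad_continuous[OF sm]])
  have "(\<lambda>n. \<integral>\<^sup>+x. ennreal (norm (\<phi> n x - v x) powr p) \<partial>lborel) \<longlonglongrightarrow> 0"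
    unfolding \<phi>_def by (rule mollification_Lp[OF int(1) p fin(1) \<epsilon>(1) \<epsilon>lim])
  then have 1: "(\<lambda>n. LINT x:U|lebesgue. norm (\<phi> n x - v x) powr p) \<longlonglongrightarrow> 0"
    by (intro LINT_powr_tendsto_0) auto
  have "(\<lambda>n. \<integral>\<^sup>+x. ennreal (norm (grad (\<phi> n) x - g x) powr p) \<partial>lborel) \<longlonglongrightarrow> 0"
    unfolding gr by (rule mollification_Lp[OF int(2) p fin(2) \<epsilon>(1) \<epsilon>lim])
  then have 2: "(\<lambda>n. LINT x:U|lebesgue. norm (grad (\<phi> n) x - g x) powr p) \<longlonglongrightarrow> 0"
    by (intro LINT_powr_tendsto_0) auto
  have fU: "(\<integral>\<^sup>+x. ennreal (f x) * indicator U x \<partial>lborel) < \<infinity>" if "(\<integral>\<^sup>+x. ennreal (f x) \<partial>lborel) < \<infinity>" for f :: "'a \<Rightarrow> real"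
    by (rule le_less_trans[OF nn_integral_mono that]) (auto simp: indicator_def)
  have "Lp p U v" "Lp p U g" by (intro LpI fU fin; simp)+
  moreover have "v x = 0" if "x \<notin> U" for x using K(2,3) that by blast
  moreover have "is_weak_gradient U v g" by (rule is_weak_gradient_subset[OF wg]) simp
  ultimately show ?thesis
    using test 1 2 unfolding W1p_0_def by (auto intro!: exI[of _ g] exI[of _ \<phi>])
qed

section \<open>The chain rule and the translation estimate\<close>

lemma lipschitz_of_derivative_bound:
  fixes f :: "'a::euclidean_space \<Rightarrow> real"
  assumes "\<And>x. (f has_derivative (\<lambda>h. D x \<bullet> h)) (at x)" "\<And>x. norm (D x) \<le> M"
  shows "\<bar>f x - f y\<bar> \<le> M * norm (x - y)"
proof -
  have "norm (f x - f y) \<le> M * norm (x - y)"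
    by (intro differentiable_bound[where f'="\<lambda>x h. D x \<bullet> h" and S=UNIV])
      (auto intro!: assms onorm_le order_trans[OF Cauchy_Schwarz_ineq2] mult_right_mono)
  then show ?thesis by simp
qed

lemma derivative_eq_0_outside:
  fixes f :: "'a::euclidean_space \<Rightarrow> real"
  assumes "(f has_derivative (\<lambda>h. D \<bullet> h)) (at x)" "closed K" "\<And>x. x \<notin> K \<Longrightarrow> f x = 0" "x \<notin> K"
  shows "D = 0"
proof -
  have "((\<lambda>_. 0::real) has_derivative (\<lambda>h. 0 \<bullet> h)) (at x)" by simp
  then have "(f has_derivative (\<lambda>h. 0 \<bullet> h)) (at x)"
    by (rule has_derivative_transform_within_open[where s="- K"]) (use assms in auto)
  then show ?thesis using grad_unique assms(1) by metis
qed

lemma continuous_compact_support_bounded: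
  fixes D :: "'a::euclidean_space \<Rightarrow> 'b::euclidean_space"
  assumes "continuous_on UNIV D" "compact K" "\<And>x. x \<notin> K \<Longrightarrow> D x = 0"
  obtains M where "0 \<le> M" "\<And>x. norm (D x) \<le> M"
proof -
  have "bounded (D ` K)"
    using assms by (intro compact_imp_bounded compact_continuous_image) (auto intro: continuous_on_subset)
  then obtain M where M: "\<And>x. x \<in> K \<Longrightarrow> norm (D x) \<le> M" unfolding bounded_iff by blast
  have "norm (D x) \<le> max M 0" for x using M[of x] assms(3)[of x] by (cases "x \<in> K") auto
  then show ?thesis by (intro that[of "max M 0"]) auto
qed

text \<open>
  The difference quotients of \<open>f\<close> have integral \<open>0\<close> by translation invariance, and they converge
  boundedly, on a fixed ball, to the partial derivatives.
\<close>

lemma integral_gradient_eq_0: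
  fixes f :: "'a::euclidean_space \<Rightarrow> real"
  assumes f: "\<And>x. (f has_derivative (\<lambda>h. D x \<bullet> h)) (at x)" and D: "continuous_on UNIV D"
    and K: "compact K" "\<And>x. x \<notin> K \<Longrightarrow> f x = 0"
  shows "integrable lborel D" "(\<integral>x. D x \<partial>lborel) = 0"
proof -
  have D0: "D x = 0" if "x \<notin> K" for x
    by (rule derivative_eq_0_outside[OF f compact_imp_closed[OF K(1)] K(2) that]) auto
  obtain M where M: "0 \<le> M" "\<And>x. norm (D x) \<le> M" using continuous_compact_support_bounded[OF D K(1) D0] by metis
  obtain k where k: "\<And>x. x \<in> K \<Longrightarrow> norm x \<le> k" using compact_imp_bounded[OF K(1)] unfolding bounded_iff by blast
  have [measurable]: "D \<in> borel_measurable borel" by (rule borel_measurable_continuous_onI[OF D])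
  have fc: "continuous_on UNIV f"
    using f by (meson continuous_at_imp_continuous_on has_derivative_continuous)
  then have [measurable]: "f \<in> borel_measurable borel" by (rule borel_measurable_continuous_onI)
  have bi: "integrable lborel (\<lambda>x::'a. M * indicator (cball 0 (k + 1)) x)"
    using emeasure_lborel_cball_finite[of "0::'a" "k + 1"] by (intro integrable_mult_right integrable_real_indicator) auto
  show Dint: "integrable lborel D"
  proof (rule Bochner_Integration.integrable_bound[OF bi])
    show "AE x in lborel. norm (D x) \<le> norm (M * indicator (cball 0 (k + 1)) x)"
      using M D0 k by (intro AE_I2) (force simp: indicator_def)
  qed simp
  obtain B where B: "0 \<le> B" "\<And>x. norm (f x) \<le> B" using continuous_compact_support_bounded[OF fc K] by metis
  have fint: "integrable lborel f"
  proof (rule Bochner_Integration.integrable_bound)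
    show "integrable lborel (\<lambda>x::'a. B * indicator (cball 0 (k + 1)) x)"
      using emeasure_lborel_cball_finite[of "0::'a" "k + 1"] by (intro integrable_mult_right integrable_real_indicator) auto
    show "AE x in lborel. norm (f x) \<le> norm (B * indicator (cball 0 (k + 1)) x)"
      using B K(2) k by (intro AE_I2) (force simp: indicator_def)
  qed simp
  have "(\<integral>x. D x \<partial>lborel) \<bullet> i = 0" if i: "i \<in> Basis" for i
  proof -
    define s where "s n = 1 / real (Suc n)" for n
    have s: "0 < s n" "s n \<le> 1" for n by (auto simp: s_def)
    have slim: "s \<longlonglongrightarrow> 0" unfolding s_def by (rule LIMSEQ_Suc[OF lim_1_over_n])
    define q where "q n x = (f (x + s n *\<^sub>R i) - f x) / s n" for n x
    have "(\<lambda>n. \<integral>x. q n x \<partial>lborel) \<longlonglongrightarrow> (\<integral>x. D x \<bullet> i \<partial>lborel)"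
    proof (rule integral_dominated_convergence[OF _ _ bi])
      show "(\<lambda>x. D x \<bullet> i) \<in> borel_measurable lborel" "q n \<in> borel_measurable lborel" for n
        unfolding q_def by auto
      have "(\<lambda>n. q n x) \<longlonglongrightarrow> D x \<bullet> i" for x
      proof -
        have "((\<lambda>t. f (x + t *\<^sub>R i)) has_derivative (\<lambda>t. D (x + 0 *\<^sub>R i) \<bullet> (t *\<^sub>R i))) (at 0)"
          by (rule has_derivative_compose[OF _ f]) (auto intro!: derivative_eq_intros)
        then have "((\<lambda>t. f (x + t *\<^sub>R i)) has_real_derivative (D x \<bullet> i)) (at 0)"
          by (simp add: has_field_derivative_def mult_commute_abs)
        then have lim: "((\<lambda>t. (f (x + t *\<^sub>R i) - f x) / t) \<longlongrightarrow> D x \<bullet> i) (at 0)"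
          by (simp add: has_field_derivative_iff)
        have ne: "s n \<noteq> 0" for n using s(1)[of n] by simp
        have "filterlim s (at 0) sequentially"
          unfolding filterlim_at using slim ne by simp
        from filterlim_compose[OF lim this] show ?thesis unfolding q_def .
      qed
      then show "AE x in lborel. (\<lambda>n. q n x) \<longlonglongrightarrow> D x \<bullet> i" by simp
      show "AE x in lborel. norm (q n x) \<le> M * indicator (cball 0 (k + 1)) x" for n
      proof (intro AE_I2)
        fix x
        show "norm (q n x) \<le> M * indicator (cball 0 (k + 1)) x"
        proof (cases "x \<in> cball 0 (k + 1)")
          case True
          have "\<bar>f (x + s n *\<^sub>R i) - f x\<bar> \<le> M * s n"
          proof -
            have "norm (x + s n *\<^sub>R i - x) = s n" using i s(1)[of n] by simp
            then show ?thesis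
              using lipschitz_of_derivative_bound[OF f M(2), of "x + s n *\<^sub>R i" x] by (simp only:)
          qed
          then have "\<bar>f (x + s n *\<^sub>R i) - f x\<bar> / s n \<le> M"
            using s(1)[of n] by (simp add: divide_le_eq)
          then show ?thesis using True s(1)[of n] by (simp add: q_def)
        next
          case False
          have "norm x \<le> norm (x + s n *\<^sub>R i) + s n"
            using norm_triangle_ineq4[of "x + s n *\<^sub>R i" "s n *\<^sub>R i"] i s[of n] by simp
          then have "x \<notin> K" "x + s n *\<^sub>R i \<notin> K" using False k s(2)[of n] by force+
          then show ?thesis using K(2) M(1) by (simp add: q_def)
        qed
      qed
    qed
    moreover have "(\<integral>x. q n x \<partial>lborel) = 0" for n
      unfolding q_def using integrable_shift[OF fint] fint
      by (simp add: Bochner_Integration.integral_diff integral_shift)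
    ultimately have "(\<integral>x. D x \<bullet> i \<partial>lborel) = 0" using LIMSEQ_unique[OF _ tendsto_const] by fastforce
    then show ?thesis using integral_inner_left[OF Dint, of i] by simp
  qed
  note components = this
  show "(\<integral>x. D x \<partial>lborel) = 0" by (rule euclidean_eqI) (simp add: components)
qed

lemma mollification_L1:
  fixes f :: "'a::euclidean_space \<Rightarrow> 'b::euclidean_space"
  assumes "integrable lborel f" "\<And>n. 0 < \<epsilon> n" "\<epsilon> \<longlonglongrightarrow> 0"
  shows "(\<lambda>n. \<integral>\<^sup>+x. ennreal (norm (conv (mol (\<epsilon> n)) f x - f x)) \<partial>lborel) \<longlonglongrightarrow> 0"
proof -
  have "(\<integral>\<^sup>+x. ennreal (norm (f x) powr 1) \<partial>lborel) < \<infinity>"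
    using assms(1) by (simp add: integrable_iff_bounded)
  from mollification_Lp[OF assms(1) _ this assms(2,3)] show ?thesis by simp
qed

lemma conv_nonneg:
  fixes f :: "'a::euclidean_space \<Rightarrow> real"
  assumes "\<And>x. 0 \<le> f x"
  shows "0 \<le> conv (mol \<epsilon>) f x"
  unfolding conv_def using assms by (intro integral_nonneg_AE) (simp add: mol_nonneg)

lemma lipschitz_half_line:
  fixes F :: "real \<Rightarrow> real"
  assumes "\<And>t. 0 \<le> t \<Longrightarrow> (F has_real_derivative F' t) (at t)" "\<And>t. 0 \<le> t \<Longrightarrow> \<bar>F' t\<bar> \<le> M" "0 \<le> a" "0 \<le> b"
  shows "\<bar>F a - F b\<bar> \<le> M * \<bar>a - b\<bar>"
proof -
  have "norm (F a - F b) \<le> M * norm (a - b)"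
    by (rule field_differentiable_bound[of "{0..}" F F' M a b])
      (use assms in \<open>auto intro: has_field_derivative_at_within\<close>)
  then show ?thesis by simp
qed

text \<open>
  This produces every Sobolev function used below: a nonnegative \<open>u\<close> is composed with a function
  \<open>F\<close> of bounded slope on the half-line, and a \<open>C\<^sup>1\<close> cutoff \<open>\<psi>\<close> makes the result globally defined.
  Mollification preserves \<open>u \<ge> 0\<close>, so the classical chain and product rules hold for the mollified
  functions, and \<open>integral_gradient_eq_0\<close> expresses them in weak form. In the limit the only
  delicate term contains \<open>F'\<close> at the mollified function; it converges by dominated convergence
  along an almost everywhere convergent subsequence.
\<close>

lemma weak_gradient_chain:
  fixes u :: "'a::euclidean_space \<Rightarrow> real" and F F' :: "real \<Rightarrow> real"
  assumes wg: "is_weak_gradient U u g" and U: "U \<in> sets borel" and W: "W \<in> sets borel" "W \<subseteq> U"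
    and meas[measurable]: "u \<in> borel_measurable borel" "g \<in> borel_measurable borel"
    and int: "integrable lborel (\<lambda>x. indicator W x *\<^sub>R u x)" "integrable lborel (\<lambda>x. indicator W x *\<^sub>R g x)"
    and nonneg: "\<And>x. x \<in> W \<Longrightarrow> 0 \<le> u x"
    and \<psi>: "\<And>x. (\<psi> has_derivative (\<lambda>h. D\<psi> x \<bullet> h)) (at x)" "continuous_on UNIV D\<psi>"
    and K: "compact K" "\<And>x. x \<notin> K \<Longrightarrow> \<psi> x = 0" and e: "0 < e" "\<And>x. x \<in> K \<Longrightarrow> cball x e \<subseteq> W"
    and F: "\<And>t. 0 \<le> t \<Longrightarrow> (F has_real_derivative F' t) (at t)" "continuous_on {0..} F'"
      "\<And>t. 0 \<le> t \<Longrightarrow> \<bar>F' t\<bar> \<le> M"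
    and Fmeas[measurable]: "F \<in> borel_measurable borel" "F' \<in> borel_measurable borel"
  defines "v \<equiv> \<lambda>x. \<psi> x * F (u x)" and "G \<equiv> \<lambda>x. F (u x) *\<^sub>R D\<psi> x + (\<psi> x * F' (u x)) *\<^sub>R g x"
  shows "is_weak_gradient UNIV v G" "integrable lborel v" "integrable lborel G"
proof -
  have D\<psi>0: "D\<psi> x = 0" if "x \<notin> K" for x
    by (rule derivative_eq_0_outside[OF \<psi>(1) compact_imp_closed[OF K(1)] K(2) that]) auto
  have KW: "K \<subseteq> W" using e by (force simp: subset_iff)
  define uu where "uu x = indicator W x *\<^sub>R u x" for x
  define gg where "gg x = indicator W x *\<^sub>R g x" for x
  have uuint: "integrable lborel uu" and ggint: "integrable lborel gg"
    using int by (simp_all add: uu_def[abs_def] gg_def[abs_def])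
  have [measurable]: "uu \<in> borel_measurable borel" "gg \<in> borel_measurable borel"
    using uuint ggint by (auto dest: borel_measurable_integrable)
  have uu0: "0 \<le> uu x" for x using nonneg by (simp add: uu_def indicator_def)
  have v: "v x = \<psi> x * F (uu x)" for x
    using K(2)[of x] KW by (cases "x \<in> K") (auto simp: v_def uu_def indicator_def)
  have G: "G x = F (uu x) *\<^sub>R D\<psi> x + (\<psi> x * F' (uu x)) *\<^sub>R gg x" for x
    using K(2)[of x] D\<psi>0[of x] KW by (cases "x \<in> K") (auto simp: G_def uu_def gg_def indicator_def)
  have \<psi>c: "continuous_on UNIV \<psi>"
    using \<psi>(1) by (meson continuous_at_imp_continuous_on has_derivative_continuous)
  have [measurable]: "\<psi> \<in> borel_measurable borel" "D\<psi> \<in> borel_measurable borel"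
    by (rule borel_measurable_continuous_onI[OF \<psi>c], rule borel_measurable_continuous_onI[OF \<psi>(2)])
  obtain P1 where P1: "0 \<le> P1" "\<And>x. norm (\<psi> x) \<le> P1" using continuous_compact_support_bounded[OF \<psi>c K] by metis
  obtain P2 where P2: "0 \<le> P2" "\<And>x. norm (D\<psi> x) \<le> P2" using continuous_compact_support_bounded[OF \<psi>(2) K(1) D\<psi>0] by metis
  define P where "P = max P1 P2"
  have P: "0 \<le> P" "\<And>x. \<bar>\<psi> x\<bar> \<le> P" "\<And>x. norm (D\<psi> x) \<le> P"
    using P1 P2 by (auto simp: P_def le_max_iff_disj)
  have M: "0 \<le> M" using F(3)[of 0] by simp
  have lip: "\<bar>F a - F b\<bar> \<le> M * \<bar>a - b\<bar>" if "0 \<le> a" "0 \<le> b" for a b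
    by (rule lipschitz_half_line[of F F' M]) (use F that in auto)
  obtain k where k: "\<And>x. x \<in> K \<Longrightarrow> norm x \<le> k" using compact_imp_bounded[OF K(1)] unfolding bounded_iff by blast
  define b where "b x = P * \<bar>F 0\<bar> * indicator (cball 0 k) x + P * M * \<bar>uu x\<bar>" for x
  have bint: "integrable lborel b"
    unfolding b_def using uuint emeasure_lborel_cball_finite[of "0::'a" k]
    by (intro Bochner_Integration.integrable_add integrable_mult_right integrable_real_indicator integrable_abs) auto
  have Fb: "c * \<bar>F (uu x)\<bar> \<le> b x" if "0 \<le> c" "c \<le> P" "x \<in> K" for c x
  proof -
    have "\<bar>F (uu x)\<bar> \<le> \<bar>F 0\<bar> + M * \<bar>uu x\<bar>" using lip[OF uu0[of x], of 0] by simp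
    then have "c * \<bar>F (uu x)\<bar> \<le> P * (\<bar>F 0\<bar> + M * \<bar>uu x\<bar>)" using that P(1) by (intro mult_mono) auto
    then show ?thesis using k[OF that(3)] by (simp add: b_def algebra_simps)
  qed
  have b0: "0 \<le> b x" for x using P(1) M by (simp add: b_def)
  have vb: "norm (v x) \<le> b x" for x
    using Fb[OF _ P(2)[of x], of x] b0 K(2) by (cases "x \<in> K") (auto simp: v abs_mult)
  have Gb: "norm (G x) \<le> b x + P * M * norm (gg x)" for x
  proof -
    have "norm (F (uu x) *\<^sub>R D\<psi> x) \<le> b x"
      using Fb[OF _ P(3)[of x], of x] b0 D\<psi>0 by (cases "x \<in> K") (auto simp: mult.commute)
    moreover have "norm ((\<psi> x * F' (uu x)) *\<^sub>R gg x) \<le> P * M * norm (gg x)"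
      using P(2)[of x] F(3)[OF uu0, of x] P(1) by (auto simp: abs_mult intro!: mult_right_mono mult_mono)
    ultimately show ?thesis unfolding G by (intro norm_triangle_le add_mono)
  qed
  have vm[measurable]: "v \<in> borel_measurable borel" and Gm[measurable]: "G \<in> borel_measurable borel"
    unfolding v_def G_def by measurable
  show vint: "integrable lborel v"
    by (rule Bochner_Integration.integrable_bound[OF bint]) (use vb b0 in auto)
  have b2int: "integrable lborel (\<lambda>x. b x + P * M * norm (gg x))"
    using bint ggint by (intro Bochner_Integration.integrable_add) auto
  show Gint: "integrable lborel G"
  proof (rule Bochner_Integration.integrable_bound[OF b2int])
    have "norm (G x) \<le> norm (b x + P * M * norm (gg x))" for x using Gb[of x] by simp
    then show "AE x in lborel. norm (G x) \<le> norm (b x + P * M * norm (gg x))" by simp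
  qed simp
  have key: "(LINT x:UNIV|lebesgue. v x *\<^sub>R grad \<phi> x) = - (LINT x:UNIV|lebesgue. \<phi> x *\<^sub>R G x)"
    if \<phi>: "\<phi> \<in> test_functions UNIV" for \<phi>
  proof -
    obtain L where L: "smooth \<phi>" "compact L" "\<And>x. x \<notin> L \<Longrightarrow> \<phi> x = 0" "\<And>x. x \<notin> L \<Longrightarrow> grad \<phi> x = 0"
      using \<phi> by (rule test_functionsD) blast
    have [measurable]: "\<phi> \<in> borel_measurable borel" "grad \<phi> \<in> borel_measurable borel"
      by (rule smooth_borel[OF L(1)], rule borel_measurable_continuous_onI[OF smooth_grad_continuous[OF L(1)]])
    obtain Q1 where Q1: "0 \<le> Q1" "\<And>x. norm (\<phi> x) \<le> Q1" using continuous_compact_support_bounded[OF smooth_continuous[OF L(1)] L(2,3)] by metis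
    obtain Q2 where Q2: "0 \<le> Q2" "\<And>x. norm (grad \<phi> x) \<le> Q2" using continuous_compact_support_bounded[OF smooth_grad_continuous[OF L(1)] L(2,4)] by metis
    define Q where "Q = max Q1 Q2"
    have Q: "0 \<le> Q" "\<And>x. \<bar>\<phi> x\<bar> \<le> Q" "\<And>x. norm (grad \<phi> x) \<le> Q"
      using Q1 Q2 by (auto simp: Q_def le_max_iff_disj)
    have i1: "integrable lborel (\<lambda>x. v x *\<^sub>R grad \<phi> x)"
    proof (rule Bochner_Integration.integrable_bound)
      show "integrable lborel (\<lambda>x. Q * \<bar>v x\<bar>)" using vint by simp
      have "norm (v x *\<^sub>R grad \<phi> x) \<le> norm (Q * \<bar>v x\<bar>)" for x
        using mult_left_mono[OF Q(3)[of x], of "\<bar>v x\<bar>"] Q(1) by (simp add: abs_mult mult.commute)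
      then show "AE x in lborel. norm (v x *\<^sub>R grad \<phi> x) \<le> norm (Q * \<bar>v x\<bar>)" by simp
    qed simp
    have i2: "integrable lborel (\<lambda>x. \<phi> x *\<^sub>R G x)"
      by (rule integrable_scaleR_bounded[OF Gint _ Q(2)]) simp
    (* The weak gradient identity for v tested with \<phi> says that E has integral 0; here E is
       formally the gradient of the product of v and \<phi>. *)
    define E where "E x = v x *\<^sub>R grad \<phi> x + \<phi> x *\<^sub>R G x" for x
    have Eint: "integrable lborel E" unfolding E_def by (rule Bochner_Integration.integrable_add[OF i1 i2])
    define s where "s n = e / real (Suc n)" for n
    have s: "0 < s n" "s n \<le> e" for n using e(1) by (auto simp: s_def field_simps)
    have slim: "s \<longlonglongrightarrow> 0"
      unfolding s_def using tendsto_mult[OF tendsto_const[of e] LIMSEQ_Suc[OF lim_1_over_n]] by simp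
    define un where "un n = conv (mol (s n)) uu" for n
    define gn where "gn n = conv (mol (s n)) gg" for n
    have sm: "smooth (un n)" for n
      unfolding un_def by (rule smooth_conv[OF uuint mol_smooth mol_support[OF s(1)]])
    have un0: "0 \<le> un n x" for n x unfolding un_def by (rule conv_nonneg[OF uu0])
    have [measurable]: "un n \<in> borel_measurable borel" "gn n \<in> borel_measurable borel" for n
      unfolding un_def gn_def by (auto intro: conv_borel)
    have gr: "grad (un n) x = gn n x" if "x \<in> K" for n x
    proof -
      have "cball x (s n) \<subseteq> W" using e(2)[OF that] s(2)[of n] by (meson order_trans subset_cball)
      then show ?thesis
        using grad_mollification[OF wg U W meas int(1) s(1)] unfolding un_def gn_def uu_def[abs_def] gg_def[abs_def] by blast
    qed
    define vn where "vn n x = \<psi> x * F (un n x)" for n x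
    define Gn where "Gn n x = F (un n x) *\<^sub>R D\<psi> x + (\<psi> x * F' (un n x)) *\<^sub>R gn n x" for n x
    define En where "En n x = vn n x *\<^sub>R grad \<phi> x + \<phi> x *\<^sub>R Gn n x" for n x
    have Gn: "Gn n x = F (un n x) *\<^sub>R D\<psi> x + (\<psi> x * F' (un n x)) *\<^sub>R grad (un n) x" for n x
      using gr[of x n] K(2)[of x] by (cases "x \<in> K") (auto simp: Gn_def)
    have En0: "integrable lborel (En n) \<and> (\<integral>x. En n x \<partial>lborel) = 0" for n
    proof -
      have d: "((\<lambda>x. vn n x * \<phi> x) has_derivative (\<lambda>h. En n x \<bullet> h)) (at x)" for x
      proof -
        have f: "((\<lambda>x. F (un n x)) has_derivative (\<lambda>h. F' (un n x) * (grad (un n) x \<bullet> h))) (at x)"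
          by (rule has_derivative_compose[OF has_derivative_grad[OF smooth_differentiable[OF sm]]
                has_field_derivative_imp_has_derivative[OF F(1)[OF un0]]])
        have "((\<lambda>x. \<psi> x * F (un n x) * \<phi> x) has_derivative
           (\<lambda>h. (\<psi> x * F (un n x)) * (grad \<phi> x \<bullet> h) + (\<psi> x * (F' (un n x) * (grad (un n) x \<bullet> h)) + (D\<psi> x \<bullet> h) * F (un n x)) * \<phi> x)) (at x)"
          by (rule has_derivative_mult[OF has_derivative_mult[OF \<psi>(1) f] has_derivative_grad[OF smooth_differentiable[OF L(1)]]])
        then show ?thesis
          unfolding vn_def En_def Gn by (simp add: inner_add_left algebra_simps)
      qed
      have cu: "continuous_on UNIV (un n)" by (rule smooth_continuous[OF sm])
      have cF: "continuous_on UNIV (\<lambda>x. F (un n x))"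
        by (rule continuous_on_compose2[of "{0..}" F, OF _ cu])
          (use un0 F(1) in \<open>auto intro!: continuous_at_imp_continuous_on dest: DERIV_isCont\<close>)
      have cF': "continuous_on UNIV (\<lambda>x. F' (un n x))"
        by (rule continuous_on_compose2[OF F(2) cu]) (use un0 in auto)
      have c: "continuous_on UNIV (En n)"
        unfolding En_def[abs_def] Gn vn_def
        by (intro continuous_intros cF cF' \<psi>c \<psi>(2) smooth_continuous[OF L(1)] smooth_grad_continuous[OF L(1)] smooth_grad_continuous[OF sm])
      show ?thesis
        using integral_gradient_eq_0[OF d c L(2)] L(3) by simp
    qed
    have [measurable]: "En n \<in> borel_measurable borel" "E \<in> borel_measurable borel" for n
      using borel_measurable_integrable[OF conjunct1[OF En0]] borel_measurable_integrable[OF Eint] by simp_all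
    have lu: "(\<lambda>n. \<integral>\<^sup>+x. ennreal (norm (un n x - uu x)) \<partial>lborel) \<longlonglongrightarrow> 0"
      unfolding un_def by (rule mollification_L1[OF uuint s(1) slim])
    have lg: "(\<lambda>n. \<integral>\<^sup>+x. ennreal (norm (gn n x - gg x)) \<partial>lborel) \<longlonglongrightarrow> 0"
      unfolding gn_def by (rule mollification_L1[OF ggint s(1) slim])
    obtain r where r: "strict_mono r" "AE x in lborel. (\<lambda>n. un (r n) x - uu x) \<longlonglongrightarrow> 0"
    proof -
      have "\<forall>\<^sub>F n in sequentially. (\<integral>\<^sup>+x. ennreal (norm (un n x - uu x)) \<partial>lborel) < \<infinity>"
        using lu by (rule order_tendstoD) simp
      then obtain n0 where n0: "\<And>n. n0 \<le> n \<Longrightarrow> (\<integral>\<^sup>+x. ennreal (norm (un n x - uu x)) \<partial>lborel) < \<infinity>"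
        by (auto simp: eventually_sequentially)
      have i: "integrable lborel (\<lambda>x. un (n + n0) x - uu x)" for n
        by (rule integrableI_bounded) (use n0 in auto)
      have "(\<lambda>n. ennreal (\<integral>x. norm (un (n + n0) x - uu x) \<partial>lborel)) \<longlonglongrightarrow> 0"
        using LIMSEQ_ignore_initial_segment[OF lu, of n0] by (subst nn_integral_eq_integral[OF integrable_norm[OF i], symmetric]) auto
      then have "(\<lambda>n. (\<integral>x. norm (un (n + n0) x - uu x) \<partial>lborel)) \<longlonglongrightarrow> 0"
        by (subst (asm) ennreal_tendsto_0_iff) auto
      from tendsto_L1_AE_subseq[OF i this] obtain q where q: "strict_mono q"
        "AE x in lborel. (\<lambda>n. un (q n + n0) x - uu x) \<longlonglongrightarrow> 0" by blast
      show thesis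
        by (rule that[of "\<lambda>n. q n + n0"]) (use q in \<open>auto simp: strict_mono_def\<close>)
    qed
    (* The three summands of B arise from the errors in un, in gn and in F' (un). *)
    define B where "B n x = Q * P * (2 * M * norm (un n x - uu x) + M * norm (gn n x - gg x) + \<bar>F' (un n x) - F' (uu x)\<bar> * norm (gg x))" for n x
    have Bd: "norm (En n x - E x) \<le> B n x" for n x
    proof -
      have 1: "\<bar>F (un n x) - F (uu x)\<bar> \<le> M * norm (un n x - uu x)" using lip[OF un0 uu0] by simp
      have "norm (vn n x - v x) = \<bar>\<psi> x\<bar> * \<bar>F (un n x) - F (uu x)\<bar>"
        unfolding vn_def v by (simp add: right_diff_distrib[symmetric] abs_mult)
      also have "\<dots> \<le> P * (M * norm (un n x - uu x))"
        by (rule mult_mono[OF P(2) 1 P(1)]) simp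
      finally have "norm (vn n x - v x) \<le> P * (M * norm (un n x - uu x))" .
      then have 2: "norm ((vn n x - v x) *\<^sub>R grad \<phi> x) \<le> P * (M * norm (un n x - uu x)) * Q"
        using Q(3)[of x] P(1) M by (simp only: norm_scaleR real_norm_def) (intro mult_mono, auto)
      have Gd: "Gn n x - G x = (F (un n x) - F (uu x)) *\<^sub>R D\<psi> x + (\<psi> x * F' (un n x)) *\<^sub>R (gn n x - gg x)
          + (\<psi> x * (F' (un n x) - F' (uu x))) *\<^sub>R gg x"
        unfolding Gn_def G by (simp add: algebra_simps)
      have a1: "norm ((F (un n x) - F (uu x)) *\<^sub>R D\<psi> x) \<le> (M * norm (un n x - uu x)) * P"
        using 1 P(3)[of x] M by (simp only: norm_scaleR real_norm_def) (intro mult_mono, auto)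
      have a2: "norm ((\<psi> x * F' (un n x)) *\<^sub>R (gn n x - gg x)) \<le> (P * M) * norm (gn n x - gg x)"
        using P(1,2) F(3)[OF un0, of n x] by (simp only: norm_scaleR abs_mult) (intro mult_mono, auto)
      have a3: "norm ((\<psi> x * (F' (un n x) - F' (uu x))) *\<^sub>R gg x) \<le> (P * \<bar>F' (un n x) - F' (uu x)\<bar>) * norm (gg x)"
        using P(1,2) by (simp only: norm_scaleR abs_mult) (intro mult_mono, auto)
      have "norm (Gn n x - G x) \<le> (M * norm (un n x - uu x)) * P + (P * M) * norm (gn n x - gg x)
          + (P * \<bar>F' (un n x) - F' (uu x)\<bar>) * norm (gg x)"
        unfolding Gd using a1 a2 a3 by (intro norm_triangle_le add_mono) auto
      from mult_mono[OF Q(2)[of x] this Q(1)]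
      have 3: "norm (\<phi> x *\<^sub>R (Gn n x - G x)) \<le> Q * ((M * norm (un n x - uu x)) * P + (P * M) * norm (gn n x - gg x)
          + (P * \<bar>F' (un n x) - F' (uu x)\<bar>) * norm (gg x))"
        by simp
      have "En n x - E x = (vn n x - v x) *\<^sub>R grad \<phi> x + \<phi> x *\<^sub>R (Gn n x - G x)"
        unfolding En_def E_def by (simp add: algebra_simps)
      then have "norm (En n x - E x) \<le> P * (M * norm (un n x - uu x)) * Q + Q * ((M * norm (un n x - uu x)) * P + (P * M) * norm (gn n x - gg x)
          + (P * \<bar>F' (un n x) - F' (uu x)\<bar>) * norm (gg x))"
        using 2 3 by (simp only:) (intro norm_triangle_le add_mono)
      also have "\<dots> = B n x" by (simp add: B_def algebra_simps)
      finally show ?thesis .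
    qed
    have lim3: "(\<lambda>n. \<integral>\<^sup>+x. ennreal (\<bar>F' (un (r n) x) - F' (uu x)\<bar> * norm (gg x)) \<partial>lborel) \<longlonglongrightarrow> (\<integral>\<^sup>+(x::'a). 0 \<partial>lborel)"
    proof (rule nn_integral_dominated_convergence[where w="\<lambda>x. ennreal (2 * M * norm (gg x))"])
      have "\<bar>F' (un (r j) x) - F' (uu x)\<bar> \<le> 2 * M" for j x
        using F(3)[OF un0, of "r j" x] F(3)[OF uu0, of x] by simp
      then show "AE x in lborel. ennreal (\<bar>F' (un (r j) x) - F' (uu x)\<bar> * norm (gg x)) \<le> ennreal (2 * M * norm (gg x))" for j
        by (intro AE_I2 ennreal_leI mult_right_mono) auto
      have "integrable lborel (\<lambda>x. 2 * M * norm (gg x))" using ggint by simp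
      then show "(\<integral>\<^sup>+x. ennreal (2 * M * norm (gg x)) \<partial>lborel) < \<infinity>"
        using M unfolding integrable_iff_bounded by (auto simp: abs_mult)
      show "AE x in lborel. (\<lambda>i. ennreal (\<bar>F' (un (r i) x) - F' (uu x)\<bar> * norm (gg x))) \<longlonglongrightarrow> 0"
        using r(2)
      proof eventually_elim
        case (elim x)
        then have "(\<lambda>n. un (r n) x) \<longlonglongrightarrow> uu x" by (simp add: LIM_zero_iff)
        then have "(\<lambda>n. F' (un (r n) x)) \<longlonglongrightarrow> F' (uu x)"
          using F(2) uu0[of x] un0 by (intro continuous_on_tendsto_compose[of "{0..}" F']) auto
        then have "(\<lambda>n. \<bar>F' (un (r n) x) - F' (uu x)\<bar> * norm (gg x)) \<longlonglongrightarrow> \<bar>F' (uu x) - F' (uu x)\<bar> * norm (gg x)"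
          by (intro tendsto_intros)
        then show ?case by (subst ennreal_tendsto_0_iff) auto
      qed
    qed measurable
    have Blim: "(\<lambda>n. \<integral>\<^sup>+x. ennreal (B (r n) x) \<partial>lborel) \<longlonglongrightarrow> 0"
    proof -
      have eq: "(\<integral>\<^sup>+x. ennreal (B n x) \<partial>lborel) = ennreal (Q * P) * (ennreal (2 * M) * (\<integral>\<^sup>+x. ennreal (norm (un n x - uu x)) \<partial>lborel)
          + ennreal M * (\<integral>\<^sup>+x. ennreal (norm (gn n x - gg x)) \<partial>lborel)
          + (\<integral>\<^sup>+x. ennreal (\<bar>F' (un n x) - F' (uu x)\<bar> * norm (gg x)) \<partial>lborel))" for n
        unfolding B_def using P(1) Q(1) M
        by (simp add: ennreal_mult nn_integral_cmult nn_integral_add ennreal_plus[symmetric] del: ennreal_plus)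
          (simp add: ennreal_mult ennreal_plus nn_integral_cmult nn_integral_add)
      have "(\<lambda>n. ennreal (Q * P) * (ennreal (2 * M) * (\<integral>\<^sup>+x. ennreal (norm (un (r n) x - uu x)) \<partial>lborel)
          + ennreal M * (\<integral>\<^sup>+x. ennreal (norm (gn (r n) x - gg x)) \<partial>lborel)
          + (\<integral>\<^sup>+x. ennreal (\<bar>F' (un (r n) x) - F' (uu x)\<bar> * norm (gg x)) \<partial>lborel)))
        \<longlonglongrightarrow> ennreal (Q * P) * (ennreal (2 * M) * 0 + ennreal M * 0 + (\<integral>\<^sup>+(x::'a). 0 \<partial>lborel))"
        using LIMSEQ_subseq_LIMSEQ[OF lu r(1)] LIMSEQ_subseq_LIMSEQ[OF lg r(1)] lim3
        by (intro tendsto_add ennreal_tendsto_cmult) (auto simp: o_def)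
      then show ?thesis unfolding eq by simp
    qed
    have "ennreal (norm (\<integral>x. E x \<partial>lborel)) \<le> (\<integral>\<^sup>+x. ennreal (B (r n) x) \<partial>lborel)" for n
    proof -
      have "(\<integral>x. E x \<partial>lborel) = (\<integral>x. E x - En (r n) x \<partial>lborel)"
        using En0[of "r n"] Eint by (simp add: Bochner_Integration.integral_diff)
      then have "ennreal (norm (\<integral>x. E x \<partial>lborel)) \<le> (\<integral>\<^sup>+x. ennreal (norm (E x - En (r n) x)) \<partial>lborel)"
        using En0[of "r n"] Eint integral_norm_bound_ennreal[of lborel "\<lambda>x. E x - En (r n) x"] by simp
      also have "\<dots> \<le> (\<integral>\<^sup>+x. ennreal (B (r n) x) \<partial>lborel)"
        using Bd by (intro nn_integral_mono ennreal_leI) (simp add: norm_minus_commute)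
      finally show ?thesis .
    qed
    then have "ennreal (norm (\<integral>x. E x \<partial>lborel)) \<le> 0"
      by (intro LIMSEQ_le_const[OF Blim]) auto
    then have "(\<integral>x. E x \<partial>lborel) = 0" by simp
    then have "(\<integral>x. v x *\<^sub>R grad \<phi> x \<partial>lborel) + (\<integral>x. \<phi> x *\<^sub>R G x \<partial>lborel) = 0"
      unfolding E_def using i1 i2 by (simp add: Bochner_Integration.integral_add)
    then show ?thesis
      by (simp add: set_integral_lebesgue_lborel eq_neg_iff_add_eq_0)
  qed
  show "is_weak_gradient UNIV v G"
    unfolding is_weak_gradient_def using key integrable_imp_Lp_loc_1[OF vint] integrable_imp_Lp_loc_1[OF Gint] by blast
qed

lemma smooth_translation_bound:
  fixes w :: "'a::euclidean_space \<Rightarrow> real"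
  assumes "smooth w"
  shows "ennreal \<bar>w (x + h) - w x\<bar> \<le> (\<integral>\<^sup>+t. ennreal (norm h) * ennreal (norm (grad w (x + t *\<^sub>R h))) * indicator {0..1} t \<partial>lborel)"
proof -
  let ?f = "\<lambda>t. grad w (x + t *\<^sub>R h) \<bullet> h"
  have c: "continuous_on {0..1} ?f"
    by (intro continuous_intros continuous_on_compose2[OF smooth_grad_continuous[OF assms, of UNIV]]) auto
  have d: "((\<lambda>t. w (x + t *\<^sub>R h)) has_vector_derivative ?f t) (at t within {0..1})" for t
  proof -
    have "((\<lambda>t. w (x + t *\<^sub>R h)) has_derivative (\<lambda>s. grad w (x + t *\<^sub>R h) \<bullet> (s *\<^sub>R h))) (at t within {0..1})"
      by (rule has_derivative_compose[OF _ has_derivative_grad[OF smooth_differentiable[OF assms]]])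
        (auto intro!: derivative_eq_intros)
    then show ?thesis by (simp add: has_vector_derivative_def)
  qed
  have I: "has_bochner_integral lborel (\<lambda>t. indicator {0..1} t *\<^sub>R ?f t) (w (x + 1 *\<^sub>R h) - w (x + 0 *\<^sub>R h))"
    by (rule has_bochner_integral_FTC_Icc[OF _ d c]) simp
  have "ennreal \<bar>w (x + h) - w x\<bar> \<le> (\<integral>\<^sup>+t. ennreal (norm (indicator {0..1} t *\<^sub>R ?f t)) \<partial>lborel)"
    using has_bochner_integral_norm_bound[OF I] by simp
  also have "\<dots> \<le> (\<integral>\<^sup>+t. ennreal (norm h) * ennreal (norm (grad w (x + t *\<^sub>R h))) * indicator {0..1} t \<partial>lborel)"
  proof (rule nn_integral_mono)
    fix t
    have "\<bar>?f t\<bar> \<le> norm h * norm (grad w (x + t *\<^sub>R h))"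
      using Cauchy_Schwarz_ineq2[of "grad w (x + t *\<^sub>R h)" h] by (simp add: mult.commute)
    then show "ennreal (norm (indicator {0..1} t *\<^sub>R ?f t)) \<le> ennreal (norm h) * ennreal (norm (grad w (x + t *\<^sub>R h))) * indicator {0..1} t"
      by (cases "t \<in> {0..1}") (auto simp: ennreal_mult[symmetric] intro!: ennreal_leI)
  qed
  finally show ?thesis .
qed

text \<open>
  The fundamental theorem of calculus along the segments from \<open>x\<close> to \<open>x + h\<close>, integrated in \<open>x\<close>,
  for mollified functions, and then the limit. The sets \<open>S\<close> and \<open>T\<close> localise the estimate. It
  takes the place of the Sobolev and Poincare inequalities in the proof.
\<close>

lemma weak_translation_bound:
  fixes v :: "'a::euclidean_space \<Rightarrow> real"
  assumes wg: "is_weak_gradient UNIV v g" and int: "integrable lborel v" "integrable lborel g"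
    and [measurable]: "S \<in> sets borel" "T \<in> sets borel"
    and ST: "\<And>x t. x \<in> S \<Longrightarrow> 0 \<le> t \<Longrightarrow> t \<le> 1 \<Longrightarrow> x + t *\<^sub>R h \<in> T"
  shows "(\<integral>\<^sup>+x. ennreal \<bar>v (x + h) - v x\<bar> * indicator S x \<partial>lborel)
     \<le> ennreal (norm h) * (\<integral>\<^sup>+x. ennreal (norm (g x)) * indicator T x \<partial>lborel)"
proof -
  have [measurable]: "v \<in> borel_measurable borel" "g \<in> borel_measurable borel"
    using int by (auto dest: borel_measurable_integrable)
  define s where "s n = 1 / real (Suc n)" for n
  have s: "0 < s n" for n by (simp add: s_def)
  have slim: "s \<longlonglongrightarrow> 0" unfolding s_def by (rule LIMSEQ_Suc[OF lim_1_over_n])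
  define vn where "vn n = conv (mol (s n)) v" for n
  define gn where "gn n = conv (mol (s n)) g" for n
  have sm: "smooth (vn n)" for n
    unfolding vn_def by (rule smooth_conv[OF int(1) mol_smooth mol_support[OF s]])
  have [measurable]: "vn n \<in> borel_measurable borel" "gn n \<in> borel_measurable borel" for n
    unfolding vn_def gn_def by (auto intro: conv_borel)
  have gr: "grad (vn n) x = gn n x" for n x
    using grad_mollification[OF wg, of UNIV "s n" x] int s unfolding vn_def gn_def by simp
  have smooth_case: "(\<integral>\<^sup>+x. ennreal \<bar>vn n (x + h) - vn n x\<bar> * indicator S x \<partial>lborel)
     \<le> ennreal (norm h) * (\<integral>\<^sup>+x. ennreal (norm (gn n x)) * indicator T x \<partial>lborel)" (is "?L \<le> ennreal (norm h) * ?R") for n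
  proof -
    have "?L \<le> (\<integral>\<^sup>+x. \<integral>\<^sup>+t. ennreal (norm h) * ennreal (norm (gn n (x + t *\<^sub>R h))) * indicator {0..1::real} t * indicator S x \<partial>lborel \<partial>lborel)"
    proof (rule nn_integral_mono)
      fix x
      have "ennreal \<bar>vn n (x + h) - vn n x\<bar> * indicator S x
        \<le> (\<integral>\<^sup>+t. ennreal (norm h) * ennreal (norm (gn n (x + t *\<^sub>R h))) * indicator {0..1} t \<partial>lborel) * indicator S x"
        using smooth_translation_bound[OF sm, of n x h] unfolding gr by (rule mult_right_mono) simp
      then show "ennreal \<bar>vn n (x + h) - vn n x\<bar> * indicator S x
        \<le> (\<integral>\<^sup>+t. ennreal (norm h) * ennreal (norm (gn n (x + t *\<^sub>R h))) * indicator {0..1} t * indicator S x \<partial>lborel)"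
        by (subst nn_integral_multc) auto
    qed
    also have "\<dots> = (\<integral>\<^sup>+t. \<integral>\<^sup>+x. ennreal (norm h) * ennreal (norm (gn n (x + t *\<^sub>R h))) * indicator {0..1::real} t * indicator S x \<partial>lborel \<partial>lborel)"
      by (rule lborel_pair.Fubini'[symmetric]) measurable
    also have "\<dots> \<le> (\<integral>\<^sup>+t. ennreal (norm h) * ?R * indicator {0..1::real} t \<partial>lborel)"
    proof (rule nn_integral_mono)
      fix t :: real
      show "(\<integral>\<^sup>+x. ennreal (norm h) * ennreal (norm (gn n (x + t *\<^sub>R h))) * indicator {0..1} t * indicator S x \<partial>lborel)
        \<le> ennreal (norm h) * ?R * indicator {0..1} t"
      proof (cases "t \<in> {0..1}")
        case True
        have "(\<integral>\<^sup>+x. ennreal (norm h) * ennreal (norm (gn n (x + t *\<^sub>R h))) * indicator {0..1} t * indicator S x \<partial>lborel)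
          \<le> (\<integral>\<^sup>+x. ennreal (norm h) * (ennreal (norm (gn n (x + t *\<^sub>R h))) * indicator T (x + t *\<^sub>R h)) \<partial>lborel)"
          using ST True by (intro nn_integral_mono) (auto simp: indicator_def)
        also have "\<dots> = ennreal (norm h) * (\<integral>\<^sup>+x. ennreal (norm (gn n (x + t *\<^sub>R h))) * indicator T (x + t *\<^sub>R h) \<partial>lborel)"
          by (rule nn_integral_cmult) measurable
        also have "(\<integral>\<^sup>+x. ennreal (norm (gn n (x + t *\<^sub>R h))) * indicator T (x + t *\<^sub>R h) \<partial>lborel) = ?R"
          by (rule nn_integral_shift[where f="\<lambda>x. ennreal (norm (gn n x)) * indicator T x"]) measurable
        finally show ?thesis using True by simp
      qed simp
    qed
    also have "\<dots> = ennreal (norm h) * ?R" by (subst nn_integral_cmult_indicator) auto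
    finally show ?thesis .
  qed
  define \<delta> where "\<delta> n = (\<integral>\<^sup>+x. ennreal (norm (vn n x - v x)) \<partial>lborel)" for n
  define \<eta> where "\<eta> n = (\<integral>\<^sup>+x. ennreal (norm (gn n x - g x)) \<partial>lborel)" for n
  have \<delta>: "\<delta> \<longlonglongrightarrow> 0" unfolding \<delta>_def vn_def by (rule mollification_L1[OF int(1) s slim])
  have \<eta>: "\<eta> \<longlonglongrightarrow> 0" unfolding \<eta>_def gn_def by (rule mollification_L1[OF int(2) s slim])
  let ?A = "\<integral>\<^sup>+x. ennreal \<bar>v (x + h) - v x\<bar> * indicator S x \<partial>lborel"
  let ?B = "\<integral>\<^sup>+x. ennreal (norm (g x)) * indicator T x \<partial>lborel"
  have "?A \<le> \<delta> n + ennreal (norm h) * (?B + \<eta> n) + \<delta> n" for n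
  proof -
    have "?A \<le> (\<integral>\<^sup>+x. ennreal (norm (vn n (x + h) - v (x + h))) + ennreal \<bar>vn n (x + h) - vn n x\<bar> * indicator S x + ennreal (norm (vn n x - v x)) \<partial>lborel)"
    proof (rule nn_integral_mono)
      fix x
      have "ennreal \<bar>v (x + h) - v x\<bar> \<le> ennreal (norm (vn n (x + h) - v (x + h))) + ennreal \<bar>vn n (x + h) - vn n x\<bar> + ennreal (norm (vn n x - v x))"
        by (simp add: ennreal_plus[symmetric] ennreal_leI del: ennreal_plus)
      then show "ennreal \<bar>v (x + h) - v x\<bar> * indicator S x
        \<le> ennreal (norm (vn n (x + h) - v (x + h))) + ennreal \<bar>vn n (x + h) - vn n x\<bar> * indicator S x + ennreal (norm (vn n x - v x))"
        by (cases "x \<in> S") auto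
    qed
    also have "\<dots> = (\<integral>\<^sup>+x. ennreal (norm (vn n (x + h) - v (x + h))) \<partial>lborel) + (\<integral>\<^sup>+x. ennreal \<bar>vn n (x + h) - vn n x\<bar> * indicator S x \<partial>lborel) + \<delta> n"
      unfolding \<delta>_def by (subst nn_integral_add; measurable)+
    also have "(\<integral>\<^sup>+x. ennreal (norm (vn n (x + h) - v (x + h))) \<partial>lborel) = \<delta> n"
      unfolding \<delta>_def by (rule nn_integral_shift[where f="\<lambda>x. ennreal (norm (vn n x - v x))"]) measurable
    also have "\<delta> n + (\<integral>\<^sup>+x. ennreal \<bar>vn n (x + h) - vn n x\<bar> * indicator S x \<partial>lborel) + \<delta> n
      \<le> \<delta> n + ennreal (norm h) * (?B + \<eta> n) + \<delta> n"
    proof (intro add_mono order_refl order_trans[OF smooth_case] mult_left_mono)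
      have "(\<integral>\<^sup>+x. ennreal (norm (gn n x)) * indicator T x \<partial>lborel) \<le> (\<integral>\<^sup>+x. ennreal (norm (g x)) * indicator T x + ennreal (norm (gn n x - g x)) \<partial>lborel)"
      proof (rule nn_integral_mono)
        fix x
        have "norm (gn n x) \<le> norm (g x) + norm (gn n x - g x)" using norm_triangle_ineq[of "g x" "gn n x - g x"] by simp
        then have "ennreal (norm (gn n x)) \<le> ennreal (norm (g x)) + ennreal (norm (gn n x - g x))"
          by (simp add: ennreal_plus[symmetric] ennreal_leI del: ennreal_plus)
        then show "ennreal (norm (gn n x)) * indicator T x \<le> ennreal (norm (g x)) * indicator T x + ennreal (norm (gn n x - g x))"
          by (cases "x \<in> T") auto
      qed
      also have "\<dots> = ?B + \<eta> n" unfolding \<eta>_def by (rule nn_integral_add) measurable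
      finally show "(\<integral>\<^sup>+x. ennreal (norm (gn n x)) * indicator T x \<partial>lborel) \<le> ?B + \<eta> n" .
    qed simp
    finally show ?thesis .
  qed
  moreover have "(\<lambda>n. \<delta> n + ennreal (norm h) * (?B + \<eta> n) + \<delta> n) \<longlonglongrightarrow> 0 + ennreal (norm h) * (?B + 0) + 0"
  proof -
    have "(\<lambda>n. ?B + \<eta> n) \<longlonglongrightarrow> ?B + 0" by (rule tendsto_add[OF tendsto_const \<eta>])
    then have "(\<lambda>n. ennreal (norm h) * (?B + \<eta> n)) \<longlonglongrightarrow> ennreal (norm h) * (?B + 0)"
      by (rule ennreal_tendsto_cmult[rotated]) simp
    from tendsto_add[OF tendsto_add[OF \<delta> this] \<delta>] show ?thesis .
  qed
  ultimately have "?A \<le> 0 + ennreal (norm h) * (?B + 0) + 0"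
    by (intro LIMSEQ_le_const) auto
  then show ?thesis by simp
qed

section \<open>The fractional kernels\<close>

text \<open>
  A non-integrable \<open>f\<close> has integral \<open>0\<close>, so the inequality is unconditional. It bounds the
  nonlocal energy from above by integrals of nonnegative functions.
\<close>

lemma ennreal_integral_le_nn_integral:
  fixes f :: "'a \<Rightarrow> real"
  shows "ennreal (\<integral>x. f x \<partial>M) \<le> (\<integral>\<^sup>+x. ennreal (f x) \<partial>M)"
proof (cases "integrable M f")
  case True
  have m: "integrable M (\<lambda>x. max 0 (f x))" using True by (intro Bochner_Integration.integrable_max) auto
  have "ennreal (\<integral>x. f x \<partial>M) \<le> ennreal (\<integral>x. max 0 (f x) \<partial>M)"
    by (intro ennreal_leI integral_mono True m) auto
  also have "\<dots> = (\<integral>\<^sup>+x. ennreal (max 0 (f x)) \<partial>M)"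
    by (rule nn_integral_eq_integral[symmetric, OF m]) auto
  also have "\<dots> = (\<integral>\<^sup>+x. ennreal (f x) \<partial>M)"
    by (intro nn_integral_cong) (auto simp: max_def ennreal_neg)
  finally show ?thesis .
next
  case False
  then show ?thesis by (simp add: not_integrable_integral_eq)
qed

text \<open>
  In polar terms the integral is \<open>\<integral> min 1 t\<^bsup>p\<^esup> * t\<^bsup>- s p - 1\<^esup> dt\<close> over the half-line, up to the
  measure of the sphere. Polar coordinates are replaced by the layer cake representation \<open>norm z\<^bsup>-
  a\<^esup> = a * \<integral> t\<^bsup>- a - 1\<^esup> dt\<close> over \<open>t \<ge> norm z\<close>: the numerator is increased to \<open>min 1 t\<^bsup>p\<^esup>\<close>, and
  Fubini's theorem leaves the volumes of balls of radius \<open>t\<close>. The two fractions come from \<open>t \<le> 1\<close>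
  and \<open>t \<ge> 1\<close>.
\<close>

lemma kernel_integral_bound:
  assumes s: "0 < s" "s < 1" and p: "1 < p"
  defines "a \<equiv> real DIM('a) + s * p"
  shows "(\<integral>\<^sup>+z. ennreal (min 1 (norm z) powr p * norm (z::'a::euclidean_space) powr (- a)) \<partial>lborel)
    \<le> ennreal (a * unit_ball_vol (DIM('a)) * (1 / ((1 - s) * p) + 1 / (s * p)))"
proof -
  let ?\<omega> = "unit_ball_vol (real DIM('a))"
  have a: "0 < a" using s p by (simp add: a_def add_pos_pos)
  have w: "0 \<le> ?\<omega>" by simp
  define f where "f t = a * (min 1 t powr p * t powr (- a - 1))" for t :: real
  have f0: "0 \<le> f t" for t using a by (simp add: f_def)
  have [measurable]: "f \<in> borel_measurable borel" unfolding f_def by measurable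
  have "(\<integral>\<^sup>+z. ennreal (min 1 (norm z) powr p * norm (z::'a) powr (- a)) \<partial>lborel)
    \<le> (\<integral>\<^sup>+z. \<integral>\<^sup>+t. ennreal (f t) * indicator {0<..} t * (if norm (z::'a) \<le> t then 1 else 0) \<partial>lborel \<partial>lborel)"
  proof (rule nn_integral_mono)
    fix z :: 'a
    show "ennreal (min 1 (norm z) powr p * norm z powr (- a))
      \<le> (\<integral>\<^sup>+t. ennreal (f t) * indicator {0<..} t * (if norm z \<le> t then 1 else 0) \<partial>lborel)"
    proof (cases "z = 0")
      case True
      then show ?thesis by simp
    next
      case False
      then have z: "0 < norm z" by simp
      let ?c = "a * min 1 (norm z) powr p"
      have c: "0 \<le> ?c" using a by simp
      have "((\<lambda>t. t powr (- a - 1)) has_integral - (norm z powr (- a - 1 + 1)) / (- a - 1 + 1)) {norm z..}"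
        using a z by (intro has_integral_powr_to_inf) auto
      then have "((\<lambda>t. ?c * t powr (- a - 1)) has_integral ?c * (- (norm z powr (- a - 1 + 1)) / (- a - 1 + 1))) {norm z..}"
        by (rule has_integral_mult_right)
      also have "?c * (- (norm z powr (- a - 1 + 1)) / (- a - 1 + 1)) = min 1 (norm z) powr p * norm z powr (- a)"
        using a by simp
      finally have "(\<integral>\<^sup>+t. ennreal (indicator {norm z..} t * (?c * t powr (- a - 1))) \<partial>lborel) = ennreal (min 1 (norm z) powr p * norm z powr (- a))"
        using c by (intro nn_integral_has_integral_lebesgue) auto
      moreover have "(\<integral>\<^sup>+t. ennreal (indicator {norm z..} t * (?c * t powr (- a - 1))) \<partial>lborel)
        \<le> (\<integral>\<^sup>+t. ennreal (f t) * indicator {0<..} t * (if norm z \<le> t then 1 else 0) \<partial>lborel)"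
      proof (rule nn_integral_mono)
        fix t
        show "ennreal (indicator {norm z..} t * (?c * t powr (- a - 1))) \<le> ennreal (f t) * indicator {0<..} t * (if norm z \<le> t then 1 else 0)"
        proof (cases "norm z \<le> t")
          case True
          have "?c * t powr (- a - 1) \<le> f t"
            unfolding f_def mult.assoc using True a p by (intro mult_left_mono mult_right_mono powr_mono2) auto
          moreover have "0 < t" by (rule less_le_trans[OF z True])
          ultimately show ?thesis using True by (simp add: ennreal_leI)
        qed simp
      qed
      ultimately show ?thesis by simp
    qed
  qed
  also have "\<dots> = (\<integral>\<^sup>+t. \<integral>\<^sup>+z. ennreal (f t) * indicator {0<..} t * (if norm (z::'a) \<le> t then 1 else 0) \<partial>lborel \<partial>lborel)"
    by (rule lborel_pair.Fubini'[symmetric]) measurable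
  also have "\<dots> \<le> (\<integral>\<^sup>+t. ennreal (indicator {0..1} t * (a * ?\<omega> * t powr (p - s * p - 1))) + ennreal (indicator {1..} t * (a * ?\<omega> * t powr (- (s * p) - 1))) \<partial>lborel)"
  proof (rule nn_integral_mono)
    fix t :: real
    have "(\<integral>\<^sup>+z. ennreal (f t) * indicator {0<..} t * (if norm (z::'a) \<le> t then 1 else 0) \<partial>lborel)
      = (\<integral>\<^sup>+z. ennreal (f t) * indicator {0<..} t * indicator (cball 0 t) (z::'a) \<partial>lborel)"
      by (intro nn_integral_cong) (simp add: indicator_def)
    also have "\<dots> = ennreal (f t) * indicator {0<..} t * emeasure lborel (cball (0::'a) t)"
      by (rule nn_integral_cmult_indicator) simp
    also have "\<dots> \<le> ennreal (indicator {0..1} t * (a * ?\<omega> * t powr (p - s * p - 1))) + ennreal (indicator {1..} t * (a * ?\<omega> * t powr (- (s * p) - 1)))"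
    proof (cases "0 < t")
      case True
      have e: "ennreal (f t) * indicator {0<..} t * emeasure lborel (cball (0::'a) t) = ennreal (f t * (?\<omega> * t ^ DIM('a)))"
        using True f0 by (simp add: emeasure_cball ennreal_mult[symmetric])
      have pw: "t ^ DIM('a) = t powr (real DIM('a))" using True by (simp add: powr_realpow)
      have "f t * (?\<omega> * t ^ DIM('a)) = a * ?\<omega> * (min 1 t powr p * (t powr (- a - 1) * t powr (real DIM('a))))"
        unfolding f_def pw by (simp add: mult_ac)
      also have "t powr (- a - 1) * t powr (real DIM('a)) = t powr (- (s * p) - 1)"
        by (simp add: powr_add[symmetric] a_def)
      finally have g: "f t * (?\<omega> * t ^ DIM('a)) = a * ?\<omega> * (min 1 t powr p * t powr (- (s * p) - 1))" .
      show ?thesis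
      proof (cases "t \<le> 1")
        case t1: True
        have "min 1 t powr p * t powr (- (s * p) - 1) = t powr (p - s * p - 1)"
          using t1 by (simp add: powr_add[symmetric] algebra_simps)
        then show ?thesis unfolding e g using t1 True by simp
      next
        case False
        then show ?thesis unfolding e g by simp
      qed
    qed simp
    finally show "(\<integral>\<^sup>+z. ennreal (f t) * indicator {0<..} t * (if norm (z::'a) \<le> t then 1 else 0) \<partial>lborel)
      \<le> ennreal (indicator {0..1} t * (a * ?\<omega> * t powr (p - s * p - 1))) + ennreal (indicator {1..} t * (a * ?\<omega> * t powr (- (s * p) - 1)))" .
  qed
  also have "\<dots> = (\<integral>\<^sup>+t. ennreal (indicator {0..1} t * (a * ?\<omega> * t powr (p - s * p - 1))) \<partial>lborel) + (\<integral>\<^sup>+t. ennreal (indicator {1..} t * (a * ?\<omega> * t powr (- (s * p) - 1))) \<partial>lborel)"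
    by (rule nn_integral_add) measurable
  also have "(\<integral>\<^sup>+t. ennreal (indicator {0..1} t * (a * ?\<omega> * t powr (p - s * p - 1))) \<partial>lborel) = ennreal (a * ?\<omega> * (1 / ((1 - s) * p)))"
  proof (rule nn_integral_has_integral_lebesgue)
    have sp: "s * p < p" using s p by simp
    have "((\<lambda>t. t powr (p - s * p - 1)) has_integral 1 powr (p - s * p - 1 + 1) / (p - s * p - 1 + 1)) {0..1::real}"
      using sp by (intro has_integral_powr_from_0) auto
    then have "((\<lambda>t. t powr (p - s * p - 1)) has_integral 1 / ((1 - s) * p)) {0..1::real}"
      by (simp add: algebra_simps)
    then show "((\<lambda>t. a * ?\<omega> * t powr (p - s * p - 1)) has_integral a * ?\<omega> * (1 / ((1 - s) * p))) {0..1}"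
      by (rule has_integral_mult_right)
  qed (use a w in auto)
  also have "(\<integral>\<^sup>+t. ennreal (indicator {1..} t * (a * ?\<omega> * t powr (- (s * p) - 1))) \<partial>lborel) = ennreal (a * ?\<omega> * (1 / (s * p)))"
  proof (rule nn_integral_has_integral_lebesgue)
    have sp: "0 < s * p" using s p by simp
    have "((\<lambda>t. t powr (- (s * p) - 1)) has_integral - (1 powr (- (s * p) - 1 + 1)) / (- (s * p) - 1 + 1)) {1..}"
      using sp by (intro has_integral_powr_to_inf) auto
    then have "((\<lambda>t. t powr (- (s * p) - 1)) has_integral 1 / (s * p)) {1..}" by simp
    then show "((\<lambda>t. a * ?\<omega> * t powr (- (s * p) - 1)) has_integral a * ?\<omega> * (1 / (s * p))) {1..}"
      by (rule has_integral_mult_right)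
  qed (use a w in auto)
  also have "ennreal (a * ?\<omega> * (1 / ((1 - s) * p))) + ennreal (a * ?\<omega> * (1 / (s * p))) = ennreal (a * ?\<omega> * (1 / ((1 - s) * p) + 1 / (s * p)))"
    using a s p w by (subst ennreal_plus[symmetric]) (auto simp: algebra_simps)
  finally show ?thesis .
qed

text \<open>
  The constant is \<open>s * (1 - s)\<close> times a function continuous and nonnegative on \<open>[0,1]\<close>, and \<open>s *
  (1 - s) * (1 / ((1 - s) * p) + 1 / (s * p)) = 1 / p\<close>.
\<close>

lemma C_norm_props:
  assumes p: "1 < p" and N: "0 < N"
  shows "continuous_on {0..1} (\<lambda>s. C_norm N s p)"
    and "\<And>s. s \<in> {0..1} \<Longrightarrow> 0 \<le> C_norm N s p"
    and "\<exists>c\<ge>0. \<forall>s. 0 < s \<and> s < 1 \<longrightarrow> C_norm N s p * (1 / ((1 - s) * p) + 1 / (s * p)) \<le> c"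
proof -
  define h where "h s = (p / 2 * 2 powr (2 * s - 1)) / pi powr ((real N - 1) / 2)
     * (Gamma ((real N + p * s) / 2) / (Gamma ((p + 1) / 2) * Gamma (2 - s)))" for s
  have eq: "C_norm N s p = s * (1 - s) * h s" for s
    unfolding C_norm_def h_def by (simp add: field_simps)
  have pos: "0 < (real N + p * s) / 2" "0 < 2 - s" if "s \<in> {0..1}" for s
    using that p N by (auto intro: add_pos_nonneg)
  have h0: "0 \<le> h s" if "s \<in> {0..1}" for s
    unfolding h_def using p pos[OF that] Gamma_real_pos[of "(p + 1) / 2"] Gamma_real_pos[OF pos(1)[OF that]] Gamma_real_pos[OF pos(2)[OF that]]
    by (intro mult_nonneg_nonneg divide_nonneg_nonneg) auto
  have G: "continuous_on {0<..} (Gamma :: real \<Rightarrow> real)"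
    by (rule continuous_on_Gamma) (auto elim!: nonpos_Ints_cases)
  have g1: "continuous_on {0..1} (\<lambda>s. Gamma ((real N + p * s) / 2))"
    by (rule continuous_on_compose2[OF G]) (use pos(1) in \<open>auto intro!: continuous_intros\<close>)
  have g2: "continuous_on {0..1} (\<lambda>s. Gamma (2 - s :: real))"
    by (rule continuous_on_compose2[OF G]) (use pos(2) in \<open>auto intro!: continuous_intros\<close>)
  have g2': "Gamma (2 - s) \<noteq> 0" if "s \<in> {0..1}" for s :: real using Gamma_real_pos[OF pos(2)[OF that]] by simp
  have "0 < Gamma ((p + 1) / 2)" using p by (intro Gamma_real_pos) simp
  then have g3: "Gamma ((p + 1) / 2) \<noteq> 0" by simp
  have hc: "continuous_on {0..1} h"
    unfolding h_def by (intro continuous_intros g1 g2) (use g2' g3 in auto)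
  show "continuous_on {0..1} (\<lambda>s. C_norm N s p)"
    unfolding eq by (intro continuous_intros hc)
  show "0 \<le> C_norm N s p" if "s \<in> {0..1}" for s
    unfolding eq using h0[OF that] that by (intro mult_nonneg_nonneg) auto
  have "bounded (h ` {0..1})" by (intro compact_imp_bounded compact_continuous_image hc) simp
  then obtain B where B: "\<And>s. s \<in> {0..1} \<Longrightarrow> norm (h s) \<le> B" unfolding bounded_iff by blast
  show "\<exists>c\<ge>0. \<forall>s. 0 < s \<and> s < 1 \<longrightarrow> C_norm N s p * (1 / ((1 - s) * p) + 1 / (s * p)) \<le> c"
  proof (intro exI[of _ "B / p"] conjI allI impI)
    show "0 \<le> B / p" using B[of 0] p by simp
    fix s :: real assume s: "0 < s \<and> s < 1"
    have "C_norm N s p * (1 / ((1 - s) * p) + 1 / (s * p)) = h s / p"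
      unfolding eq using s p by (simp add: field_simps)
    also have "\<dots> \<le> B / p" using B[of s] s p by (intro divide_right_mono) auto
    finally show "C_norm N s p * (1 / ((1 - s) * p) + 1 / (s * p)) \<le> B / p" .
  qed
qed

text \<open>
  The bound is uniform in \<open>s\<close>: the normalising constant degenerates at \<open>s = 0\<close> and \<open>s = 1\<close> exactly
  as fast as the kernel integral blows up. Integration over \<open>s\<close> then costs no more than the total
  mass of \<open>\<mu>\<close>.
\<close>

lemma kernel_constant:
  assumes p: "1 < p"
  obtains c where "0 \<le> c" "\<And>s. 0 < s \<Longrightarrow> s < 1 \<Longrightarrow>
    ennreal (C_norm DIM('a) s p) * (\<integral>\<^sup>+z. ennreal (min 1 (norm z) powr p * norm (z::'a::euclidean_space) powr (- (real DIM('a) + s * p))) \<partial>lborel) \<le> ennreal c"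
proof -
  obtain c where c: "0 \<le> c" "\<And>s. 0 < s \<Longrightarrow> s < 1 \<Longrightarrow> C_norm DIM('a) s p * (1 / ((1 - s) * p) + 1 / (s * p)) \<le> c"
    using C_norm_props(3)[OF p, of "DIM('a)"] by auto
  let ?\<omega> = "unit_ball_vol (real DIM('a))"
  show thesis
  proof (rule that[of "(real DIM('a) + p) * ?\<omega> * c"])
    show "0 \<le> (real DIM('a) + p) * ?\<omega> * c" using c(1) p by simp
    fix s :: real assume s: "0 < s" "s < 1"
    let ?a = "real DIM('a) + s * p" and ?q = "1 / ((1 - s) * p) + 1 / (s * p)"
    have C0: "0 \<le> C_norm DIM('a) s p" using C_norm_props(2)[OF p, of "DIM('a)" s] s by simp
    have "ennreal (C_norm DIM('a) s p) * (\<integral>\<^sup>+z. ennreal (min 1 (norm z) powr p * norm (z::'a) powr (- ?a)) \<partial>lborel)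
      \<le> ennreal (C_norm DIM('a) s p) * ennreal (?a * ?\<omega> * ?q)"
      by (intro mult_left_mono kernel_integral_bound s p) simp
    also have "\<dots> = ennreal (?a * ?\<omega> * (C_norm DIM('a) s p * ?q))"
      using C0 by (simp add: ennreal_mult'[symmetric] mult_ac)
    also have "?a * ?\<omega> * (C_norm DIM('a) s p * ?q) \<le> (real DIM('a) + p) * ?\<omega> * c"
    proof (rule mult_mono)
      show "?a * ?\<omega> \<le> (real DIM('a) + p) * ?\<omega>" using s p by (intro mult_right_mono add_left_mono) auto
      show "C_norm DIM('a) s p * ?q \<le> c" by (rule c(2)[OF s])
      show "0 \<le> (real DIM('a) + p) * ?\<omega>" using p by simp
      show "0 \<le> C_norm DIM('a) s p * ?q" using C0 s p by simp
    qed
    finally show "ennreal (C_norm DIM('a) s p) * (\<integral>\<^sup>+z. ennreal (min 1 (norm z) powr p * norm (z::'a) powr (- ?a)) \<partial>lborel)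
      \<le> ennreal ((real DIM('a) + p) * ?\<omega> * c)" by (simp add: ennreal_leI)
  qed
qed

section \<open>The support of the measure and the tail\<close>

text \<open>
  The complement of the support is covered by those members of a countable basis that are null
  sets.
\<close>

lemma AE_measure_support:
  assumes sets: "sets \<mu> = sets (restrict_space borel {0..1::real})"
  shows "AE s in \<mu>. s \<in> measure_support \<mu>"
proof -
  have sp: "space \<mu> = {0..1}" using sets_eq_imp_space_eq[OF sets] by (simp add: space_restrict_space)
  obtain B :: "real set set" where B: "countable B" "topological_basis B" using ex_countable_basis by blast
  define Z where "Z = {b \<inter> space \<mu> |b. b \<in> B \<and> emeasure \<mu> (b \<inter> space \<mu>) = 0}"
  have meas: "b \<inter> space \<mu> \<in> sets \<mu>" if "open b" for b
  proof -
    have "{0..1} \<inter> b \<in> (\<inter>) {0..1} ` sets borel" by (rule imageI) (rule borel_open[OF that])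
    then show ?thesis unfolding sp sets sets_restrict_space Int_commute[of b] .
  qed
  have "\<Union>Z \<in> null_sets \<mu>"
  proof (rule null_sets_UN'[of Z "\<lambda>x. x", simplified])
    show "countable Z" unfolding Z_def using countable_subset[OF _ B(1), of "{b \<in> B. emeasure \<mu> (b \<inter> space \<mu>) = 0}"]
      by (auto simp: setcompr_eq_image intro!: countable_image)
    show "z \<in> null_sets \<mu>" if "z \<in> Z" for z
      using that meas topological_basis_open[OF B(2)] by (auto simp: Z_def null_sets_def)
  qed
  moreover have "{s \<in> space \<mu>. s \<notin> measure_support \<mu>} \<subseteq> \<Union>Z"
  proof
    fix s assume "s \<in> {s \<in> space \<mu>. s \<notin> measure_support \<mu>}"
    then obtain U where U: "s \<in> space \<mu>" "open U" "s \<in> U" "emeasure \<mu> (U \<inter> space \<mu>) = 0"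
      unfolding measure_support_def by (auto simp: not_gr_zero)
    obtain b where b: "b \<in> B" "s \<in> b" "b \<subseteq> U"
      using topological_basisE[OF B(2) U(2,3)] by blast
    have "emeasure \<mu> (b \<inter> space \<mu>) \<le> emeasure \<mu> (U \<inter> space \<mu>)"
      using b(3) meas[OF U(2)] by (intro emeasure_mono) auto
    then show "s \<in> \<Union>Z" using U b by (auto simp: Z_def)
  qed
  ultimately show ?thesis by (rule AE_I')
qed

lemma measure_support_nonempty:
  assumes "sets \<mu> = sets (restrict_space borel {0..1::real})" "emeasure \<mu> S > 0" "S \<in> sets \<mu>"
  shows "measure_support \<mu> \<noteq> {}"
proof
  assume empty: "measure_support \<mu> = {}"
  have "AE s in \<mu>. s \<notin> S" using AE_measure_support[OF assms(1)] by eventually_elim (use empty in simp)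
  then have "S \<in> null_sets \<mu>" using assms(3) by (simp add: AE_iff_null_sets)
  then show False using assms(2) by (simp add: null_sets_def)
qed

text \<open>
  Let \<open>S\<close> be the supremum over the support. For \<open>s\<close> in the support, \<open>r\<^bsup>p\<^esup> \<le> r\<^bsup>s p\<^esup> = (r / R)\<^bsup>s p\<^esup>
  * R\<^bsup>s p\<^esup> \<le> S\<^bsup>p-1\<^esup> * R\<^bsup>s p\<^esup>\<close> because \<open>r \<le> 1\<close>, and almost every \<open>s\<close> lies in the support. Hence the
  left-hand side is at most the \<open>p - 1\<close>-st power of the product of \<open>S\<close> and the tail.
\<close>

lemma tail_scaling:
  fixes u :: "'a::euclidean_space \<Rightarrow> real" and \<mu> :: "real measure"
  assumes p: "1 < p" and sets: "sets \<mu> = sets (restrict_space borel {0..1::real})"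
    and r: "0 < r" "r \<le> 1" "r < R" and d: "0 \<le> d" and fin: "Tail \<mu> p u x0 R < \<infinity>"
    and meas: "(\<lambda>s. \<integral>\<^sup>+y\<in>- ball x0 R. ennreal (\<bar>u y\<bar> powr (p - 1) / norm (y - x0) powr (real DIM('a) + s * p)) \<partial>lebesgue) \<in> borel_measurable \<mu>"
      "(\<lambda>s. C_norm DIM('a) s p) \<in> borel_measurable \<mu>"
    and le: "(SUP s\<in>measure_support \<mu>. ereal ((r / R) powr (s * p / (p - 1)))) * enn2ereal (Tail \<mu> p u x0 R) \<le> ereal d"
  shows "ennreal (r powr p) * (\<integral>\<^sup>+s\<in>{0<..<1}. ennreal (C_norm DIM('a) s p)
      * (\<integral>\<^sup>+y\<in>- ball x0 R. ennreal (\<bar>u y\<bar> powr (p - 1) / norm (y - x0) powr (real DIM('a) + s * p)) \<partial>lebesgue) \<partial>\<mu>)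
    \<le> ennreal (d powr (p - 1))"
proof -
  define T where "T s = (\<integral>\<^sup>+y\<in>- ball x0 R. ennreal (\<bar>u y\<bar> powr (p - 1) / norm (y - x0) powr (real DIM('a) + s * p)) \<partial>lebesgue)" for s
  define C where "C s = C_norm DIM('a) s p" for s
  have [measurable]: "T \<in> borel_measurable \<mu>" "C \<in> borel_measurable \<mu>" using meas by (simp_all add: T_def[abs_def] C_def[abs_def])
  have sp: "space \<mu> = {0..1}" using sets_eq_imp_space_eq[OF sets] by (simp add: space_restrict_space)
  have mI: "{0<..<1} \<in> sets \<mu>" unfolding sets sets_restrict_space
    by (rule image_eqI[of _ _ "{0<..<1}"]) auto
  have idm: "(\<lambda>s. s) \<in> borel_measurable \<mu>"
    by (subst measurable_cong_sets[OF sets refl]) (simp add: measurable_restrict_space1)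
  define I where "I = (\<integral>\<^sup>+s\<in>{0<..<1}. ennreal (C s * R powr (s * p)) * T s \<partial>\<mu>)"
  define S where "S = (SUP s\<in>measure_support \<mu>. ereal ((r / R) powr (s * p / (p - 1))))"
  have Tail: "Tail \<mu> p u x0 R = (if I = \<infinity> then \<infinity> else ennreal (enn2real I powr (1 / (p - 1))))"
    unfolding Tail_def Let_def I_def T_def C_def ..
  then have I: "I \<noteq> \<infinity>" using fin by auto
  define i where "i = enn2real I"
  have i: "I = ennreal i" "0 \<le> i" using I by (auto simp: i_def less_top)
  have rR: "0 < r / R" "r / R < 1" using r by auto
  show ?thesis
  proof (cases "measure_support \<mu> = {}")
    case True
    then have "AE s in \<mu>. False" using AE_measure_support[OF sets] by simp
    then have "(\<integral>\<^sup>+s\<in>{0<..<1}. ennreal (C s) * T s \<partial>\<mu>) = (\<integral>\<^sup>+s. 0 \<partial>\<mu>)"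
      by (intro nn_integral_cong_AE) auto
    then show ?thesis unfolding T_def[symmetric] C_def[symmetric] by simp
  next
    case False
    have S1: "S \<le> 1" unfolding S_def
    proof (rule SUP_least)
      fix s assume "s \<in> measure_support \<mu>"
      then have "0 \<le> s" using sp by (auto simp: measure_support_def)
      then show "ereal ((r / R) powr (s * p / (p - 1))) \<le> 1"
        using rR p by (simp add: powr_le1)
    qed
    have S0: "0 \<le> S"
    proof -
      obtain s where "s \<in> measure_support \<mu>" using False by blast
      then have "ereal ((r / R) powr (s * p / (p - 1))) \<le> S" unfolding S_def by (rule SUP_upper)
      moreover have "0 \<le> ereal ((r / R) powr (s * p / (p - 1)))" by simp
      ultimately show ?thesis by (rule order_trans[rotated])
    qed
    define \<sigma> where "\<sigma> = real_of_ereal S"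
    have \<sigma>: "S = ereal \<sigma>" "0 \<le> \<sigma>" using S0 S1 by (cases S; auto simp: \<sigma>_def)+
    have "\<sigma> * i powr (1 / (p - 1)) \<le> d"
      using le I unfolding S_def[symmetric] Tail \<sigma>(1) i_def[symmetric] by (simp add: enn2ereal_ennreal)
    then have "(\<sigma> * i powr (1 / (p - 1))) powr (p - 1) \<le> d powr (p - 1)"
      using \<sigma>(2) p by (intro powr_mono2) auto
    then have fin: "\<sigma> powr (p - 1) * i \<le> d powr (p - 1)"
      using p i(2) by (simp add: powr_mult powr_powr)
    have pt: "ennreal (r powr p) * (ennreal (C s) * T s) \<le> ennreal (\<sigma> powr (p - 1)) * (ennreal (C s * R powr (s * p)) * T s)"
      if s: "s \<in> measure_support \<mu>" "s \<in> {0<..<1}" for s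
    proof -
      have "(r / R) powr (s * p / (p - 1)) \<le> \<sigma>"
        using SUP_upper[OF s(1), of "\<lambda>s. ereal ((r / R) powr (s * p / (p - 1)))"] unfolding S_def[symmetric] \<sigma>(1) by simp
      then have "((r / R) powr (s * p / (p - 1))) powr (p - 1) \<le> \<sigma> powr (p - 1)"
        using p by (intro powr_mono2) auto
      then have a: "(r / R) powr (s * p) \<le> \<sigma> powr (p - 1)" using p by (simp add: powr_powr)
      have "r powr p \<le> r powr (s * p)" using r s p by (intro powr_mono') auto
      also have "\<dots> = (r / R) powr (s * p) * R powr (s * p)" using r by (simp add: powr_divide)
      also have "\<dots> \<le> \<sigma> powr (p - 1) * R powr (s * p)" using a by (intro mult_right_mono) auto
      finally have b: "r powr p \<le> \<sigma> powr (p - 1) * R powr (s * p)" .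
      have C0: "0 \<le> C s" using C_norm_props(2)[OF p, of "DIM('a)" s] s by (simp add: C_def)
      have "ennreal (r powr p) * (ennreal (C s) * T s) \<le> ennreal (\<sigma> powr (p - 1) * R powr (s * p)) * (ennreal (C s) * T s)"
        using b by (intro mult_right_mono ennreal_leI) auto
      also have "\<dots> = ennreal (\<sigma> powr (p - 1)) * (ennreal (C s * R powr (s * p)) * T s)"
        using C0 by (simp add: ennreal_mult mult_ac)
      finally show ?thesis .
    qed
    have m: "(\<lambda>s. ennreal (C s * R powr (s * p)) * T s * indicator {0<..<1} s) \<in> borel_measurable \<mu>"
      using idm mI by measurable
    have m2: "(\<lambda>s. ennreal (C s) * T s * indicator {0<..<1} s) \<in> borel_measurable \<mu>"
      using mI by measurable
    have "ennreal (r powr p) * (\<integral>\<^sup>+s\<in>{0<..<1}. ennreal (C s) * T s \<partial>\<mu>)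
        = (\<integral>\<^sup>+s. ennreal (r powr p) * (ennreal (C s) * T s * indicator {0<..<1} s) \<partial>\<mu>)"
      by (rule nn_integral_cmult[symmetric, OF m2])
    also have "\<dots> \<le> (\<integral>\<^sup>+s. ennreal (\<sigma> powr (p - 1)) * (ennreal (C s * R powr (s * p)) * T s * indicator {0<..<1} s) \<partial>\<mu>)"
      using AE_measure_support[OF sets]
    proof (intro nn_integral_mono_AE, eventually_elim)
      case (elim s)
      then show ?case using pt[of s] by (cases "s \<in> {0<..<1}") (auto simp: mult.assoc)
    qed
    also have "\<dots> = ennreal (\<sigma> powr (p - 1)) * I"
      unfolding I_def by (rule nn_integral_cmult[OF m])
    also have "\<dots> \<le> ennreal (d powr (p - 1))"
      unfolding i(1) using fin i(2) by (simp add: ennreal_mult[symmetric] ennreal_leI)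
    finally show ?thesis unfolding T_def C_def .
  qed
qed

lemma Tail_finite_mono:
  fixes u v :: "'a::euclidean_space \<Rightarrow> real"
  assumes p: "1 < p" and le: "\<And>y. \<bar>v y\<bar> \<le> \<bar>u y\<bar>" and fin: "Tail \<mu> p u x0 R < \<infinity>"
  shows "Tail \<mu> p v x0 R < \<infinity>"
proof -
  define I where "I f = (\<integral>\<^sup>+s\<in>{0<..<1}. ennreal (C_norm DIM('a) s p * R powr (s * p))
                 * (\<integral>\<^sup>+y\<in>- ball x0 R.
                      ennreal (\<bar>f y\<bar> powr (p - 1) / norm (y - x0) powr (real DIM('a) + s * p))
                    \<partial>lebesgue) \<partial>\<mu>)" for f :: "'a \<Rightarrow> real"
  have T: "Tail \<mu> p f x0 R = (if I f = \<infinity> then \<infinity> else ennreal (enn2real (I f) powr (1 / (p - 1))))" for f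
    unfolding Tail_def Let_def I_def ..
  have "I v \<le> I u"
    unfolding I_def using p le
    by (intro nn_integral_mono mult_right_mono mult_left_mono ennreal_leI divide_right_mono powr_mono2) auto
  moreover have "I u \<noteq> \<infinity>" using fin unfolding T by (auto split: if_splits)
  ultimately have "I v \<noteq> \<infinity>" by (auto simp: top_unique)
  then show ?thesis unfolding T by simp
qed

lemma outer_integral_lborel:
  fixes u w :: "'a::euclidean_space \<Rightarrow> real"
  assumes "AE x in lebesgue. u x = w x"
  shows "(\<integral>\<^sup>+y\<in>- ball x0 R. ennreal (\<bar>max (- u y) 0\<bar> powr (p - 1) / norm (y - x0) powr e) \<partial>lebesgue)
    = (\<integral>\<^sup>+y. ennreal ((max (- w y) 0) powr (p - 1) / norm (y - x0) powr e) * indicator (- ball x0 R) y \<partial>lborel)"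
proof -
  have "(\<integral>\<^sup>+y\<in>- ball x0 R. ennreal (\<bar>max (- u y) 0\<bar> powr (p - 1) / norm (y - x0) powr e) \<partial>lebesgue)
    = (\<integral>\<^sup>+y\<in>- ball x0 R. ennreal ((max (- w y) 0) powr (p - 1) / norm (y - x0) powr e) \<partial>lebesgue)"
    by (rule nn_integral_cong_AE) (use assms in eventually_elim, simp)
  then show ?thesis by (simp only: nn_integral_completion)
qed

section \<open>The nonlocal energy of the test function\<close>

text \<open>
  Bernoulli's inequality, read off from Young's.
\<close>

lemma one_minus_powr_le:
  assumes "1 \<le> q" "0 \<le> y"
  shows "1 - y powr q \<le> q * (1 - (y::real))"
proof -
  have "q * y \<le> q * (y powr q / q + (1 - 1 / q))"
    using powr_Young[OF assms, of 1] assms by (intro mult_left_mono) auto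
  also have "\<dots> = y powr q + q - 1" using assms(1) by (simp add: field_simps)
  finally show ?thesis by (simp add: algebra_simps)
qed

text \<open>
  The pointwise inequality behind the logarithmic estimate. It is homogeneous, and with \<open>t = b /
  a\<close> and \<open>y = Y / X\<close> it concerns \<open>(1 - t)\<^bsup>p-1\<^esup> * (1 - y\<^bsup>p\<^esup> * t\<^bsup>1-p\<^esup>)\<close>. If this is positive, then
  \<open>y\<^bsup>p\<^esup> < t\<^bsup>p-1\<^esup>\<close>, so that \<open>1 - t\<close> is below \<open>1 - y\<^bsup>p/(p-1)\<^esup>\<close> and thus, by Bernoulli, below a
  multiple of \<open>1 - y\<close>; the second factor is at most \<open>1 - y\<^bsup>p\<^esup> \<le> p * (1 - y)\<close>. Together these give
  a multiple of \<open>(1 - y)\<^bsup>p\<^esup>\<close>.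
\<close>

lemma log_type_inequality:
  fixes a b X Y p :: real
  assumes p: "1 < p" and ab: "0 < b" "b \<le> a" and XY: "0 \<le> X" "0 \<le> Y"
  shows "(a - b) powr (p - 1) * (X powr p * a powr (1 - p) - Y powr p * b powr (1 - p))
    \<le> p * (p / (p - 1)) powr (p - 1) * \<bar>X - Y\<bar> powr p"
proof (cases "X powr p * a powr (1 - p) \<le> Y powr p * b powr (1 - p)")
  case True
  then have "(a - b) powr (p - 1) * (X powr p * a powr (1 - p) - Y powr p * b powr (1 - p)) \<le> 0"
    by (intro mult_nonneg_nonpos) auto
  also have "0 \<le> p * (p / (p - 1)) powr (p - 1) * \<bar>X - Y\<bar> powr p" using p by simp
  finally show ?thesis .
next
  case False
  define q where "q = p / (p - 1)"
  define t where "t = b / a"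
  have a: "0 < a" using ab by simp
  have q: "1 \<le> q" using p by (simp add: q_def field_simps)
  have t: "0 < t" "t \<le> 1" "b = a * t" using ab a by (auto simp: t_def)
  have bt: "b powr (1 - p) = a powr (1 - p) * t powr (1 - p)" unfolding t(3) using a t(1) by (simp add: powr_mult)
  have lt: "Y powr p * t powr (1 - p) < X powr p"
    using False a unfolding bt by (simp add: not_le mult.assoc mult.left_commute[of "Y powr p"] mult.commute[of "X powr p"])
  have t1: "1 \<le> t powr (1 - p)"
    using powr_mono'[of "1 - p" 0 t] t p by simp
  have X: "0 < X"
  proof (rule ccontr)
    assume "\<not> 0 < X"
    then have "X powr p = 0" using XY by simp
    moreover have "0 \<le> Y powr p * t powr (1 - p)" by simp
    ultimately show False using lt by linarith
  qed
  define y where "y = Y / X"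
  have y: "0 \<le> y" "Y = X * y" using X XY by (auto simp: y_def)
  have lt': "y powr p * t powr (1 - p) < 1"
    using lt X y unfolding y(2) by (simp add: powr_mult mult.assoc)
  have "y powr p < t powr (p - 1)"
  proof -
    have "y powr p * t powr (1 - p) * t powr (p - 1) < 1 * t powr (p - 1)"
      using lt' t(1) by (intro mult_strict_right_mono) auto
    moreover have "t powr (1 - p) * t powr (p - 1) = 1" using t(1) by (simp add: powr_add[symmetric])
    ultimately show ?thesis by (simp add: mult.assoc)
  qed
  then have "(y powr p) powr (1 / (p - 1)) < (t powr (p - 1)) powr (1 / (p - 1))"
    using p by (intro powr_less_mono2) auto
  then have yt: "y powr q < t" using p t(1) by (simp add: powr_powr q_def)
  have "1 - t \<le> 1 - y powr q" using yt by simp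
  also have "\<dots> \<le> q * (1 - y)" by (rule one_minus_powr_le[OF q y(1)])
  finally have A: "1 - t \<le> q * (1 - y)" .
  have yy: "y < 1"
  proof (rule ccontr)
    assume "\<not> y < 1"
    then have "1 \<le> y powr p" using p by (simp add: ge_one_powr_ge_zero)
    then have "1 * 1 \<le> y powr p * t powr (1 - p)" using t1 by (intro mult_mono) auto
    then show False using lt' by simp
  qed
  have "(a - b) powr (p - 1) * (X powr p * a powr (1 - p) - Y powr p * b powr (1 - p))
     = ((a * (1 - t)) powr (p - 1) * a powr (1 - p)) * (X powr p * (1 - y powr p * t powr (1 - p)))"
    unfolding bt y(2) t(3) using X y(1) by (simp add: powr_mult algebra_simps)
  also have "(a * (1 - t)) powr (p - 1) * a powr (1 - p) = (1 - t) powr (p - 1)"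
    using a t by (simp add: powr_mult powr_add[symmetric] mult.assoc mult.left_commute[of _ "(1 - t) powr (p - 1)"] flip: powr_add)
  also have "(1 - t) powr (p - 1) * (X powr p * (1 - y powr p * t powr (1 - p)))
      \<le> (q * (1 - y)) powr (p - 1) * (X powr p * (p * (1 - y)))"
  proof (rule mult_mono)
    show "(1 - t) powr (p - 1) \<le> (q * (1 - y)) powr (p - 1)" using A t p by (intro powr_mono2) auto
    have "1 - y powr p * t powr (1 - p) \<le> 1 - y powr p"
      using mult_left_mono[OF t1, of "y powr p"] by simp
    also have "\<dots> \<le> p * (1 - y)" using p by (intro one_minus_powr_le y(1)) simp
    finally show "X powr p * (1 - y powr p * t powr (1 - p)) \<le> X powr p * (p * (1 - y))"
      by (rule mult_left_mono) simp
    show "0 \<le> X powr p * (1 - y powr p * t powr (1 - p))" using lt' by simp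
  qed simp
  also have "\<dots> = p * q powr (p - 1) * (X powr p * ((1 - y) powr (p - 1) * (1 - y)))"
    using q yy by (simp add: powr_mult mult_ac)
  also have "(1 - y) powr (p - 1) * (1 - y) = (1 - y) powr p"
    using powr_mult_base[of "1 - y" "p - 1"] yy by (simp add: mult.commute)
  also have "X powr p * (1 - y) powr p = \<bar>X - Y\<bar> powr p"
  proof -
    have "X * (1 - y) = \<bar>X - Y\<bar>" using X yy y(2) by (simp add: right_diff_distrib abs_if)
    then show ?thesis using X yy by (simp add: powr_mult[symmetric])
  qed
  finally show ?thesis by (simp add: q_def)
qed

text \<open>
  The test function for the equation is \<open>\<eta>\<^bsup>p\<^esup>\<close> times this function of the solution. With \<open>T = t +
  d\<close>, the power \<open>T\<^bsup>1-p\<^esup>\<close> makes the gradient of \<open>ln T\<close> appear, and the second factor confines the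
  test function to \<open>q * T < 1\<close>; it is squared to be \<open>C\<^sup>1\<close>. For \<open>q = 0\<close> there is no confinement.
\<close>

definition test_profile :: "real \<Rightarrow> real \<Rightarrow> real \<Rightarrow> real \<Rightarrow> real" where
  "test_profile p d q t = (t + d) powr (1 - p) * (max 0 (1 - q * (t + d)))\<^sup>2"

lemma test_profile_nonneg: "0 \<le> test_profile p d q t"
  by (simp add: test_profile_def)

lemma powr_add_le:
  fixes a m p :: real
  assumes "0 \<le> a" "0 \<le> m" "0 \<le> p"
  shows "(a + m) powr p \<le> 2 powr p * (a powr p + m powr p)"
proof -
  let ?m = "max a m"
  have "(a + m) powr p \<le> (2 * ?m) powr p" using assms by (intro powr_mono2) auto
  also have "\<dots> = 2 powr p * ?m powr p" using assms by (simp add: powr_mult)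
  also have "?m powr p \<le> a powr p + m powr p"
    using powr_ge_zero[of a p] powr_ge_zero[of m p] unfolding max_def by auto
  finally show ?thesis by (simp add: mult_left_mono)
qed

text \<open>
  The first summand is for pairs of points one of which lies outside the large ball, where the
  solution may be negative; the second is the constant of \<open>log_type_inequality\<close>.
\<close>

definition nonlocal_const :: "real \<Rightarrow> real" where
  "nonlocal_const p = 2 powr (p - 1) + p * (p / (p - 1)) powr (p - 1)"

text \<open>
  The nonlocal integrand at a pair of points, where \<open>ux\<close> is the larger of the two values. If \<open>uy \<ge>
  0\<close>, the confining factor is larger at \<open>uy\<close> than at \<open>ux\<close>; replacing it there by its value at
  \<open>ux\<close>, which is at most \<open>1\<close>, leaves the expression of \<open>log_type_inequality\<close>. If \<open>uy < 0\<close>, the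
  second point lies outside the ball, where the cutoff vanishes, and the integrand is split into a
  part without \<open>uy\<close> and the tail part. The truth value \<open>inA\<close> says that the first point is in the
  level set, \<open>out\<close> that the second one is outside the ball.
\<close>

lemma nonlocal_pointwise_ordered:
  fixes ux uy X Y :: real
  assumes p: "1 < p" and d: "0 < d" and q: "0 \<le> q" and X: "0 \<le> X" "X \<le> 1" and Y: "0 \<le> Y"
    and le: "uy \<le> ux"
    and inx: "X \<noteq> 0 \<Longrightarrow> 0 \<le> ux" and iny: "0 \<le> uy \<or> (Y = 0 \<and> out)"
    and A: "X \<noteq> 0 \<Longrightarrow> q * (ux + d) < 1 \<Longrightarrow> inA"
  shows "(ux - uy) powr (p - 1) * (X powr p * test_profile p d q ux - Y powr p * test_profile p d q uy)
    \<le> nonlocal_const p * (\<bar>X - Y\<bar> powr p * of_bool inA + d powr (1 - p) * (of_bool inA * of_bool out * (max (- uy) 0) powr (p - 1)))"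
    (is "?L \<le> ?R")
proof -
  have c: "0 \<le> nonlocal_const p" "2 powr (p - 1) \<le> nonlocal_const p"
    "p * (p / (p - 1)) powr (p - 1) \<le> nonlocal_const p" using p by (simp_all add: nonlocal_const_def)
  have R0: "0 \<le> ?R" using c(1) by (intro mult_nonneg_nonneg add_nonneg_nonneg) auto
  show ?thesis
  proof (cases "X powr p * test_profile p d q ux \<le> Y powr p * test_profile p d q uy")
    case True
    then have "?L \<le> 0" by (intro mult_nonneg_nonpos) auto
    then show ?thesis using R0 by linarith
  next
    case False
    have "0 \<le> Y powr p * test_profile p d q uy" by (simp add: test_profile_nonneg)
    with False have "0 < X powr p * test_profile p d q ux" by linarith
    then have X0: "X \<noteq> 0" and t0: "test_profile p d q ux \<noteq> 0" by auto
    define a where "a = ux + d"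
    define ga where "ga = (max 0 (1 - q * a))\<^sup>2"
    have a: "d \<le> a" "0 < a" using inx[OF X0] d by (auto simp: a_def)
    have "q * a < 1" using t0 unfolding test_profile_def a_def[symmetric] by (auto simp: max_def split: if_splits)
    then have inA: inA using A[OF X0] by (simp add: a_def)
    have qa: "0 \<le> q * a" using q a by simp
    have ga: "0 \<le> ga" "ga \<le> 1" using qa by (auto simp: ga_def max_def power_le_one)
    have vx: "test_profile p d q ux = a powr (1 - p) * ga" by (simp add: test_profile_def a_def ga_def)
    show ?thesis
    proof (cases "0 \<le> uy")
      case uy: True
      define b where "b = uy + d"
      define gb where "gb = (max 0 (1 - q * b))\<^sup>2"
      have b: "0 < b" "b \<le> a" using uy d le by (auto simp: a_def b_def)
      have "q * b \<le> q * a" using b(2) q by (rule mult_left_mono)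
      then have gab: "ga \<le> gb" unfolding ga_def gb_def by (intro power_mono) auto
      have vy: "test_profile p d q uy = b powr (1 - p) * gb" by (simp add: test_profile_def b_def gb_def)
      let ?D = "X powr p * a powr (1 - p) - Y powr p * b powr (1 - p)"
      have "Y powr p * (b powr (1 - p) * ga) \<le> Y powr p * (b powr (1 - p) * gb)"
        using gab by (intro mult_left_mono) auto
      then have D: "X powr p * test_profile p d q ux - Y powr p * test_profile p d q uy \<le> ga * ?D"
        unfolding vx vy by (simp add: algebra_simps)
      have D0: "0 \<le> ?D"
      proof (rule ccontr)
        assume "\<not> 0 \<le> ?D"
        then have "ga * ?D \<le> 0" using ga(1) by (intro mult_nonneg_nonpos) auto
        then show False using D False by linarith
      qed
      have "ga * ?D \<le> 1 * ?D" using ga(2) D0 by (rule mult_right_mono)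
      then have D1: "X powr p * test_profile p d q ux - Y powr p * test_profile p d q uy \<le> ?D"
        using order_trans[OF D] by (simp only: mult_1)
      have "?L \<le> (a - b) powr (p - 1) * ?D"
        using mult_left_mono[OF D1, of "(ux - uy) powr (p - 1)"] by (simp add: a_def b_def)
      also have "\<dots> \<le> p * (p / (p - 1)) powr (p - 1) * \<bar>X - Y\<bar> powr p"
        by (rule log_type_inequality[OF p b X(1) Y])
      also have "\<dots> \<le> nonlocal_const p * \<bar>X - Y\<bar> powr p" using c(3) by (rule mult_right_mono) simp
      also have "\<dots> \<le> ?R" using inA c(1) by (intro mult_left_mono) auto
      finally show ?thesis .
    next
      case uy: False
      then have Y0: "Y = 0" and out: out using iny by auto
      define m where "m = max (- uy) 0"
      have m: "0 \<le> m" by (simp add: m_def)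
      have "(ux - uy) powr (p - 1) \<le> (a + m) powr (p - 1)"
        using p le d by (intro powr_mono2) (auto simp: a_def m_def)
      also have "\<dots> \<le> 2 powr (p - 1) * (a powr (p - 1) + m powr (p - 1))"
        using p a m by (intro powr_add_le) auto
      finally have 1: "(ux - uy) powr (p - 1) \<le> 2 powr (p - 1) * (a powr (p - 1) + m powr (p - 1))" .
      have "a powr (1 - p) * ga \<le> a powr (1 - p) * 1" using ga by (intro mult_left_mono) auto
      then have 2: "X powr p * test_profile p d q ux - Y powr p * test_profile p d q uy \<le> X powr p * a powr (1 - p)"
        unfolding vx Y0 using mult_left_mono[of "a powr (1 - p) * ga" "a powr (1 - p)" "X powr p"] by simp
      have "?L \<le> (2 powr (p - 1) * (a powr (p - 1) + m powr (p - 1))) * (X powr p * a powr (1 - p))"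
        using 1 2 False by (intro mult_mono) auto
      also have "\<dots> = 2 powr (p - 1) * (X powr p * (a powr (p - 1) * a powr (1 - p)) + X powr p * a powr (1 - p) * m powr (p - 1))"
        by (simp add: algebra_simps)
      also have "a powr (p - 1) * a powr (1 - p) = 1" using a(2) by (simp add: powr_add[symmetric])
      also have "2 powr (p - 1) * (X powr p * 1 + X powr p * a powr (1 - p) * m powr (p - 1))
        \<le> nonlocal_const p * (\<bar>X - Y\<bar> powr p + d powr (1 - p) * m powr (p - 1))"
      proof (rule mult_mono[OF c(2) _ c(1)])
        have "X powr p \<le> 1" using X p by (simp add: powr_le1)
        moreover have "a powr (1 - p) \<le> d powr (1 - p)" using a d p by (intro powr_mono2') auto
        ultimately have "X powr p * a powr (1 - p) \<le> 1 * d powr (1 - p)" by (intro mult_mono) auto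
        then have "X powr p * a powr (1 - p) * m powr (p - 1) \<le> d powr (1 - p) * m powr (p - 1)"
          by (intro mult_right_mono) auto
        then show "X powr p * 1 + X powr p * a powr (1 - p) * m powr (p - 1) \<le> \<bar>X - Y\<bar> powr p + d powr (1 - p) * m powr (p - 1)"
          using X Y0 by simp
        show "0 \<le> X powr p * 1 + X powr p * a powr (1 - p) * m powr (p - 1)" by simp
      qed
      also have "\<dots> = ?R" using inA out by (simp add: m_def)
      finally show ?thesis .
    qed
  qed
qed

lemma powr_sign_split:
  fixes p t :: real
  assumes "1 < p" "0 \<le> t"
  shows "\<bar>t\<bar> powr (p - 2) * t = t powr (p - 1)"
  using powr_mult_base[of t "p - 2"] assms by (cases "t = 0") (auto simp: mult.commute)

text \<open>
  The integrand is symmetric in \<open>x\<close> and \<open>y\<close>, so the two orders of the values are covered by \<open>H x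
  y\<close> and \<open>H y x\<close>.
\<close>

lemma nonlocal_pointwise:
  fixes w \<eta> :: "'a \<Rightarrow> real" and x y :: 'a
  assumes p: "1 < p" and d: "0 < d" and q: "0 \<le> q" and \<eta>: "\<And>x. 0 \<le> \<eta> x" "\<And>x. \<eta> x \<le> 1"
    and B: "\<And>x. x \<in> B \<Longrightarrow> 0 \<le> w x" "\<And>x. x \<notin> B \<Longrightarrow> \<eta> x = 0"
    and A: "\<And>x. \<eta> x \<noteq> 0 \<Longrightarrow> q * (w x + d) < 1 \<Longrightarrow> x \<in> A"
  defines "v \<equiv> \<lambda>x. \<eta> x powr p * test_profile p d q (w x)"
    and "H \<equiv> \<lambda>x y. \<bar>\<eta> x - \<eta> y\<bar> powr p * indicator A x + d powr (1 - p) * (indicator A x * indicator (- B) y * (max (- w y) 0) powr (p - 1))"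
  shows "\<bar>w x - w y\<bar> powr (p - 2) * (w x - w y) * (v x - v y) \<le> nonlocal_const p * (H x y + H y x)"
proof -
  have H0: "0 \<le> H x y" for x y unfolding H_def by (intro add_nonneg_nonneg mult_nonneg_nonneg) auto
  have c: "0 \<le> nonlocal_const p" using p by (simp add: nonlocal_const_def)
  have main: "\<bar>w x - w y\<bar> powr (p - 2) * (w x - w y) * (v x - v y) \<le> nonlocal_const p * H x y" if "w y \<le> w x" for x y
  proof -
    have "(w x - w y) powr (p - 1) * (\<eta> x powr p * test_profile p d q (w x) - \<eta> y powr p * test_profile p d q (w y))
      \<le> nonlocal_const p * (\<bar>\<eta> x - \<eta> y\<bar> powr p * of_bool (x \<in> A) + d powr (1 - p) * (of_bool (x \<in> A) * of_bool (y \<in> - B) * (max (- w y) 0) powr (p - 1)))"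
      by (rule nonlocal_pointwise_ordered[OF p d q \<eta> \<eta>(1) that]) (use A B in auto)
    then show ?thesis
      using powr_sign_split[OF p, of "w x - w y"] that unfolding v_def H_def indicator_def by simp
  qed
  show ?thesis
  proof (cases "w y \<le> w x")
    case True
    have "nonlocal_const p * H x y \<le> nonlocal_const p * (H x y + H y x)" using c H0 by (intro mult_left_mono) auto
    then show ?thesis using main[OF True] by linarith
  next
    case False
    have "\<bar>w x - w y\<bar> powr (p - 2) * (w x - w y) * (v x - v y) = \<bar>w y - w x\<bar> powr (p - 2) * (w y - w x) * (v y - v x)"
      by (simp add: abs_minus_commute algebra_simps)
    also have "\<dots> \<le> nonlocal_const p * H y x" using False by (intro main) simp
    also have "\<dots> \<le> nonlocal_const p * (H x y + H y x)" using c H0 by (intro mult_left_mono) auto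
    finally show ?thesis .
  qed
qed

lemma AE_lebesgue_prod:
  fixes P :: "'a::euclidean_space \<Rightarrow> bool"
  assumes "AE x in lebesgue. P x"
  shows "AE z in (lebesgue :: ('a \<times> 'a) measure). P (fst z) \<and> P (snd z)"
proof -
  have "AE x in lborel. P x" using assms by (simp add: AE_completion_iff)
  then obtain Z where Z: "Z \<in> null_sets lborel" "{x. \<not> P x} \<subseteq> Z"
    by (auto simp: eventually_ae_filter)
  have "Z \<times> UNIV \<in> null_sets (lborel :: ('a \<times> 'a) measure)" "UNIV \<times> Z \<in> null_sets (lborel :: ('a \<times> 'a) measure)"
    unfolding lborel_prod[symmetric] using Z(1)
    by (auto simp: null_sets_def lborel.emeasure_pair_measure_Times)
  then have "Z \<times> UNIV \<union> UNIV \<times> Z \<in> null_sets (lborel :: ('a \<times> 'a) measure)" by (rule null_sets.Un)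
  moreover have "{z \<in> space lborel. \<not> (P (fst z) \<and> P (snd z))} \<subseteq> Z \<times> UNIV \<union> UNIV \<times> Z" using Z(2) by auto
  ultimately have "AE z in (lborel :: ('a \<times> 'a) measure). P (fst z) \<and> P (snd z)" by (rule AE_I')
  then show ?thesis by (simp add: AE_completion_iff)
qed

lemma nn_integral_lborel_symmetrized:
  fixes F :: "'a::euclidean_space \<Rightarrow> 'a \<Rightarrow> ennreal"
  assumes [measurable]: "(\<lambda>z. F (fst z) (snd z)) \<in> borel_measurable (borel \<Otimes>\<^sub>M borel)"
  shows "(\<integral>\<^sup>+z. F (fst z) (snd z) + F (snd z) (fst z) \<partial>lborel) = 2 * (\<integral>\<^sup>+x. \<integral>\<^sup>+y. F x y \<partial>lborel \<partial>lborel)"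
proof -
  have m1: "(\<lambda>z. F (fst z) (snd z)) \<in> borel_measurable (lborel \<Otimes>\<^sub>M lborel)"
    using assms by (simp add: measurable_def sets_pair_measure space_pair_measure)
  have sw: "(\<lambda>z. (snd z, fst z)) \<in> (lborel \<Otimes>\<^sub>M lborel) \<rightarrow>\<^sub>M (lborel \<Otimes>\<^sub>M (lborel :: 'a measure))" by measurable
  have m2: "(\<lambda>z. F (snd z) (fst z)) \<in> borel_measurable (lborel \<Otimes>\<^sub>M lborel)"
    using measurable_compose[OF sw m1] by simp
  have "(\<integral>\<^sup>+z. F (fst z) (snd z) + F (snd z) (fst z) \<partial>lborel)
     = (\<integral>\<^sup>+z. F (fst z) (snd z) \<partial>(lborel \<Otimes>\<^sub>M lborel)) + (\<integral>\<^sup>+z. F (snd z) (fst z) \<partial>(lborel \<Otimes>\<^sub>M lborel))"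
    unfolding lborel_prod[symmetric] by (rule nn_integral_add[OF m1 m2])
  also have "(\<integral>\<^sup>+z. F (fst z) (snd z) \<partial>(lborel \<Otimes>\<^sub>M lborel)) = (\<integral>\<^sup>+x. \<integral>\<^sup>+y. F x y \<partial>lborel \<partial>lborel)"
    using lborel.nn_integral_fst[OF m1] by simp
  also have "(\<integral>\<^sup>+z. F (snd z) (fst z) \<partial>(lborel \<Otimes>\<^sub>M lborel)) = (\<integral>\<^sup>+x. \<integral>\<^sup>+y. F x y \<partial>lborel \<partial>lborel)"
    using lborel_pair.nn_integral_snd[OF m2] by simp
  finally show ?thesis by (simp add: mult_2)
qed

lemma id_measurable_mu:
  assumes "sets \<mu> = sets (restrict_space borel {0..1::real})"
  shows "(\<lambda>s. s) \<in> borel_measurable \<mu>"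
  by (subst measurable_cong_sets[OF assms refl]) (simp add: measurable_restrict_space1)

lemma C_norm_measurable:
  assumes "sets \<mu> = sets (restrict_space borel {0..1::real})" "1 < p" "0 < N"
  shows "(\<lambda>s. C_norm N s p) \<in> borel_measurable \<mu>"
  by (subst measurable_cong_sets[OF assms(1) refl])
    (rule borel_measurable_continuous_on_restrict[OF C_norm_props(1)[OF assms(2,3)]])

lemma outer_measurable:
  fixes w :: "'a::euclidean_space \<Rightarrow> real"
  assumes sets: "sets \<mu> = sets (restrict_space borel {0..1::real})" and [measurable]: "w \<in> borel_measurable borel" "B \<in> sets borel"
  shows "(\<lambda>s. \<integral>\<^sup>+y. ennreal (w y powr (p - 1) / norm (y - x0) powr (real DIM('a) + s * p)) * indicator B y \<partial>lborel) \<in> borel_measurable \<mu>"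
proof -
  note [measurable] = id_measurable_mu[OF sets]
  show ?thesis
    by (rule lborel.borel_measurable_nn_integral) measurable
qed

lemma ennreal_weighted_sum:
  assumes "0 \<le> a" "0 \<le> k" "0 \<le> b" "0 \<le> c"
  shows "ennreal (a * k + b * (c * indicator S y)) = ennreal a * ennreal k + ennreal b * (ennreal c * indicator S y)"
  using assms by (cases "y \<in> S") (simp_all add: ennreal_mult ennreal_plus)

text \<open>
  After the pointwise bound two integrals over \<open>A \<times> UNIV\<close> remain. In the first, the cutoff
  increment is at most \<open>L * min 1 (norm (x - y))\<close>, which leads to the kernel integral. In the
  second, \<open>x\<close> lies in the ball of radius \<open>3 * R / 4\<close> and \<open>y\<close> outside the ball of radius \<open>R\<close>, so
  \<open>norm (y - x0) \<le> 4 * norm (x - y)\<close>, and the kernel may be centred at \<open>x0\<close> as in the tail.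
\<close>

lemma nonlocal_energy_bound:
  fixes u w \<eta> :: "'a::euclidean_space \<Rightarrow> real" and \<mu> :: "real measure"
  assumes p: "1 < p" and d: "0 < d" and q: "0 \<le> q"
    and fm: "finite_measure \<mu>" and sets: "sets \<mu> = sets (restrict_space borel {0..1::real})"
    and w[measurable]: "w \<in> borel_measurable borel" and uw: "AE x in lebesgue. u x = w x"
    and w0: "\<And>x. x \<in> ball x0 R \<Longrightarrow> 0 \<le> w x"
    and \<eta>: "\<And>x. 0 \<le> \<eta> x" "\<And>x. \<eta> x \<le> 1" "\<And>x. x \<notin> ball x0 \<rho> \<Longrightarrow> \<eta> x = 0" "\<And>x y. \<bar>\<eta> x - \<eta> y\<bar> \<le> L * norm (x - y)"
    and \<eta>m[measurable]: "\<eta> \<in> borel_measurable borel"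
    and L: "1 \<le> L" and \<rho>: "\<rho> \<le> 3 / 4 * R" "0 < R"
    and kc: "0 \<le> kc" "\<And>s. 0 < s \<Longrightarrow> s < 1 \<Longrightarrow>
       ennreal (C_norm DIM('a) s p) * (\<integral>\<^sup>+z. ennreal (min 1 (norm z) powr p * norm (z::'a) powr (- (real DIM('a) + s * p))) \<partial>lborel) \<le> ennreal kc"
    and \<tau>: "0 \<le> \<tau>" "(\<integral>\<^sup>+s\<in>{0<..<1}. ennreal (C_norm DIM('a) s p)
       * (\<integral>\<^sup>+y. ennreal ((max (- w y) 0) powr (p - 1) / norm (y - x0) powr (real DIM('a) + s * p)) * indicator (- ball x0 R) y \<partial>lborel) \<partial>\<mu>) \<le> ennreal \<tau>"
  defines "A \<equiv> {x \<in> ball x0 \<rho>. q * (w x + d) < 1}"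
  shows "ennreal (nonlocal_energy \<mu> p u (\<lambda>x. \<eta> x powr p * test_profile p d q (w x)))
    \<le> ennreal (nonlocal_const p * 2 * (L powr p * kc * measure \<mu> (space \<mu>) + 4 powr (real DIM('a) + p) * d powr (1 - p) * \<tau>) * measure lborel A)"
proof -
  interpret finite_measure \<mu> by (rule fm)
  define v where "v x = \<eta> x powr p * test_profile p d q (w x)" for x
  define m where "m y = max (- w y) 0" for y
  have [measurable]: "m \<in> borel_measurable borel" unfolding m_def[abs_def] by measurable
  have Am[measurable]: "A \<in> sets borel" unfolding A_def by measurable
  have Bm[measurable]: "- ball x0 R \<in> sets borel" by simp
  define H where "H x y = \<bar>\<eta> x - \<eta> y\<bar> powr p * indicator A x + d powr (1 - p) * (indicator A x * indicator (- ball x0 R) y * m y powr (p - 1))" for x y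
  have H0: "0 \<le> H x y" for x y unfolding H_def by (intro add_nonneg_nonneg mult_nonneg_nonneg) auto
  have c: "0 \<le> nonlocal_const p" using p by (simp add: nonlocal_const_def)
  have pw: "\<bar>w x - w y\<bar> powr (p - 2) * (w x - w y) * (v x - v y) \<le> nonlocal_const p * (H x y + H y x)" for x y
    unfolding v_def H_def m_def
  proof (rule nonlocal_pointwise[OF p d q \<eta>(1,2) w0])
    show "\<eta> x = 0" if "x \<notin> ball x0 R" for x using that \<eta>(3)[of x] \<rho> by auto
    show "x \<in> A" if "\<eta> x \<noteq> 0" "q * (w x + d) < 1" for x using that \<eta>(3)[of x] by (auto simp: A_def)
  qed
  define e where "e s = real DIM('a) + s * p" for s
  define C where "C s = C_norm DIM('a) s p" for s
  have Cm[measurable]: "C \<in> borel_measurable \<mu>" unfolding C_def[abs_def] by (rule C_norm_measurable[OF sets p]) simp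
  define T where "T s = (\<integral>\<^sup>+y. ennreal (m y powr (p - 1) / norm (y - x0) powr e s) * indicator (- ball x0 R) y \<partial>lborel)" for s
  have Tm[measurable]: "T \<in> borel_measurable \<mu>" unfolding T_def[abs_def] e_def by (rule outer_measurable[OF sets]) auto
  have Afin: "emeasure lborel A < \<infinity>"
  proof -
    have "emeasure lborel A \<le> emeasure lborel (ball x0 \<rho>)" by (intro emeasure_mono) (auto simp: A_def)
    also have "\<dots> < \<infinity>" using emeasure_lborel_ball_finite[of x0 \<rho>] by simp
    finally show ?thesis .
  qed
  define \<alpha> where "\<alpha> = measure lborel A"
  have \<alpha>: "emeasure lborel A = ennreal \<alpha>" using Afin by (simp add: \<alpha>_def emeasure_eq_ennreal_measure)
  define I where "I s = (LINT z|(lebesgue :: ('a \<times> 'a) measure).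
           \<bar>u (fst z) - u (snd z)\<bar> powr (p - 2) * (u (fst z) - u (snd z)) * (v (fst z) - v (snd z))
           / norm (fst z - snd z) powr e s)" for s
  have inner: "ennreal (C s) * ennreal (I s)
    \<le> ennreal (nonlocal_const p * 2 * (L powr p * kc) * \<alpha>) + ennreal (nonlocal_const p * 2 * (4 powr (real DIM('a) + p) * d powr (1 - p)) * \<alpha>) * (ennreal (C s) * T s)"
    if s: "0 < s" "s < 1" for s
  proof -
    define F where "F x y = ennreal (H x y * norm (x - y) powr (- e s))" for x y
    have Fm: "(\<lambda>z. F (fst z) (snd z)) \<in> borel_measurable (borel \<Otimes>\<^sub>M borel)"
      unfolding F_def H_def by measurable
    have e0: "0 < e s" "e s \<le> real DIM('a) + p" using s p by (auto simp: e_def intro: add_pos_pos)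
    have "ennreal (I s) \<le> (\<integral>\<^sup>+z. ennreal (\<bar>u (fst z) - u (snd z)\<bar> powr (p - 2) * (u (fst z) - u (snd z)) * (v (fst z) - v (snd z))
           / norm (fst z - snd z) powr e s) \<partial>lebesgue)"
      unfolding I_def by (rule ennreal_integral_le_nn_integral)
    also have "\<dots> \<le> (\<integral>\<^sup>+z. ennreal (nonlocal_const p) * (F (fst z) (snd z) + F (snd z) (fst z)) \<partial>(lebesgue :: ('a \<times> 'a) measure))"
      using AE_lebesgue_prod[OF uw]
    proof (intro nn_integral_mono_AE, eventually_elim)
      case (elim z)
      have "\<bar>u (fst z) - u (snd z)\<bar> powr (p - 2) * (u (fst z) - u (snd z)) * (v (fst z) - v (snd z)) / norm (fst z - snd z) powr e s
        = \<bar>w (fst z) - w (snd z)\<bar> powr (p - 2) * (w (fst z) - w (snd z)) * (v (fst z) - v (snd z)) * norm (fst z - snd z) powr (- e s)"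
        using elim by (simp add: powr_minus divide_inverse)
      also have "\<dots> \<le> nonlocal_const p * (H (fst z) (snd z) + H (snd z) (fst z)) * norm (fst z - snd z) powr (- e s)"
        by (intro mult_right_mono pw) simp
      also have "\<dots> = nonlocal_const p * (H (fst z) (snd z) * norm (fst z - snd z) powr (- e s) + H (snd z) (fst z) * norm (snd z - fst z) powr (- e s))"
        by (simp add: norm_minus_commute algebra_simps)
      finally have "ennreal (\<bar>u (fst z) - u (snd z)\<bar> powr (p - 2) * (u (fst z) - u (snd z)) * (v (fst z) - v (snd z)) / norm (fst z - snd z) powr e s)
        \<le> ennreal (nonlocal_const p * (H (fst z) (snd z) * norm (fst z - snd z) powr (- e s) + H (snd z) (fst z) * norm (snd z - fst z) powr (- e s)))"
        by (rule ennreal_leI)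
      also have "\<dots> = ennreal (nonlocal_const p) * (F (fst z) (snd z) + F (snd z) (fst z))"
        unfolding F_def using c H0 by (simp add: ennreal_mult ennreal_plus)
      finally show ?case .
    qed
    also have "\<dots> = (\<integral>\<^sup>+z. ennreal (nonlocal_const p) * (F (fst z) (snd z) + F (snd z) (fst z)) \<partial>lborel)"
      by (rule nn_integral_completion)
    also have "\<dots> = ennreal (nonlocal_const p) * (\<integral>\<^sup>+z. F (fst z) (snd z) + F (snd z) (fst z) \<partial>lborel)"
    proof (rule nn_integral_cmult)
      have m1: "(\<lambda>z. F (fst z) (snd z)) \<in> borel_measurable (borel :: ('a \<times> 'a) measure)" using Fm by (simp add: borel_prod)
      moreover have "(\<lambda>z. F (snd z) (fst z)) \<in> borel_measurable (borel :: ('a \<times> 'a) measure)"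
      proof -
        have "(\<lambda>z. (snd z, fst z)) \<in> borel_measurable (borel :: ('a \<times> 'a) measure)"
          by (rule borel_measurable_continuous_onI) (intro continuous_intros)
        from measurable_compose[OF this m1] show ?thesis by simp
      qed
      ultimately show "(\<lambda>z. F (fst z) (snd z) + F (snd z) (fst z)) \<in> borel_measurable lborel" by simp
    qed
    also have "(\<integral>\<^sup>+z. F (fst z) (snd z) + F (snd z) (fst z) \<partial>lborel) = 2 * (\<integral>\<^sup>+x. \<integral>\<^sup>+y. F x y \<partial>lborel \<partial>lborel)"
      by (rule nn_integral_lborel_symmetrized[OF Fm])
    finally have I1: "ennreal (I s) \<le> ennreal (nonlocal_const p) * (2 * (\<integral>\<^sup>+x. \<integral>\<^sup>+y. F x y \<partial>lborel \<partial>lborel))" .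
    define kern where "kern = (\<integral>\<^sup>+z. ennreal (min 1 (norm z) powr p * norm (z::'a) powr (- e s)) \<partial>lborel)"
    define b where "b = 4 powr (real DIM('a) + p) * d powr (1 - p)"
    have b0: "0 \<le> b" by (simp add: b_def)
    have Fx: "(\<integral>\<^sup>+y. F x y \<partial>lborel) \<le> (ennreal (L powr p) * kern + ennreal b * T s) * indicator A x" for x
    proof (cases "x \<in> A")
      case False
      then have "F x y = 0" for y by (simp add: F_def H_def)
      then show ?thesis by simp
    next
      case True
      then have xr: "dist x0 x < \<rho>" by (simp add: A_def)
      have "F x y \<le> ennreal (L powr p) * ennreal (min 1 (norm (x - y)) powr p * norm (x - y) powr (- e s))
          + ennreal b * (ennreal (m y powr (p - 1) / norm (y - x0) powr e s) * indicator (- ball x0 R) y)" for y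
      proof -
        have "\<bar>\<eta> x - \<eta> y\<bar> \<le> L * min 1 (norm (x - y))"
        proof (cases "norm (x - y) \<le> 1")
          case True then show ?thesis using \<eta>(4)[of x y] by simp
        next
          case False
          have "\<bar>\<eta> x - \<eta> y\<bar> \<le> 1" using \<eta>(1,2)[of x] \<eta>(1,2)[of y] by linarith
          then show ?thesis using L False by simp
        qed
        then have "\<bar>\<eta> x - \<eta> y\<bar> powr p \<le> (L * min 1 (norm (x - y))) powr p" using p by (intro powr_mono2) auto
        also have "\<dots> = L powr p * min 1 (norm (x - y)) powr p" using L by (intro powr_mult)
        finally have 1: "\<bar>\<eta> x - \<eta> y\<bar> powr p * norm (x - y) powr (- e s) \<le> L powr p * (min 1 (norm (x - y)) powr p * norm (x - y) powr (- e s))"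
          using mult_right_mono[of "\<bar>\<eta> x - \<eta> y\<bar> powr p" "L powr p * min 1 (norm (x - y)) powr p" "norm (x - y) powr (- e s)"] by (simp add: mult.assoc)
        have 2: "d powr (1 - p) * (indicator (- ball x0 R) y * m y powr (p - 1)) * norm (x - y) powr (- e s)
            \<le> b * (m y powr (p - 1) / norm (y - x0) powr e s * indicator (- ball x0 R) y)"
        proof (cases "y \<in> ball x0 R")
          case False
          then have yR: "R \<le> dist x0 y" by simp
          have ny: "norm (y - x0) = dist x0 y" by (simp add: dist_norm norm_minus_commute)
          have dy: "0 < norm (y - x0)" using \<rho>(2) yR unfolding ny by linarith
          have "dist x0 y \<le> dist x0 x + dist x y" by (rule dist_triangle)
          then have "dist x0 y / 4 \<le> dist x y" using xr yR \<rho>(1) by linarith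
          then have "norm (y - x0) / 4 \<le> norm (x - y)" unfolding ny by (simp add: dist_norm)
          then have "norm (x - y) powr (- e s) \<le> (norm (y - x0) / 4) powr (- e s)"
            using dy e0 by (intro powr_mono2') auto
          also have "\<dots> = 4 powr (e s) * norm (y - x0) powr (- e s)"
            using dy by (simp add: powr_divide powr_minus field_simps)
          also have "\<dots> \<le> 4 powr (real DIM('a) + p) * norm (y - x0) powr (- e s)"
            using e0 by (intro mult_right_mono powr_mono) auto
          finally have k: "norm (x - y) powr (- e s) \<le> 4 powr (real DIM('a) + p) * norm (y - x0) powr (- e s)" .
          have "(d powr (1 - p) * m y powr (p - 1)) * norm (x - y) powr (- e s)
             \<le> (d powr (1 - p) * m y powr (p - 1)) * (4 powr (real DIM('a) + p) * norm (y - x0) powr (- e s))"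
            by (rule mult_left_mono[OF k]) simp
          also have "\<dots> = b * (m y powr (p - 1) / norm (y - x0) powr e s)"
            by (simp add: b_def powr_minus divide_inverse)
          finally show ?thesis using False by simp
        qed simp
        have "H x y * norm (x - y) powr (- e s) = \<bar>\<eta> x - \<eta> y\<bar> powr p * norm (x - y) powr (- e s)
           + d powr (1 - p) * (indicator (- ball x0 R) y * m y powr (p - 1)) * norm (x - y) powr (- e s)"
          using True by (simp add: H_def distrib_right)
        also have "\<dots> \<le> L powr p * (min 1 (norm (x - y)) powr p * norm (x - y) powr (- e s))
           + b * (m y powr (p - 1) / norm (y - x0) powr e s * indicator (- ball x0 R) y)"
          by (rule add_mono[OF 1 2])
        finally have "F x y \<le> ennreal (L powr p * (min 1 (norm (x - y)) powr p * norm (x - y) powr (- e s))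
           + b * (m y powr (p - 1) / norm (y - x0) powr e s * indicator (- ball x0 R) y))"
          unfolding F_def by (rule ennreal_leI)
        also have "\<dots> = ennreal (L powr p) * ennreal (min 1 (norm (x - y)) powr p * norm (x - y) powr (- e s))
          + ennreal b * (ennreal (m y powr (p - 1) / norm (y - x0) powr e s) * indicator (- ball x0 R) y)"
          using b0 by (intro ennreal_weighted_sum) auto
        finally show ?thesis .
      qed
      then have "(\<integral>\<^sup>+y. F x y \<partial>lborel) \<le> (\<integral>\<^sup>+y. ennreal (L powr p) * ennreal (min 1 (norm (x - y)) powr p * norm (x - y) powr (- e s))
          + ennreal b * (ennreal (m y powr (p - 1) / norm (y - x0) powr e s) * indicator (- ball x0 R) y) \<partial>lborel)"
        by (rule nn_integral_mono)
      also have "\<dots> = (\<integral>\<^sup>+y. ennreal (L powr p) * ennreal (min 1 (norm (x - y)) powr p * norm (x - y) powr (- e s)) \<partial>lborel)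
          + (\<integral>\<^sup>+y. ennreal b * (ennreal (m y powr (p - 1) / norm (y - x0) powr e s) * indicator (- ball x0 R) y) \<partial>lborel)"
        by (rule nn_integral_add) measurable
      also have "(\<integral>\<^sup>+y. ennreal (L powr p) * ennreal (min 1 (norm (x - y)) powr p * norm (x - y) powr (- e s)) \<partial>lborel)
          = ennreal (L powr p) * kern"
      proof -
        have "(\<integral>\<^sup>+y. ennreal (min 1 (norm (x - y)) powr p * norm (x - y) powr (- e s)) \<partial>lborel) = kern"
          unfolding kern_def
          by (rule nn_integral_reflect[where f="\<lambda>z. ennreal (min 1 (norm z) powr p * norm z powr (- e s))"]) measurable
        then show ?thesis by (subst nn_integral_cmult) auto
      qed
      also have "(\<integral>\<^sup>+y. ennreal b * (ennreal (m y powr (p - 1) / norm (y - x0) powr e s) * indicator (- ball x0 R) y) \<partial>lborel) = ennreal b * T s"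
        unfolding T_def by (rule nn_integral_cmult) measurable
      finally show ?thesis using True by simp
    qed
    have "(\<integral>\<^sup>+x. \<integral>\<^sup>+y. F x y \<partial>lborel \<partial>lborel) \<le> (\<integral>\<^sup>+x. (ennreal (L powr p) * kern + ennreal b * T s) * indicator A x \<partial>lborel)"
      by (intro nn_integral_mono Fx)
    also have "\<dots> = (ennreal (L powr p) * kern + ennreal b * T s) * ennreal \<alpha>"
      using \<alpha> by (subst nn_integral_cmult_indicator) auto
    finally have I2: "(\<integral>\<^sup>+x. \<integral>\<^sup>+y. F x y \<partial>lborel \<partial>lborel) \<le> (ennreal (L powr p) * kern + ennreal b * T s) * ennreal \<alpha>" .
    have "ennreal (C s) * ennreal (I s) \<le> ennreal (C s) * (ennreal (nonlocal_const p) * (2 * ((ennreal (L powr p) * kern + ennreal b * T s) * ennreal \<alpha>)))"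
      using I1 I2 by (meson mult_left_mono order_trans zero_le)
    also have "\<dots> = ennreal (nonlocal_const p) * 2 * ennreal \<alpha> * (ennreal (L powr p) * (ennreal (C s) * kern) + ennreal b * (ennreal (C s) * T s))"
      by (simp add: algebra_simps)
    also have "\<dots> \<le> ennreal (nonlocal_const p) * 2 * ennreal \<alpha> * (ennreal (L powr p) * ennreal kc + ennreal b * (ennreal (C s) * T s))"
      using kc(2)[OF s] unfolding kern_def C_def e_def by (intro mult_left_mono add_right_mono) auto
    also have "\<dots> = ennreal (nonlocal_const p * 2 * (L powr p * kc) * \<alpha>) + ennreal (nonlocal_const p * 2 * b * \<alpha>) * (ennreal (C s) * T s)"
    proof -
      have t: "(2::ennreal) = ennreal 2" by simp
      have "ennreal (nonlocal_const p * 2 * (L powr p * kc) * \<alpha>) = ennreal (nonlocal_const p) * 2 * ennreal \<alpha> * (ennreal (L powr p) * ennreal kc)"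
        unfolding t using c kc(1) by (simp add: ennreal_mult[symmetric] \<alpha>_def mult_ac del: ennreal_numeral)
      moreover have "ennreal (nonlocal_const p * 2 * b * \<alpha>) = ennreal (nonlocal_const p) * 2 * ennreal \<alpha> * ennreal b"
        unfolding t using c b0 by (simp add: ennreal_mult[symmetric] \<alpha>_def mult_ac del: ennreal_numeral)
      ultimately show ?thesis by (simp add: distrib_left mult.assoc)
    qed
    finally show ?thesis by (simp add: b_def)
  qed
  let ?k1 = "nonlocal_const p * 2 * (L powr p * kc) * \<alpha>" and ?k2 = "nonlocal_const p * 2 * (4 powr (real DIM('a) + p) * d powr (1 - p)) * \<alpha>"
  have k0: "0 \<le> ?k1" "0 \<le> ?k2" using c kc(1) by (auto simp: \<alpha>_def)
  have C0: "0 \<le> C s" if "0 < s" "s < 1" for s using C_norm_props(2)[OF p, of "DIM('a)" s] that by (simp add: C_def)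
  have mI: "{0<..<1} \<in> sets \<mu>" unfolding sets sets_restrict_space
    by (rule image_eqI[of _ _ "{0<..<1}"]) auto
  have m1: "(\<lambda>s. ennreal (C s) * T s * indicator {0<..<1} s) \<in> borel_measurable \<mu>" using mI by measurable
  have "ennreal (nonlocal_energy \<mu> p u v) \<le> (\<integral>\<^sup>+s. ennreal (indicator {0<..<1} s *\<^sub>R (C s * I s)) \<partial>\<mu>)"
    unfolding nonlocal_energy_def set_lebesgue_integral_def C_def I_def e_def by (rule ennreal_integral_le_nn_integral)
  also have "\<dots> \<le> (\<integral>\<^sup>+s. ennreal ?k1 + ennreal ?k2 * (ennreal (C s) * T s * indicator {0<..<1} s) \<partial>\<mu>)"
  proof (rule nn_integral_mono)
    fix s
    show "ennreal (indicator {0<..<1} s *\<^sub>R (C s * I s)) \<le> ennreal ?k1 + ennreal ?k2 * (ennreal (C s) * T s * indicator {0<..<1} s)"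
      using inner[of s] C0[of s] by (cases "s \<in> {0<..<1}") (auto simp: ennreal_mult')
  qed
  also have "\<dots> = (\<integral>\<^sup>+s. ennreal ?k1 \<partial>\<mu>) + (\<integral>\<^sup>+s. ennreal ?k2 * (ennreal (C s) * T s * indicator {0<..<1} s) \<partial>\<mu>)"
    by (rule nn_integral_add) (use m1 in auto)
  also have "(\<integral>\<^sup>+s. ennreal ?k2 * (ennreal (C s) * T s * indicator {0<..<1} s) \<partial>\<mu>) = ennreal ?k2 * (\<integral>\<^sup>+s. ennreal (C s) * T s * indicator {0<..<1} s \<partial>\<mu>)"
    by (rule nn_integral_cmult[OF m1])
  also have "\<dots> \<le> ennreal ?k2 * ennreal \<tau>"
    using \<tau>(2) unfolding C_def T_def m_def e_def by (intro mult_left_mono) auto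
  also have "(\<integral>\<^sup>+s. ennreal ?k1 \<partial>\<mu>) + ennreal ?k2 * ennreal \<tau> = ennreal (?k1 * measure \<mu> (space \<mu>) + ?k2 * \<tau>)"
    using k0 \<tau>(1) by (simp add: emeasure_eq_measure ennreal_mult ennreal_plus)
  also have "?k1 * measure \<mu> (space \<mu>) + ?k2 * \<tau> = nonlocal_const p * 2 * (L powr p * kc * measure \<mu> (space \<mu>) + 4 powr (real DIM('a) + p) * d powr (1 - p) * \<tau>) * measure lborel A"
    by (simp add: \<alpha>_def algebra_simps)
  finally show ?thesis by (simp add: v_def[abs_def])
qed

section \<open>The Caccioppoli inequality\<close>

lemma has_real_derivative_max_power:
  assumes "2 \<le> n"
  shows "((\<lambda>x. (max 0 x) ^ n) has_real_derivative real n * (max 0 x) ^ (n - 1)) (at x)"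
proof -
  consider "0 < x" | "x < 0" | "x = 0" by linarith
  then show ?thesis
  proof cases
    case 1
    have "((\<lambda>x. x ^ n) has_real_derivative real n * x ^ (n - 1)) (at x)" by (auto intro!: derivative_eq_intros)
    then have "((\<lambda>x. (max 0 x) ^ n) has_real_derivative real n * x ^ (n - 1)) (at x)"
      by (rule has_field_derivative_transform_within_open[where S="{0<..}"]) (use 1 in auto)
    then show ?thesis using 1 by simp
  next
    case 2
    have "((\<lambda>x. 0) has_real_derivative 0) (at x)" by simp
    then have "((\<lambda>x. (max 0 x) ^ n) has_real_derivative 0) (at x)"
      by (rule has_field_derivative_transform_within_open[where S="{..<0}"]) (use 2 assms in auto)
    then show ?thesis using 2 assms by (simp add: zero_power)
  next
    case 3
    have "((\<lambda>y::real. (max 0 y) ^ (n - 1)) \<longlongrightarrow> (max 0 0) ^ (n - 1)) (at 0)" by (intro tendsto_intros)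
    then have l: "((\<lambda>y::real. (max 0 y) ^ (n - 1)) \<longlongrightarrow> 0) (at 0)" using assms by (simp add: zero_power)
    have e: "(max 0 y) ^ n / y = (max 0 y) ^ (n - 1)" if "y \<noteq> 0" for y :: real
      using that assms by (cases "0 < y"; cases n) auto
    have "((\<lambda>y::real. (max 0 y) ^ n / y) \<longlongrightarrow> 0) (at 0)"
      using l by (rule Lim_transform_eventually) (use e in \<open>auto simp: eventually_at_filter\<close>)
    then show ?thesis using 3 assms by (simp add: has_field_derivative_iff zero_power)
  qed
qed

lemma has_real_derivative_max_powr:
  fixes p :: real
  assumes "1 < p"
  shows "((\<lambda>x. (max 0 x) powr p) has_real_derivative p * (max 0 x) powr (p - 1)) (at x)"
proof -
  consider "0 < x" | "x < 0" | "x = 0" by linarith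
  then show ?thesis
  proof cases
    case 1
    have "((\<lambda>x. x powr p) has_real_derivative p * x powr (p - 1)) (at x)"
      using has_real_derivative_powr[OF 1, of p] by simp
    then have "((\<lambda>x. (max 0 x) powr p) has_real_derivative p * x powr (p - 1)) (at x)"
      by (rule has_field_derivative_transform_within_open[where S="{0<..}"]) (use 1 in auto)
    then show ?thesis using 1 by simp
  next
    case 2
    have "((\<lambda>x. 0) has_real_derivative 0) (at x)" by simp
    then have "((\<lambda>x. (max 0 x) powr p) has_real_derivative 0) (at x)"
      by (rule has_field_derivative_transform_within_open[where S="{..<0}"]) (use 2 assms in auto)
    then show ?thesis using 2 assms by simp
  next
    case 3
    have "((\<lambda>y::real. (max 0 y) powr (p - 1)) \<longlongrightarrow> (max 0 0) powr (p - 1)) (at 0)"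
      using assms by (intro tendsto_powr' tendsto_intros) auto
    then have l: "((\<lambda>y::real. (max 0 y) powr (p - 1)) \<longlongrightarrow> 0) (at 0)" using assms by simp
    have e: "(max 0 y) powr p / y = (max 0 y) powr (p - 1)" if "y \<noteq> 0" for y :: real
      using that powr_mult_base[of y "p - 1"] by (cases "0 < y") (auto simp: field_simps)
    have "((\<lambda>y::real. (max 0 y) powr p / y) \<longlongrightarrow> 0) (at 0)"
      using l by (rule Lim_transform_eventually) (use e in \<open>auto simp: eventually_at_filter\<close>)
    then show ?thesis using 3 assms by (simp add: has_field_derivative_iff)
  qed
qed

definition test_profile_deriv :: "real \<Rightarrow> real \<Rightarrow> real \<Rightarrow> real \<Rightarrow> real" where
  "test_profile_deriv p d q t = (1 - p) * (t + d) powr (- p) * (max 0 (1 - q * (t + d)))\<^sup>2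
     - 2 * q * (t + d) powr (1 - p) * max 0 (1 - q * (t + d))"

lemma test_profile_has_derivative:
  assumes "0 < d" "0 \<le> t"
  shows "(test_profile p d q has_real_derivative test_profile_deriv p d q t) (at t)"
proof -
  have a: "((\<lambda>t. (t + d) powr (1 - p)) has_real_derivative (1 - p) * (t + d) powr (- p)) (at t)"
    using assms by (auto intro!: derivative_eq_intros)
  have b: "((\<lambda>t. (max 0 (1 - q * (t + d)))\<^sup>2) has_real_derivative (2 * max 0 (1 - q * (t + d))) * (- q)) (at t)"
    by (rule DERIV_chain2[OF has_real_derivative_max_power[of 2, simplified]]) (auto intro!: derivative_eq_intros)
  show ?thesis
    unfolding test_profile_def[abs_def] test_profile_deriv_def
    by (rule DERIV_cong[OF DERIV_mult[OF a b]]) (simp add: algebra_simps)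
qed

lemma test_profile_deriv_continuous:
  assumes "0 < d"
  shows "continuous_on {0..} (test_profile_deriv p d q)"
  unfolding test_profile_deriv_def[abs_def] using assms by (intro continuous_intros) auto

lemma cutoff_slope_bounds:
  assumes "0 < d" "0 \<le> q" "0 \<le> t"
  shows "0 \<le> max 0 (1 - q * (t + d))" "max 0 (1 - q * (t + d)) \<le> (1::real)"
  using assms by auto

lemma test_profile_bound:
  assumes "0 < d" "0 \<le> q" "0 \<le> t" "1 < p"
  shows "test_profile p d q t \<le> d powr (1 - p)"
    and "\<bar>test_profile_deriv p d q t\<bar> \<le> (p - 1) * d powr (- p) + 2 * q * d powr (1 - p)"
proof -
  let ?m = "max 0 (1 - q * (t + d))"
  have m: "0 \<le> ?m" "?m \<le> 1" using cutoff_slope_bounds[OF assms(1-3)] by auto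
  have m2: "0 \<le> ?m\<^sup>2" "?m\<^sup>2 \<le> 1" using m by (auto simp: power_le_one)
  have a: "(t + d) powr (1 - p) \<le> d powr (1 - p)" using assms by (intro powr_mono2') auto
  have b: "(t + d) powr (- p) \<le> d powr (- p)" using assms by (intro powr_mono2') auto
  have "(t + d) powr (1 - p) * ?m\<^sup>2 \<le> d powr (1 - p) * 1" using a m2 by (intro mult_mono) auto
  then show "test_profile p d q t \<le> d powr (1 - p)" by (simp add: test_profile_def)
  have "(t + d) powr (- p) * ?m\<^sup>2 \<le> d powr (- p) * 1" using b m2 by (intro mult_mono) auto
  then have 1: "(p - 1) * ((t + d) powr (- p) * ?m\<^sup>2) \<le> (p - 1) * d powr (- p)" using assms by simp
  have "(t + d) powr (1 - p) * ?m \<le> d powr (1 - p) * 1" using a m by (intro mult_mono) auto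
  then have 2: "2 * q * ((t + d) powr (1 - p) * ?m) \<le> 2 * q * d powr (1 - p)" using assms(2) by (intro mult_left_mono) auto
  have 3: "0 \<le> (p - 1) * ((t + d) powr (- p) * ?m\<^sup>2)" "0 \<le> 2 * q * ((t + d) powr (1 - p) * ?m)"
    using assms m by auto
  have "test_profile_deriv p d q t = - ((p - 1) * ((t + d) powr (- p) * ?m\<^sup>2)) - 2 * q * ((t + d) powr (1 - p) * ?m)"
    by (simp add: test_profile_deriv_def algebra_simps)
  then show "\<bar>test_profile_deriv p d q t\<bar> \<le> (p - 1) * d powr (- p) + 2 * q * d powr (1 - p)"
    using 1 2 3 by linarith
qed

text \<open>
  For \<open>L \<le> e * W\<close> the first summand dominates, otherwise the second one.
\<close>

lemma powr_Young_eps: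
  fixes W L p e :: real
  assumes "1 < p" "0 \<le> W" "0 \<le> L" "0 < e"
  shows "W powr (p - 1) * L \<le> e * W powr p + e powr (1 - p) * L powr p"
proof (cases "L \<le> e * W")
  case True
  then have "W powr (p - 1) * L \<le> W powr (p - 1) * (e * W)" by (intro mult_left_mono) auto
  also have "\<dots> = e * W powr p"
    using powr_mult_base[of W "p - 1"] assms by (simp add: mult_ac)
  also have "\<dots> \<le> e * W powr p + e powr (1 - p) * L powr p" by simp
  finally show ?thesis .
next
  case False
  then have "W \<le> L / e" using assms by (simp add: field_simps)
  then have "W powr (p - 1) * L \<le> (L / e) powr (p - 1) * L" using assms by (intro mult_right_mono powr_mono2) auto
  also have "\<dots> = (1 / e powr (p - 1)) * (L powr (p - 1) * L)"
    using assms by (simp add: powr_divide)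
  also have "1 / e powr (p - 1) = e powr (1 - p)"
    using powr_minus_divide[of e "p - 1"] by simp
  also have "L powr (p - 1) * L = L powr p" using powr_mult_base[of L "p - 1"] assms by (simp add: mult.commute)
  also have "e powr (1 - p) * L powr p \<le> e * W powr p + e powr (1 - p) * L powr p" using assms by simp
  finally show ?thesis .
qed

text \<open>
  The derivative is part of the data, as a continuous vector field, which is the form needed by
  \<open>weak_gradient_chain\<close>.
\<close>

locale smooth_cutoff =
  fixes x0 :: "'a::euclidean_space" and \<rho> L :: real and \<eta> :: "'a \<Rightarrow> real" and D\<eta> :: "'a \<Rightarrow> 'a"
  assumes deriv: "\<And>x. (\<eta> has_derivative (\<lambda>h. D\<eta> x \<bullet> h)) (at x)"
    and cont: "continuous_on UNIV D\<eta>"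
    and range: "\<And>x. 0 \<le> \<eta> x" "\<And>x. \<eta> x \<le> 1"
    and supp: "\<And>x. x \<notin> ball x0 \<rho> \<Longrightarrow> \<eta> x = 0"
    and bound: "\<And>x. norm (D\<eta> x) \<le> L"
begin

lemma supp': "x \<notin> cball x0 \<rho> \<Longrightarrow> \<eta> x = 0"
  using supp[of x] by auto

lemma D_supp: "x \<notin> cball x0 \<rho> \<Longrightarrow> D\<eta> x = 0"
  by (rule derivative_eq_0_outside[OF deriv closed_cball supp']) auto

lemma lipschitz: "\<bar>\<eta> x - \<eta> y\<bar> \<le> L * norm (x - y)"
  by (rule lipschitz_of_derivative_bound[OF deriv bound])

lemma eta_continuous: "continuous_on UNIV \<eta>"
  using deriv by (meson continuous_at_imp_continuous_on has_derivative_continuous)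

lemma eta_measurable [measurable]: "\<eta> \<in> borel_measurable borel"
  by (rule borel_measurable_continuous_onI[OF eta_continuous])

lemma D_measurable [measurable]: "D\<eta> \<in> borel_measurable borel"
  by (rule borel_measurable_continuous_onI[OF cont])

lemma powr_deriv:
  assumes "1 < p"
  shows "((\<lambda>x. \<eta> x powr p) has_derivative (\<lambda>h. ((p * \<eta> x powr (p - 1)) *\<^sub>R D\<eta> x) \<bullet> h)) (at x)"
proof -
  have m: "max 0 (\<eta> x) = \<eta> x" for x using range(1)[of x] by simp
  have "((\<lambda>x. (max 0 (\<eta> x)) powr p) has_derivative (\<lambda>h. (p * (max 0 (\<eta> x)) powr (p - 1)) * (D\<eta> x \<bullet> h))) (at x)"
    by (rule has_derivative_compose[OF deriv has_field_derivative_imp_has_derivative[OF has_real_derivative_max_powr[OF assms]]])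
  then show ?thesis unfolding m by simp
qed

lemma powr_deriv_continuous:
  assumes "1 < p"
  shows "continuous_on UNIV (\<lambda>x. (p * \<eta> x powr (p - 1)) *\<^sub>R D\<eta> x)"
  using assms range(1) by (intro continuous_intros cont eta_continuous continuous_on_powr') auto

end

text \<open>
  Twice the reciprocal of \<open>\<alpha> * (p - 1)\<close>, with \<open>\<alpha> = measure \<mu> {1}\<close>, undoes the coefficient of the
  good term in the local energy. In the bracket, the first summand stems from the kernel and the
  tail, the second one from Young's inequality in the local energy.
\<close>

definition cacc_const :: "nat \<Rightarrow> real \<Rightarrow> real measure \<Rightarrow> real \<Rightarrow> real" where
  "cacc_const N p \<mu> kc = 2 / (measure \<mu> {1} * (p - 1)) *
     (nonlocal_const p * 2 * (kc * measure \<mu> (space \<mu>) + 4 powr (real N + p))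
      + measure \<mu> {1} * (p * ((p - 1) / (2 * p)) powr (1 - p)))"

lemma cacc_const_nonneg: "1 < p \<Longrightarrow> 0 \<le> kc \<Longrightarrow> 0 \<le> cacc_const N p \<mu> kc"
  unfolding cacc_const_def nonlocal_const_def by (intro mult_nonneg_nonneg add_nonneg_nonneg divide_nonneg_nonneg) auto

text \<open>
  The situation after all reductions: \<open>w\<close> and \<open>g\<close> are Borel representatives of the supersolution
  \<open>u\<close> and of its gradient, and \<open>d\<close> is the lower bound to be proved on the ball of radius \<open>4 * r\<close>.
  The last assumption says that the negative part of \<open>w\<close> far away is harmless at scale \<open>r\<close> for the
  shifted function \<open>w + d\<close>.
\<close>

locale supersolution_near =
  fixes p :: real and \<mu> :: "real measure" and \<Omega> :: "'a::euclidean_space set"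
    and u w :: "'a \<Rightarrow> real" and g :: "'a \<Rightarrow> 'a" and x0 :: 'a and R r d kc :: real
  assumes p: "1 < p" and fm: "finite_measure \<mu>" and sets_mu: "sets \<mu> = sets (restrict_space borel {0..1::real})"
    and \<alpha>: "0 < measure \<mu> {1}" and \<Omega>: "open \<Omega>"
    and super: "weak_supersolution \<mu> p \<Omega> u" and ball: "ball x0 R \<subseteq> \<Omega>"
    and w [measurable]: "w \<in> borel_measurable borel" and uw: "AE x in lebesgue. u x = w x"
    and w0: "\<And>x. x \<in> ball x0 R \<Longrightarrow> 0 \<le> w x"
    and g [measurable]: "g \<in> borel_measurable borel"
    and wgu: "is_weak_gradient \<Omega> u g" and wgw: "is_weak_gradient \<Omega> w g" and gp: "Lp_loc p \<Omega> g"
    and r: "0 < r" "r \<le> 1" "16 * r < R" and d: "0 < d"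
    and kc: "0 \<le> kc" "\<And>s. 0 < s \<Longrightarrow> s < 1 \<Longrightarrow>
       ennreal (C_norm DIM('a) s p) * (\<integral>\<^sup>+z. ennreal (min 1 (norm z) powr p * norm (z::'a) powr (- (real DIM('a) + s * p))) \<partial>lborel) \<le> ennreal kc"
    and tail: "(\<integral>\<^sup>+s\<in>{0<..<1}. ennreal (C_norm DIM('a) s p)
       * (\<integral>\<^sup>+y. ennreal ((max (- w y) 0) powr (p - 1) / norm (y - x0) powr (real DIM('a) + s * p)) * indicator (- ball x0 R) y \<partial>lborel) \<partial>\<mu>)
       \<le> ennreal (r powr (- p) * d powr (p - 1))"
begin

text \<open>
  Cutoffs live in the ball of radius \<open>12 * r\<close>; another \<open>r\<close> is spent on mollification, so that
  everything happens inside the ball of radius \<open>14 * r\<close>, whose closure lies in \<open>\<Omega>\<close> since \<open>16 * r <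
  R\<close>.
\<close>

abbreviation "W \<equiv> ball x0 (14 * r)"

lemma W_sub: "cball x0 (14 * r) \<subseteq> \<Omega>" "W \<subseteq> \<Omega>" "cball x0 (14 * r) \<subseteq> ball x0 R"
proof -
  show "cball x0 (14 * r) \<subseteq> ball x0 R" using r by auto
  then show "cball x0 (14 * r) \<subseteq> \<Omega>" using ball by blast
  then show "W \<subseteq> \<Omega>" using ball_subset_cball by blast
qed

lemma integrable_W: "integrable lborel (\<lambda>x. indicator W x *\<^sub>R w x)" "integrable lborel (\<lambda>x. indicator W x *\<^sub>R g x)"
proof -
  have *: "integrable lborel (\<lambda>x. indicator W x *\<^sub>R f x)" if f: "Lp_loc 1 \<Omega> f" and [measurable]: "f \<in> borel_measurable borel" for f :: "'a \<Rightarrow> 'b::euclidean_space"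
  proof (rule integrableI_bounded)
    have "Lp 1 (cball x0 (14 * r)) f" using f W_sub(1) unfolding Lp_loc_def by auto
    then have fin: "(\<integral>\<^sup>+x. ennreal (norm (f x) powr 1) * indicator (cball x0 (14 * r)) x \<partial>lborel) < \<infinity>"
      by (rule LpD) auto
    show "(\<integral>\<^sup>+x. ennreal (norm (indicator W x *\<^sub>R f x)) \<partial>lborel) < \<infinity>"
      by (rule le_less_trans[OF nn_integral_mono fin]) (auto simp: indicator_def)
    show "(\<lambda>x. indicator W x *\<^sub>R f x) \<in> borel_measurable lborel"
    proof -
      have "W \<in> sets lborel" by simp
      then show ?thesis by (intro borel_measurable_scaleR borel_measurable_indicator) simp_all
    qed
  qed
  show "integrable lborel (\<lambda>x. indicator W x *\<^sub>R w x)" by (rule *) (use wgw in \<open>auto simp: is_weak_gradient_def\<close>)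
  show "integrable lborel (\<lambda>x. indicator W x *\<^sub>R g x)" by (rule *) (use wgw in \<open>auto simp: is_weak_gradient_def\<close>)
qed

lemma gp_fin: "(\<integral>\<^sup>+x. ennreal (norm (g x) powr p) * indicator (cball x0 (14 * r)) x \<partial>lborel) < \<infinity>"
  by (rule LpD) (use gp W_sub(1) in \<open>auto simp: Lp_loc_def\<close>)

lemma chain:
  assumes \<psi>: "\<And>x. (\<psi> has_derivative (\<lambda>h. D\<psi> x \<bullet> h)) (at x)" "continuous_on UNIV D\<psi>"
    and supp: "\<And>x. x \<notin> cball x0 \<rho> \<Longrightarrow> \<psi> x = 0" and \<rho>: "\<rho> \<le> 12 * r"
    and F: "\<And>t. 0 \<le> t \<Longrightarrow> (F has_real_derivative F' t) (at t)" "continuous_on {0..} F'"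
      "\<And>t. 0 \<le> t \<Longrightarrow> \<bar>F' t\<bar> \<le> M"
    and Fmeas: "F \<in> borel_measurable borel" "F' \<in> borel_measurable borel"
  shows "is_weak_gradient UNIV (\<lambda>x. \<psi> x * F (w x)) (\<lambda>x. F (w x) *\<^sub>R D\<psi> x + (\<psi> x * F' (w x)) *\<^sub>R g x)"
    "integrable lborel (\<lambda>x. \<psi> x * F (w x))"
    "integrable lborel (\<lambda>x. F (w x) *\<^sub>R D\<psi> x + (\<psi> x * F' (w x)) *\<^sub>R g x)"
proof -
  have cb: "cball x r \<subseteq> W" if "x \<in> cball x0 \<rho>" for x
  proof
    fix y assume "y \<in> cball x r"
    then have "dist x0 y \<le> \<rho> + r" using that dist_triangle[of x0 y x] by auto
    then show "y \<in> W" using \<rho> r(1) by simp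
  qed
  have nn: "0 \<le> w x" if "x \<in> W" for x using that W_sub(3) ball_subset_cball w0 by blast
  note * = weak_gradient_chain[OF wgw _ _ W_sub(2) w g integrable_W nn \<psi> compact_cball supp r(1) cb F Fmeas]
  show "is_weak_gradient UNIV (\<lambda>x. \<psi> x * F (w x)) (\<lambda>x. F (w x) *\<^sub>R D\<psi> x + (\<psi> x * F' (w x)) *\<^sub>R g x)"
    "integrable lborel (\<lambda>x. \<psi> x * F (w x))"
    "integrable lborel (\<lambda>x. F (w x) *\<^sub>R D\<psi> x + (\<psi> x * F' (w x)) *\<^sub>R g x)"
    using \<Omega> by (intro *; simp)+
qed

definition K :: real where
  "K = cacc_const DIM('a) p \<mu> kc"

text \<open>
  The \<open>p\<close>-th power of \<open>\<eta>\<close> times the length of the gradient of \<open>ln (w + d)\<close>, confined to \<open>q * (w +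
  d) < 1\<close>.
\<close>

definition energy_density :: "('a \<Rightarrow> real) \<Rightarrow> real \<Rightarrow> 'a \<Rightarrow> real" where
  "energy_density \<eta> q x = (\<eta> x * norm (g x) / (w x + d)) powr p * (max 0 (1 - q * (w x + d)))\<^sup>2"

text \<open>
  The only use of the equation. The test function is \<open>v = \<eta>\<^bsup>p\<^esup>\<close> times \<open>test_profile\<close> of \<open>w\<close>. The
  nonlocal energy is bounded by \<open>nonlocal_energy_bound\<close>, where the smallness of the tail and \<open>1 /
  r \<le> L\<close> turn the tail contribution into a multiple of \<open>L\<^bsup>p\<^esup>\<close>. In the local energy, the derivative
  of the profile contributes \<open>- (p - 1)\<close> times the energy density and a further term of favourable
  sign; the gradient of the cutoff is absorbed with half of the good term by Young's inequality.
  As \<open>\<alpha> > 0\<close>, this controls the energy density.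
\<close>

lemma caccioppoli:
  assumes cut: "smooth_cutoff x0 \<rho> L \<eta> D\<eta>" and \<rho>: "\<rho> \<le> 12 * r" and L: "1 / r \<le> L" and q: "0 \<le> q"
  defines "A \<equiv> {x \<in> ball x0 \<rho>. q * (w x + d) < 1}"
  shows "(\<integral>\<^sup>+x. ennreal (energy_density \<eta> q x) \<partial>lborel) \<le> ennreal (K * L powr p * measure lborel A)"
proof -
  interpret smooth_cutoff x0 \<rho> L \<eta> D\<eta> by (rule cut)
  interpret finite_measure \<mu> by (rule fm)
  define F where "F = test_profile p d q"
  define F' where "F' = test_profile_deriv p d q"
  define D\<psi> where "D\<psi> x = (p * \<eta> x powr (p - 1)) *\<^sub>R D\<eta> x" for x
  define v where "v x = \<eta> x powr p * F (w x)" for x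
  define Gv where "Gv x = F (w x) *\<^sub>R D\<psi> x + (\<eta> x powr p * F' (w x)) *\<^sub>R g x" for x
  define M where "M = (p - 1) * d powr (- p) + 2 * q * d powr (1 - p)"
  have L1: "1 \<le> L" "0 < L"
  proof -
    have "1 \<le> 1 / r" using r by simp
    then show "1 \<le> L" "0 < L" using L by auto
  qed
  have \<rho>R: "\<rho> \<le> 3 / 4 * R" "ball x0 \<rho> \<subseteq> ball x0 R" "cball x0 \<rho> \<subseteq> cball x0 (14 * r)" "cball x0 \<rho> \<subseteq> W" using \<rho> r by auto
  have wn: "0 \<le> w x" if "x \<in> cball x0 \<rho>" for x using that \<rho>R(3) W_sub(3) w0 by blast
  have s: "0 < w x + d" "d \<le> w x + d" if "x \<in> cball x0 \<rho>" for x using wn[OF that] d by auto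
  have [measurable]: "F \<in> borel_measurable borel" "F' \<in> borel_measurable borel"
    unfolding F_def F'_def test_profile_def[abs_def] test_profile_deriv_def[abs_def] by measurable
  have [measurable]: "D\<psi> \<in> borel_measurable borel" unfolding D\<psi>_def[abs_def] by measurable
  have vm[measurable]: "v \<in> borel_measurable borel" and Gvm[measurable]: "Gv \<in> borel_measurable borel"
    unfolding v_def[abs_def] Gv_def[abs_def] by measurable
  have \<psi>supp: "\<eta> x powr p = 0" if "x \<notin> cball x0 \<rho>" for x using supp'[OF that] by simp
  have F1: "(F has_real_derivative F' t) (at t)" if "0 \<le> t" for t
    unfolding F_def F'_def by (rule test_profile_has_derivative[OF d that])
  have F2: "continuous_on {0..} F'" unfolding F'_def by (rule test_profile_deriv_continuous[OF d])
  have F3: "\<bar>F' t\<bar> \<le> M" if "0 \<le> t" for t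
    unfolding F'_def M_def by (rule test_profile_bound(2)[OF d q that p])
  note chain_F = chain[OF powr_deriv[OF p] powr_deriv_continuous[OF p] \<psi>supp \<rho> F1 F2 F3 \<open>F \<in> borel_measurable borel\<close> \<open>F' \<in> borel_measurable borel\<close>]
  have v_wg: "is_weak_gradient UNIV v Gv"
    unfolding v_def[abs_def] Gv_def[abs_def] D\<psi>_def by (rule chain_F(1))
  have v_int: "integrable lborel v" unfolding v_def[abs_def] by (rule chain_F(2))
  have Gv_int: "integrable lborel Gv" unfolding Gv_def[abs_def] D\<psi>_def by (rule chain_F(3))
  have v0: "0 \<le> v x" for x by (simp add: v_def F_def test_profile_nonneg)
  have vb: "v x \<le> d powr (1 - p)" for x
  proof (cases "x \<in> cball x0 \<rho>")
    case True
    have "\<eta> x powr p * F (w x) \<le> 1 * d powr (1 - p)"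
      using range[of x] p test_profile_bound(1)[OF d q wn[OF True] p] test_profile_nonneg[of p d q "w x"]
      by (intro mult_mono) (auto simp: F_def powr_le1)
    then show ?thesis by (simp add: v_def)
  next
    case False
    show ?thesis unfolding v_def \<psi>supp[OF False] by simp
  qed
  have v_supp: "v x = 0" if "x \<notin> cball x0 \<rho>" for x
    unfolding v_def \<psi>supp[OF that] by simp
  define B where "B = d powr (1 - p) * (p * L)"
  have B0: "0 \<le> B" using p L1 by (simp add: B_def)
  have M0: "0 \<le> M" using p q by (simp add: M_def)
  have Gvb: "norm (Gv x) \<le> (B + M * norm (g x)) * indicator (cball x0 \<rho>) x" for x
  proof (cases "x \<in> cball x0 \<rho>")
    case True
    have f0: "0 \<le> F (w x)" "F (w x) \<le> d powr (1 - p)"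
      using test_profile_bound(1)[OF d q wn[OF True] p] test_profile_nonneg by (auto simp: F_def)
    have e1: "\<eta> x powr (p - 1) \<le> 1" "\<eta> x powr p \<le> 1" using range[of x] p by (auto simp: powr_le1)
    have "norm (D\<psi> x) \<le> (p * 1) * L"
      unfolding D\<psi>_def norm_scaleR using p e1 bound[of x] by (intro mult_mono) (auto simp: abs_mult)
    then have 1: "norm (F (w x) *\<^sub>R D\<psi> x) \<le> B"
      unfolding B_def norm_scaleR using f0 p L1 by (intro mult_mono) auto
    have "\<bar>\<eta> x powr p * F' (w x)\<bar> \<le> 1 * M"
      unfolding abs_mult using e1 test_profile_bound(2)[OF d q wn[OF True] p] by (intro mult_mono) (auto simp: F'_def M_def)
    then have 2: "norm ((\<eta> x powr p * F' (w x)) *\<^sub>R g x) \<le> M * norm (g x)"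
      unfolding norm_scaleR by (intro mult_right_mono) auto
    show ?thesis using norm_triangle_mono[OF 1 2] True by (simp add: Gv_def)
  next
    case False
    then have "\<eta> x = 0" "D\<eta> x = 0" using supp' D_supp by auto
    then show ?thesis using False by (simp add: Gv_def D\<psi>_def)
  qed
  have cfin: "emeasure lborel (cball x0 (14 * r)) < \<infinity>" using emeasure_lborel_cball_finite by (simp add: less_top)
  have vfin: "(\<integral>\<^sup>+x. ennreal (norm (v x) powr p) \<partial>lborel) < \<infinity>"
  proof -
    have "(\<integral>\<^sup>+x. ennreal (norm (v x) powr p) \<partial>lborel) \<le> (\<integral>\<^sup>+x. ennreal ((d powr (1 - p)) powr p) * indicator (cball x0 (14 * r)) x \<partial>lborel)"
    proof (rule nn_integral_mono)
      fix x
      have "norm (v x) powr p \<le> (d powr (1 - p)) powr p" using v0[of x] vb[of x] p by (intro powr_mono2) auto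
      then show "ennreal (norm (v x) powr p) \<le> ennreal ((d powr (1 - p)) powr p) * indicator (cball x0 (14 * r)) x"
        using v_supp[of x] \<rho>R(3) p by (cases "x \<in> cball x0 \<rho>") (auto simp: ennreal_leI)
    qed
    also have "\<dots> = ennreal ((d powr (1 - p)) powr p) * emeasure lborel (cball x0 (14 * r))" by (rule nn_integral_cmult_indicator) simp
    also have "\<dots> < \<infinity>" using cfin by (simp add: ennreal_mult_less_top)
    finally show ?thesis .
  qed
  have Gvp: "norm (Gv x) powr p \<le> 2 powr p * (B powr p + M powr p * norm (g x) powr p) * indicator (cball x0 (14 * r)) x" for x
  proof (cases "x \<in> cball x0 \<rho>")
    case True
    have "norm (Gv x) powr p \<le> (B + M * norm (g x)) powr p" using Gvb[of x] True p by (intro powr_mono2) auto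
    also have "\<dots> \<le> 2 powr p * (B powr p + (M * norm (g x)) powr p)" using B0 M0 p by (intro powr_add_le) auto
    also have "(M * norm (g x)) powr p = M powr p * norm (g x) powr p" using M0 by (simp add: powr_mult)
    finally show ?thesis using True \<rho>R(3) by auto
  next
    case False
    then have "Gv x = 0" using Gvb[of x] by simp
    then show ?thesis using p by simp
  qed
  have indm: "(\<lambda>x. indicator (cball x0 (14 * r)) x :: ennreal) \<in> borel_measurable lborel"
    by (rule borel_measurable_indicator) simp
  have Gfin: "(\<integral>\<^sup>+x. ennreal (norm (Gv x) powr p) \<partial>lborel) < \<infinity>"
  proof -
    let ?c1 = "2 powr p * B powr p" and ?c2 = "2 powr p * M powr p"
    have "(\<integral>\<^sup>+x. ennreal (norm (Gv x) powr p) \<partial>lborel)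
       \<le> (\<integral>\<^sup>+x. ennreal ?c1 * indicator (cball x0 (14 * r)) x + ennreal ?c2 * (ennreal (norm (g x) powr p) * indicator (cball x0 (14 * r)) x) \<partial>lborel)"
    proof (rule nn_integral_mono)
      fix x
      have "norm (Gv x) powr p \<le> (?c1 + ?c2 * norm (g x) powr p) * indicator (cball x0 (14 * r)) x"
        using Gvp[of x] by (simp add: algebra_simps)
      then have "ennreal (norm (Gv x) powr p) \<le> ennreal ((?c1 + ?c2 * norm (g x) powr p) * indicator (cball x0 (14 * r)) x)"
        by (rule ennreal_leI)
      also have "\<dots> = ennreal ?c1 * indicator (cball x0 (14 * r)) x + ennreal ?c2 * (ennreal (norm (g x) powr p) * indicator (cball x0 (14 * r)) x)"
        by (cases "x \<in> cball x0 (14 * r)") (simp_all add: ennreal_plus ennreal_mult)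
      finally show "ennreal (norm (Gv x) powr p) \<le> ennreal ?c1 * indicator (cball x0 (14 * r)) x + ennreal ?c2 * (ennreal (norm (g x) powr p) * indicator (cball x0 (14 * r)) x)" .
    qed
    also have "\<dots> = (\<integral>\<^sup>+x. ennreal ?c1 * indicator (cball x0 (14 * r)) x \<partial>lborel) + (\<integral>\<^sup>+x. ennreal ?c2 * (ennreal (norm (g x) powr p) * indicator (cball x0 (14 * r)) x) \<partial>lborel)"
      using indm by (intro nn_integral_add borel_measurable_times_ennreal) auto
    also have "(\<integral>\<^sup>+x. ennreal ?c1 * indicator (cball x0 (14 * r)) x \<partial>lborel) = ennreal ?c1 * emeasure lborel (cball x0 (14 * r))"
      by (rule nn_integral_cmult_indicator) simp
    also have "(\<integral>\<^sup>+x. ennreal ?c2 * (ennreal (norm (g x) powr p) * indicator (cball x0 (14 * r)) x) \<partial>lborel)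
       = ennreal ?c2 * (\<integral>\<^sup>+x. ennreal (norm (g x) powr p) * indicator (cball x0 (14 * r)) x \<partial>lborel)"
      using indm by (intro nn_integral_cmult borel_measurable_times_ennreal) auto
    also have "ennreal ?c1 * emeasure lborel (cball x0 (14 * r)) + ennreal ?c2 * (\<integral>\<^sup>+x. ennreal (norm (g x) powr p) * indicator (cball x0 (14 * r)) x \<partial>lborel) < \<infinity>"
      using cfin gp_fin by (simp add: ennreal_mult_less_top)
    finally show ?thesis .
  qed
  have vW: "v \<in> W1p_0 p W"
    by (rule W1p_0I[OF open_ball compact_cball \<rho>R(4) v_supp _ v_wg v_int Gv_int vfin Gfin]) (use p in auto)
  have "0 \<le> nonlocal_energy \<mu> p u v + measure \<mu> {1} * local_energy p \<Omega> g Gv"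
  proof -
    have "compact (closure W)" "closure W \<subseteq> \<Omega>" using W_sub(1) r(1) by auto
    moreover have "is_weak_gradient \<Omega> v Gv" by (rule is_weak_gradient_subset[OF v_wg]) simp
    moreover have "AE x in lebesgue. 0 \<le> v x" using v0 by simp
    ultimately show ?thesis using super vW wgu open_ball unfolding weak_supersolution_def by blast
  qed
  moreover have "nonlocal_energy \<mu> p u v \<le> nonlocal_const p * 2 * (kc * measure \<mu> (space \<mu>) + 4 powr (real DIM('a) + p)) * L powr p * measure lborel A"
  proof -
    have nc: "0 \<le> nonlocal_const p" using p by (simp add: nonlocal_const_def)
    have "ennreal (nonlocal_energy \<mu> p u v) \<le> ennreal (nonlocal_const p * 2 * (L powr p * kc * measure \<mu> (space \<mu>) + 4 powr (real DIM('a) + p) * d powr (1 - p) * (r powr (- p) * d powr (p - 1))) * measure lborel A)"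
      unfolding v_def[abs_def] F_def A_def
      by (rule nonlocal_energy_bound[OF p d q fm sets_mu w uw w0 range supp lipschitz eta_measurable L1(1) \<rho>R(1) _ kc _ tail]) (use r in auto)
    moreover have "0 \<le> nonlocal_const p * 2 * (L powr p * kc * measure \<mu> (space \<mu>) + 4 powr (real DIM('a) + p) * d powr (1 - p) * (r powr (- p) * d powr (p - 1))) * measure lborel A"
      using nc kc(1) by simp
    ultimately have "nonlocal_energy \<mu> p u v \<le> nonlocal_const p * 2 * (L powr p * kc * measure \<mu> (space \<mu>) + 4 powr (real DIM('a) + p) * d powr (1 - p) * (r powr (- p) * d powr (p - 1))) * measure lborel A"
      by (simp add: ennreal_le_iff)
    also have "\<dots> \<le> nonlocal_const p * 2 * (L powr p * (kc * measure \<mu> (space \<mu>)) + L powr p * 4 powr (real DIM('a) + p)) * measure lborel A"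
    proof (intro mult_right_mono mult_left_mono add_mono)
      have "d powr (1 - p) * d powr (p - 1) = 1" using d by (simp add: powr_add[symmetric])
      then have e1: "4 powr (real DIM('a) + p) * d powr (1 - p) * (r powr (- p) * d powr (p - 1)) = 4 powr (real DIM('a) + p) * r powr (- p)"
        by (simp add: mult_ac)
      have "r powr (- p) = (1 / r) powr p" using r by (simp add: powr_divide powr_minus_divide)
      moreover have "(1 / r) powr p \<le> L powr p" using L r p by (intro powr_mono2) auto
      ultimately have e2: "r powr (- p) \<le> L powr p" by (simp only:)
      show "4 powr (real DIM('a) + p) * d powr (1 - p) * (r powr (- p) * d powr (p - 1)) \<le> L powr p * 4 powr (real DIM('a) + p)"
        unfolding e1 using e2 by simp
    qed (use nc in auto)
    finally show ?thesis by (simp add: algebra_simps)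
  qed
  moreover have "local_energy p \<Omega> g Gv \<le> p * ((p - 1) / (2 * p)) powr (1 - p) * L powr p * measure lborel A - (p - 1) / 2 * (\<integral>x. energy_density \<eta> q x \<partial>lborel)"
    and Eint: "integrable lborel (energy_density \<eta> q)"
  proof -
    define J where "J x = indicator \<Omega> x *\<^sub>R ((norm (g x) powr (p - 2) *\<^sub>R g x) \<bullet> Gv x)" for x
    have \<Omega>m: "\<Omega> \<in> sets lborel" using \<Omega> by simp
    have Em[measurable]: "energy_density \<eta> q \<in> borel_measurable borel"
      unfolding energy_density_def[abs_def] by measurable
    have E0: "0 \<le> energy_density \<eta> q x" for x by (simp add: energy_density_def)
    have Eb: "energy_density \<eta> q x \<le> d powr (- p) * norm (g x) powr p * indicator (cball x0 (14 * r)) x" for x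
    proof (cases "x \<in> cball x0 \<rho>")
      case True
      have "\<eta> x * norm (g x) / (w x + d) \<le> 1 * norm (g x) / d"
        using range[of x] s[OF True] d by (intro frac_le mult_right_mono) auto
      then have "(\<eta> x * norm (g x) / (w x + d)) powr p \<le> (norm (g x) / d) powr p"
        using range[of x] s[OF True] p by (intro powr_mono2) auto
      also have "\<dots> = d powr (- p) * norm (g x) powr p" using d by (simp add: powr_divide powr_minus_divide)
      finally have "(\<eta> x * norm (g x) / (w x + d)) powr p * (max 0 (1 - q * (w x + d)))\<^sup>2 \<le> d powr (- p) * norm (g x) powr p * 1"
        using cutoff_slope_bounds[OF d q wn[OF True]] by (intro mult_mono) (auto simp: power_le_one)
      then show ?thesis using True \<rho>R(3) by (auto simp: energy_density_def)
    next
      case False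
      then have "energy_density \<eta> q x = 0" using supp'[OF False] by (simp add: energy_density_def)
      then show ?thesis by simp
    qed
    have gpint: "integrable lborel (\<lambda>x. norm (g x) powr p * indicator (cball x0 (14 * r)) x)"
    proof (rule integrableI_bounded)
      have "(\<lambda>x. norm (g x) powr p) \<in> borel_measurable lborel" by measurable
      moreover have "(\<lambda>x. indicator (cball x0 (14 * r)) x :: real) \<in> borel_measurable lborel" by (intro borel_measurable_indicator) simp
      ultimately show "(\<lambda>x. norm (g x) powr p * indicator (cball x0 (14 * r)) x) \<in> borel_measurable lborel"
        by (intro borel_measurable_times)
      show "(\<integral>\<^sup>+x. ennreal (norm (norm (g x) powr p * indicator (cball x0 (14 * r)) x)) \<partial>lborel) < \<infinity>"
        by (rule le_less_trans[OF nn_integral_mono gp_fin]) (auto simp: indicator_def)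
    qed
    show Eint: "integrable lborel (energy_density \<eta> q)"
    proof (rule Bochner_Integration.integrable_bound)
      show "integrable lborel (\<lambda>x. d powr (- p) * (norm (g x) powr p * indicator (cball x0 (14 * r)) x))"
        by (rule integrable_mult_right[OF gpint])
      show "AE x in lborel. norm (energy_density \<eta> q x) \<le> norm (d powr (- p) * (norm (g x) powr p * indicator (cball x0 (14 * r)) x))"
      proof (rule AE_I2)
        fix x show "norm (energy_density \<eta> q x) \<le> norm (d powr (- p) * (norm (g x) powr p * indicator (cball x0 (14 * r)) x))"
          using Eb[of x] E0[of x] by (simp add: mult.assoc)
      qed
      show "energy_density \<eta> q \<in> borel_measurable lborel" using Em by simp
    qed
    have Jm: "J \<in> borel_measurable lborel"
    proof -
      have "(\<lambda>x. (norm (g x) powr (p - 2) *\<^sub>R g x) \<bullet> Gv x) \<in> borel_measurable lborel" by measurable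
      then show ?thesis unfolding J_def[abs_def] by (intro borel_measurable_scaleR borel_measurable_indicator \<Omega>m)
    qed
    have ng: "norm (norm (g x) powr (p - 2) *\<^sub>R g x) = norm (g x) powr (p - 1)" for x
      using powr_mult_base[of "norm (g x)" "p - 2"] by (simp add: mult.commute)
    have Jint: "integrable lborel J"
    proof (rule Bochner_Integration.integrable_bound[OF _ Jm])
      have "integrable lborel (\<lambda>x. norm (Gv x) powr p)"
        by (rule integrableI_bounded) (use Gfin in auto)
      then show "integrable lborel (\<lambda>x. norm (g x) powr p * indicator (cball x0 (14 * r)) x + norm (Gv x) powr p)"
        by (intro Bochner_Integration.integrable_add gpint)
      show "AE x in lborel. norm (J x) \<le> norm (norm (g x) powr p * indicator (cball x0 (14 * r)) x + norm (Gv x) powr p)"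
      proof (rule AE_I2)
        fix x
        show "norm (J x) \<le> norm (norm (g x) powr p * indicator (cball x0 (14 * r)) x + norm (Gv x) powr p)"
        proof (cases "x \<in> cball x0 \<rho>")
          case True
          have "norm (J x) \<le> norm (norm (g x) powr (p - 2) *\<^sub>R g x) * norm (Gv x)"
            using Cauchy_Schwarz_ineq2[of "norm (g x) powr (p - 2) *\<^sub>R g x" "Gv x"]
            unfolding J_def by (cases "x \<in> \<Omega>") (simp_all del: inner_scaleR_left norm_scaleR)
          also have "\<dots> = norm (g x) powr (p - 1) * norm (Gv x)" by (simp only: ng)
          also have "\<dots> \<le> 1 * norm (g x) powr p + 1 powr (1 - p) * norm (Gv x) powr p"
            by (rule powr_Young_eps[OF p]) auto
          finally show ?thesis using True \<rho>R(3) by auto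
        next
          case False
          then have "Gv x = 0" using Gvb[of x] by simp
          then show ?thesis by (simp add: J_def)
        qed
      qed
    qed
    define c where "c = p * ((p - 1) / (2 * p)) powr (1 - p) * L powr p"
    have c0: "0 \<le> c" using p by (simp add: c_def)
    have Am: "A \<in> sets lborel" unfolding A_def by measurable
    have Afin: "emeasure lborel A < \<infinity>"
    proof -
      have "emeasure lborel A \<le> emeasure lborel (ball x0 \<rho>)" by (intro emeasure_mono) (auto simp: A_def)
      also have "\<dots> < \<infinity>" using emeasure_lborel_ball_finite[of x0 \<rho>] by simp
      finally show ?thesis .
    qed
    have pt: "J x \<le> c * indicator A x - (p - 1) / 2 * energy_density \<eta> q x" for x
    proof (cases "\<eta> x = 0 \<or> 1 - q * (w x + d) \<le> 0")
      case True
      then have "Gv x = 0" using p by (auto simp: Gv_def D\<psi>_def F_def F'_def test_profile_def test_profile_deriv_def)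
      moreover have "energy_density \<eta> q x = 0" using True p by (auto simp: energy_density_def)
      ultimately show ?thesis using c0 by (simp add: J_def)
    next
      case False
      then have xb: "x \<in> ball x0 \<rho>" using supp by blast
      then have xA: "x \<in> A" using False by (simp add: A_def)
      have xc: "x \<in> cball x0 \<rho>" using xb ball_subset_cball by blast
      have x\<Omega>: "x \<in> \<Omega>" using xb \<rho>R(2) ball by blast
      define t where "t = w x + d"
      define m where "m = max 0 (1 - q * t)"
      define Z where "Z = \<eta> x * norm (g x) / t"
      have t: "0 < t" using s[OF xc] by (simp add: t_def)
      have m: "0 \<le> m" "m \<le> 1" using cutoff_slope_bounds[OF d q wn[OF xc]] by (auto simp: m_def t_def)
      have Z: "0 \<le> Z" using range[of x] t by (simp add: Z_def)
      have gg: "(norm (g x) powr (p - 2) *\<^sub>R g x) \<bullet> g x = norm (g x) powr p"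
      proof -
        have "(norm (g x) powr (p - 2) *\<^sub>R g x) \<bullet> g x = norm (g x) powr (p - 2) * norm (g x) * norm (g x)"
          by (simp add: power2_norm_eq_inner[symmetric] power2_eq_square)
        also have "norm (g x) powr (p - 2) * norm (g x) = norm (g x) powr (p - 1)"
          using powr_mult_base[of "norm (g x)" "p - 2"] by (simp add: mult.commute)
        also have "norm (g x) powr (p - 1) * norm (g x) = norm (g x) powr p"
          using powr_mult_base[of "norm (g x)" "p - 1"] by (simp add: mult.commute)
        finally show ?thesis .
      qed
      have Zp: "Z powr p = \<eta> x powr p * norm (g x) powr p * t powr (- p)"
        unfolding Z_def using range[of x] t by (simp add: powr_divide powr_mult powr_minus_divide)
      have Zp1: "Z powr (p - 1) = \<eta> x powr (p - 1) * norm (g x) powr (p - 1) * t powr (1 - p)"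
      proof -
        have "t powr (1 - p) = 1 / t powr (p - 1)" using powr_minus_divide[of t "p - 1"] by simp
        then show ?thesis unfolding Z_def using range[of x] t by (simp add: powr_divide powr_mult)
      qed
      have gD: "(norm (g x) powr (p - 2) *\<^sub>R g x) \<bullet> D\<eta> x \<le> norm (g x) powr (p - 1) * L"
      proof -
        have "(norm (g x) powr (p - 2) *\<^sub>R g x) \<bullet> D\<eta> x \<le> norm (norm (g x) powr (p - 2) *\<^sub>R g x) * norm (D\<eta> x)"
          by (rule norm_cauchy_schwarz)
        also have "\<dots> \<le> norm (g x) powr (p - 1) * L" unfolding ng using bound[of x] by (intro mult_left_mono) auto
        finally show ?thesis .
      qed
      (* ?X comes from the gradient of the cutoff, ?Y from the derivative of the profile. *)
      let ?X = "F (w x) * (p * \<eta> x powr (p - 1)) * ((norm (g x) powr (p - 2) *\<^sub>R g x) \<bullet> D\<eta> x)"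
      let ?Y = "(\<eta> x powr p * F' (w x)) * norm (g x) powr p"
      have J0: "J x = ?X + ?Y"
        using x\<Omega> unfolding J_def Gv_def D\<psi>_def inner_add_right inner_scaleR_right gg by simp
      have X1: "?X \<le> F (w x) * (p * \<eta> x powr (p - 1)) * (norm (g x) powr (p - 1) * L)"
        using p by (intro mult_left_mono gD) (auto simp: F_def test_profile_nonneg)
      have X2: "F (w x) * (p * \<eta> x powr (p - 1)) * (norm (g x) powr (p - 1) * L) = m\<^sup>2 * (p * (Z powr (p - 1) * L))"
        unfolding Zp1 F_def test_profile_def t_def[symmetric] m_def[symmetric] by (simp add: mult_ac)
      have Y1: "?Y = - ((p - 1) * m\<^sup>2 * Z powr p) - 2 * q * m * t powr (1 - p) * (\<eta> x powr p * norm (g x) powr p)"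
        unfolding Zp F'_def test_profile_deriv_def t_def[symmetric] m_def[symmetric] by (simp add: algebra_simps)
      have Y2: "0 \<le> 2 * q * m * t powr (1 - p) * (\<eta> x powr p * norm (g x) powr p)" using q m by simp
      have J1: "J x \<le> m\<^sup>2 * (p * (Z powr (p - 1) * L)) - (p - 1) * m\<^sup>2 * Z powr p"
        using J0 X1 X2 Y1 Y2 by linarith
      (* With this weight p * ?e is (p - 1) / 2, half of the coefficient of the good term. *)
      let ?e = "(p - 1) / (2 * p)"
      have "p * (Z powr (p - 1) * L) \<le> p * (?e * Z powr p + ?e powr (1 - p) * L powr p)"
        using p Z L1 by (intro mult_left_mono powr_Young_eps) auto
      also have "\<dots> = (p - 1) / 2 * Z powr p + c" using p by (simp add: c_def field_simps)
      finally have "m\<^sup>2 * (p * (Z powr (p - 1) * L)) \<le> m\<^sup>2 * ((p - 1) / 2 * Z powr p + c)" by (rule mult_left_mono) simp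
      moreover have "m\<^sup>2 * ((p - 1) / 2 * Z powr p + c) = (p - 1) * m\<^sup>2 * Z powr p - (p - 1) / 2 * (m\<^sup>2 * Z powr p) + m\<^sup>2 * c"
        by (simp add: field_simps)
      moreover have "m\<^sup>2 * c \<le> 1 * c" using m c0 by (intro mult_right_mono) (auto simp: power_le_one)
      ultimately have "J x \<le> c - (p - 1) / 2 * (m\<^sup>2 * Z powr p)" using J1 by linarith
      moreover have "energy_density \<eta> q x = m\<^sup>2 * Z powr p"
        by (simp add: energy_density_def m_def Z_def t_def mult.commute)
      ultimately show ?thesis using xA by simp
    qed
    have "local_energy p \<Omega> g Gv = (\<integral>x. J x \<partial>lborel)"
    proof -
      have "local_energy p \<Omega> g Gv = (\<integral>x. J x \<partial>lebesgue)" unfolding local_energy_def set_lebesgue_integral_def J_def ..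
      also have "\<dots> = (\<integral>x. J x \<partial>lborel)" by (rule integral_completion[OF Jm])
      finally show ?thesis .
    qed
    also have "\<dots> \<le> (\<integral>x. c * indicator A x - (p - 1) / 2 * energy_density \<eta> q x \<partial>lborel)"
      using Jint Eint Am Afin pt by (intro integral_mono Bochner_Integration.integrable_diff integrable_mult_right integrable_real_indicator) auto
    also have "\<dots> = c * measure lborel A - (p - 1) / 2 * (\<integral>x. energy_density \<eta> q x \<partial>lborel)"
      using Eint Am Afin by (subst Bochner_Integration.integral_diff) (auto intro!: integrable_mult_right integrable_real_indicator)
    finally show "local_energy p \<Omega> g Gv \<le> p * ((p - 1) / (2 * p)) powr (1 - p) * L powr p * measure lborel A - (p - 1) / 2 * (\<integral>x. energy_density \<eta> q x \<partial>lborel)"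
      by (simp add: c_def)
  qed
  ultimately have fin: "0 \<le> nonlocal_const p * 2 * (kc * measure \<mu> (space \<mu>) + 4 powr (real DIM('a) + p)) * L powr p * measure lborel A
     + measure \<mu> {1} * (p * ((p - 1) / (2 * p)) powr (1 - p) * L powr p * measure lborel A - (p - 1) / 2 * (\<integral>x. energy_density \<eta> q x \<partial>lborel))"
    using mult_left_mono[of "local_energy p \<Omega> g Gv" _ "measure \<mu> {1}"] by (smt (verit) measure_nonneg)
  have "(\<integral>x. energy_density \<eta> q x \<partial>lborel) \<le> K * L powr p * measure lborel A"
  proof -
    define a where "a = measure \<mu> {1} * (p - 1)"
    have a: "0 < a" using \<alpha> p by (simp add: a_def)
    let ?X = "nonlocal_const p * 2 * (kc * measure \<mu> (space \<mu>) + 4 powr (real DIM('a) + p)) + measure \<mu> {1} * (p * ((p - 1) / (2 * p)) powr (1 - p))"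
    have "a / 2 * (\<integral>x. energy_density \<eta> q x \<partial>lborel) \<le> ?X * (L powr p * measure lborel A)"
      using fin unfolding a_def by (simp add: algebra_simps)
    then have "(\<integral>x. energy_density \<eta> q x \<partial>lborel) \<le> 2 / a * (?X * (L powr p * measure lborel A))"
      using a by (simp add: field_simps)
    also have "2 / a * (?X * (L powr p * measure lborel A)) = K * L powr p * measure lborel A"
      by (simp only: K_def cacc_const_def a_def mult.assoc)
    finally show ?thesis .
  qed
  moreover have "(\<integral>\<^sup>+x. ennreal (energy_density \<eta> q x) \<partial>lborel) = ennreal (\<integral>x. energy_density \<eta> q x \<partial>lborel)"
    by (rule nn_integral_eq_integral[OF Eint]) (simp add: energy_density_def)
  ultimately show ?thesis by (simp add: ennreal_leI)
qed

end

section \<open>The logarithmic estimate and the De Giorgi step\<close>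

text \<open>
  The cutoff is \<open>(1 - s\<^sup>2)\<^sup>2\<close> between the radii, where \<open>s\<close> is the affine function of \<open>norm (x -
  x0)\<^sup>2\<close> that equals \<open>0\<close> on the inner and \<open>1\<close> on the outer sphere. Both squares make the
  transitions \<open>C\<^sup>1\<close>. The slope is at most \<open>8 * \<rho>2 / (\<rho>2\<^sup>2 - \<rho>1\<^sup>2)\<close>.
\<close>

lemma smooth_cutoff_exists:
  fixes x0 :: "'a::euclidean_space"
  assumes \<rho>: "0 < \<rho>1" "\<rho>1 < \<rho>2"
  obtains \<eta> D\<eta> where "smooth_cutoff x0 \<rho>2 (8 / (\<rho>2 - \<rho>1)) \<eta> D\<eta>" "\<And>x. x \<in> cball x0 \<rho>1 \<Longrightarrow> \<eta> x = 1"
    "\<And>x. x \<in> cball x0 \<rho>1 \<Longrightarrow> D\<eta> x = 0"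
proof -
  define Q where "Q = \<rho>2\<^sup>2 - \<rho>1\<^sup>2"
  have Q: "0 < Q" "Q = (\<rho>2 - \<rho>1) * (\<rho>2 + \<rho>1)"
    using \<rho> power_strict_mono[of \<rho>1 \<rho>2 2] by (auto simp: Q_def power2_eq_square algebra_simps)
  define s where "s x = ((x - x0) \<bullet> (x - x0) - \<rho>1\<^sup>2) / Q" for x
  define \<eta> where "\<eta> x = (max 0 (1 - (max 0 (s x))\<^sup>2))\<^sup>2" for x
  define c where "c x = - (8 * max 0 (1 - (max 0 (s x))\<^sup>2) * max 0 (s x)) / Q" for x
  define D\<eta> where "D\<eta> x = c x *\<^sub>R (x - x0)" for x
  have sn: "s x = ((norm (x - x0))\<^sup>2 - \<rho>1\<^sup>2) / Q" for x by (simp add: s_def power2_norm_eq_inner)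
  have s1: "1 \<le> s x" if "\<rho>2 \<le> norm (x - x0)" for x
  proof -
    have "\<rho>2\<^sup>2 \<le> (norm (x - x0))\<^sup>2" using that \<rho> by (intro power_mono) auto
    then show ?thesis using Q(1) by (simp add: sn Q_def)
  qed
  have s0: "s x \<le> 0" if "norm (x - x0) \<le> \<rho>1" for x
  proof -
    have "(norm (x - x0))\<^sup>2 \<le> \<rho>1\<^sup>2" using that by (intro power_mono) auto
    then show ?thesis using Q(1) by (simp add: sn divide_nonpos_pos)
  qed
  note P' = has_real_derivative_max_power[of 2, simplified]
  have d: "(\<eta> has_derivative (\<lambda>h. D\<eta> x \<bullet> h)) (at x)" for x
  proof -
    have "(s has_derivative (\<lambda>h. 2 * ((x - x0) \<bullet> h) / Q)) (at x)"
      unfolding s_def using Q(1) by (auto intro!: derivative_eq_intros simp: inner_commute)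
    then have "((\<lambda>x. (max 0 (s x))\<^sup>2) has_derivative (\<lambda>h. (2 * max 0 (s x)) * (2 * ((x - x0) \<bullet> h) / Q))) (at x)"
      by (rule has_derivative_compose[OF _ has_field_derivative_imp_has_derivative[OF P']])
    then have "((\<lambda>x. 1 - (max 0 (s x))\<^sup>2) has_derivative (\<lambda>h. 0 - (2 * max 0 (s x)) * (2 * ((x - x0) \<bullet> h) / Q))) (at x)"
      by (rule has_derivative_diff[OF has_derivative_const])
    then have "(\<eta> has_derivative (\<lambda>h. (2 * max 0 (1 - (max 0 (s x))\<^sup>2)) * (0 - (2 * max 0 (s x)) * (2 * ((x - x0) \<bullet> h) / Q)))) (at x)"
      unfolding \<eta>_def[abs_def] by (rule has_derivative_compose[OF _ has_field_derivative_imp_has_derivative[OF P']])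
    moreover have "(\<lambda>h. (2 * max 0 (1 - (max 0 (s x))\<^sup>2)) * (0 - (2 * max 0 (s x)) * (2 * ((x - x0) \<bullet> h) / Q))) = (\<lambda>h. D\<eta> x \<bullet> h)"
      by (simp add: D\<eta>_def c_def fun_eq_iff)
    ultimately show ?thesis by simp
  qed
  have sc: "continuous_on UNIV s" unfolding s_def by (intro continuous_intros) (use Q in auto)
  have cont: "continuous_on UNIV D\<eta>"
    unfolding D\<eta>_def c_def using Q by (intro continuous_intros sc) auto
  have one: "max 0 (1 - (max 0 (s x))\<^sup>2) \<le> 1" "0 \<le> max 0 (1 - (max 0 (s x))\<^sup>2)" for x by auto
  have supp: "\<eta> x = 0 \<and> D\<eta> x = 0" if "\<rho>2 \<le> norm (x - x0)" for x
  proof -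
    have "1 \<le> (max 0 (s x))\<^sup>2" using s1[OF that] by (simp add: one_le_power)
    then show ?thesis by (simp add: \<eta>_def D\<eta>_def c_def)
  qed
  have bd: "norm (D\<eta> x) \<le> 8 / (\<rho>2 - \<rho>1)" for x
  proof (cases "(max 0 (s x))\<^sup>2 < 1 \<and> norm (x - x0) < \<rho>2")
    case True
    then have "max 0 (s x) \<le> 1" using power_le_one_iff[of "max 0 (s x)" 2] by simp
    then have "max 0 (1 - (max 0 (s x))\<^sup>2) * max 0 (s x) \<le> 1 * 1" using one by (intro mult_mono) auto
    then have "\<bar>c x\<bar> \<le> 8 / Q" using Q(1) one(2)[of x] by (simp add: c_def abs_mult mult.assoc divide_right_mono)
    then have "norm (D\<eta> x) \<le> 8 / Q * \<rho>2" unfolding D\<eta>_def norm_scaleR using True Q by (intro mult_mono) auto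
    also have "\<dots> \<le> 8 / Q * (\<rho>2 + \<rho>1)" using \<rho> Q by (intro mult_left_mono) auto
    also have "\<dots> = 8 / (\<rho>2 - \<rho>1)"
    proof -
      have cancel: "8 / (a * b) * b = 8 / a" if "b \<noteq> 0" for a b :: real using that by simp
      have "\<rho>2 + \<rho>1 \<noteq> 0" using \<rho> by linarith
      then show ?thesis unfolding Q(2) by (rule cancel)
    qed
    finally show ?thesis .
  next
    case False
    then have "D\<eta> x = 0" using supp[of x] by (auto simp: D\<eta>_def c_def not_less)
    then show ?thesis using \<rho> by simp
  qed
  have in1: "\<eta> x = 1 \<and> D\<eta> x = 0" if "x \<in> cball x0 \<rho>1" for x
  proof -
    have "s x \<le> 0" using that by (intro s0) (simp add: dist_norm norm_minus_commute)
    then show ?thesis by (simp add: \<eta>_def D\<eta>_def c_def)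
  qed
  have "smooth_cutoff x0 \<rho>2 (8 / (\<rho>2 - \<rho>1)) \<eta> D\<eta>"
  proof
    show "\<eta> x \<le> 1" for x unfolding \<eta>_def using one[of x] by (intro power_le_one) auto
    show "\<eta> x = 0" if "x \<notin> ball x0 \<rho>2" for x
      using supp[of x] that by (simp add: dist_norm norm_minus_commute)
  qed (use d cont bd in \<open>auto simp: \<eta>_def\<close>)
  then show thesis using in1 that by blast
qed

text \<open>
  A Faber-Krahn type inequality: a function with small support is small compared with its
  gradient, which enters through \<open>tr\<close>. The ball of radius \<open>\<rho>\<close> has twice the measure of \<open>A\<close>, so for
  every \<open>x\<close> a set of at least \<open>m\<close> vectors \<open>h\<close> in it leads to points \<open>x + h\<close> outside \<open>A\<close>, where \<open>V\<close>
  vanishes. Hence \<open>m * \<bar>V x\<bar>\<close> is at most the integral of \<open>\<bar>V (x + h) - V x\<bar>\<close> over the ball.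
\<close>

lemma faber_krahn_translation:
  fixes V :: "'a::euclidean_space \<Rightarrow> real" and \<Gamma> :: ennreal
  assumes [measurable]: "V \<in> borel_measurable borel" "A \<in> sets borel"
    and m: "emeasure lborel A = ennreal m" "0 < m" and supp: "\<And>x. x \<notin> A \<Longrightarrow> V x = 0"
    and tr: "\<And>h. (\<integral>\<^sup>+x. ennreal \<bar>V (x + h) - V x\<bar> \<partial>lborel) \<le> ennreal (norm h) * \<Gamma>"
    and \<rho>: "0 < \<rho>" "measure lborel (ball (0::'a) \<rho>) = 2 * m"
  shows "(\<integral>\<^sup>+x. ennreal \<bar>V x\<bar> \<partial>lborel) \<le> ennreal (2 * \<rho>) * \<Gamma>"
proof -
  have bm: "emeasure lborel (ball (0::'a) \<rho>) = ennreal (2 * m)"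
    using \<rho>(2) emeasure_lborel_ball_finite[of "0::'a" \<rho>] by (simp add: emeasure_eq_ennreal_measure less_top)
  have Bm[measurable]: "ball (0::'a) \<rho> \<in> sets borel" by simp
  have shifted: "ennreal m \<le> (\<integral>\<^sup>+h. indicator (ball 0 \<rho>) h * indicator (- A) (x + h) \<partial>lborel)" for x
  proof -
    have "ennreal (2 * m) = (\<integral>\<^sup>+h. indicator (ball 0 \<rho>) h \<partial>(lborel :: 'a measure))" using bm by simp
    also have "\<dots> \<le> (\<integral>\<^sup>+h. indicator (ball 0 \<rho>) h * indicator (- A) (x + h) + indicator A (h + x) \<partial>lborel)"
      by (intro nn_integral_mono) (auto simp: indicator_def add.commute)
    also have "\<dots> = (\<integral>\<^sup>+h. indicator (ball 0 \<rho>) h * indicator (- A) (x + h) \<partial>lborel) + (\<integral>\<^sup>+h. indicator A (h + x) \<partial>lborel)"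
      by (rule nn_integral_add) measurable
    also have "(\<integral>\<^sup>+h. indicator A (h + x) \<partial>lborel) = ennreal m"
      using nn_integral_shift[of "indicator A" x] m(1) by simp
    finally have "ennreal m + ennreal m \<le> ennreal m + (\<integral>\<^sup>+h. indicator (ball 0 \<rho>) h * indicator (- A) (x + h) \<partial>lborel)"
      using m(2) by (simp add: ennreal_plus[symmetric] add.commute del: ennreal_plus)
    then show ?thesis by (simp only: ennreal_add_left_cancel_le) simp
  qed
  have "ennreal m * (\<integral>\<^sup>+x. ennreal \<bar>V x\<bar> \<partial>lborel) = (\<integral>\<^sup>+x. ennreal \<bar>V x\<bar> * ennreal m \<partial>lborel)"
    by (subst mult.commute, rule nn_integral_multc[symmetric]) measurable
  also have "\<dots> \<le> (\<integral>\<^sup>+x. ennreal \<bar>V x\<bar> * (\<integral>\<^sup>+h. indicator (ball 0 \<rho>) h * indicator (- A) (x + h) \<partial>lborel) \<partial>lborel)"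
    by (intro nn_integral_mono mult_left_mono shifted) auto
  also have "\<dots> = (\<integral>\<^sup>+x. \<integral>\<^sup>+h. ennreal \<bar>V x\<bar> * (indicator (ball 0 \<rho>) h * indicator (- A) (x + h)) \<partial>lborel \<partial>lborel)"
    by (intro nn_integral_cong nn_integral_cmult[symmetric]) measurable
  also have "\<dots> \<le> (\<integral>\<^sup>+x. \<integral>\<^sup>+h. ennreal \<bar>V (x + h) - V x\<bar> * indicator (ball 0 \<rho>) h \<partial>lborel \<partial>lborel)"
    using supp by (intro nn_integral_mono) (auto simp: indicator_def)
  also have "\<dots> = (\<integral>\<^sup>+h. \<integral>\<^sup>+x. ennreal \<bar>V (x + h) - V x\<bar> * indicator (ball 0 \<rho>) h \<partial>lborel \<partial>lborel)"
    by (rule lborel_pair.Fubini'[symmetric]) measurable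
  also have "\<dots> \<le> (\<integral>\<^sup>+h. (ennreal \<rho> * \<Gamma>) * indicator (ball (0::'a) \<rho>) h \<partial>lborel)"
  proof (rule nn_integral_mono)
    fix h :: 'a
    have "(\<integral>\<^sup>+x. ennreal \<bar>V (x + h) - V x\<bar> * indicator (ball 0 \<rho>) h \<partial>lborel)
      = (\<integral>\<^sup>+x. ennreal \<bar>V (x + h) - V x\<bar> \<partial>lborel) * indicator (ball 0 \<rho>) h"
      by (rule nn_integral_multc) measurable
    also have "\<dots> \<le> (ennreal (norm h) * \<Gamma>) * indicator (ball 0 \<rho>) h" by (intro mult_right_mono tr) simp
    also have "\<dots> \<le> (ennreal \<rho> * \<Gamma>) * indicator (ball 0 \<rho>) h"
      by (cases "h \<in> ball 0 \<rho>") (auto intro!: mult_right_mono ennreal_leI)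
    finally show "(\<integral>\<^sup>+x. ennreal \<bar>V (x + h) - V x\<bar> * indicator (ball 0 \<rho>) h \<partial>lborel) \<le> (ennreal \<rho> * \<Gamma>) * indicator (ball 0 \<rho>) h" .
  qed
  also have "\<dots> = (ennreal \<rho> * \<Gamma>) * ennreal (2 * m)" using bm by (subst nn_integral_cmult_indicator) auto
  also have "\<dots> = ennreal m * (ennreal (2 * \<rho>) * \<Gamma>)"
  proof -
    have "ennreal \<rho> * ennreal (2 * m) = ennreal m * ennreal (2 * \<rho>)" using m(2) \<rho>(1) by (simp add: ennreal_mult[symmetric] mult_ac)
    then show ?thesis by (metis mult.assoc mult.commute)
  qed
  finally have "ennreal m * (\<integral>\<^sup>+x. ennreal \<bar>V x\<bar> \<partial>lborel) \<le> ennreal m * (ennreal (2 * \<rho>) * \<Gamma>)" .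
  then show ?thesis using m(2) by (simp add: ennreal_mult_le_mult_iff)
qed

text \<open>
  It converts the \<open>L\<^sup>p\<close> bound of the Caccioppoli inequality into an \<open>L\<^sup>1\<close> bound of the right
  scaling.
\<close>

lemma le_powr_plus:
  fixes Z L p :: real
  assumes "1 < p" "0 \<le> Z" "0 < L"
  shows "Z \<le> L powr (1 - p) * Z powr p + L"
proof (cases "Z \<le> L")
  case True
  then show ?thesis using assms by (simp add: add_increasing)
next
  case False
  then have Z: "0 < Z" using assms by simp
  have "Z powr (1 - p) \<le> L powr (1 - p)" using False assms by (intro powr_mono2') auto
  then have "Z powr (1 - p) * Z powr p \<le> L powr (1 - p) * Z powr p" by (rule mult_right_mono) simp
  moreover have "Z powr (1 - p) * Z powr p = Z" using Z by (simp add: powr_add[symmetric])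
  ultimately show ?thesis using assms by linarith
qed

context supersolution_near
begin

lemma K0: "0 \<le> K" unfolding K_def by (rule cacc_const_nonneg[OF p kc(1)])

lemma ball_measure: "emeasure lborel (ball (c::'a) t) = ennreal (measure lborel (ball c t))"
  using emeasure_lborel_ball_finite[of c t] by (simp add: emeasure_eq_ennreal_measure less_top)

lemma level_set_measure:
  assumes "S \<subseteq> ball x0 t" "S \<in> sets borel"
  shows "emeasure lborel S = ennreal (measure lborel S)"
proof -
  have "emeasure lborel S \<le> emeasure lborel (ball x0 t)" using assms by (intro emeasure_mono) auto
  also have "\<dots> < \<infinity>" using emeasure_lborel_ball_finite[of x0 t] by simp
  finally show ?thesis by (simp add: emeasure_eq_ennreal_measure less_top)
qed

text \<open>
  The Caccioppoli inequality with \<open>q = 0\<close> says that the gradient of \<open>ln (w + d)\<close> has size \<open>1 / r\<close>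
  on average, with a constant that depends neither on \<open>d\<close> nor on the solution.
\<close>

lemma log_gradient_bound:
  obtains V G where "is_weak_gradient UNIV V G" "integrable lborel V" "integrable lborel G"
    "\<And>x. x \<in> ball x0 (11 * r) \<Longrightarrow> V x = ln (w x + d)"
    "(\<integral>\<^sup>+x. ennreal (norm (G x)) * indicator (ball x0 (11 * r)) x \<partial>lborel) \<le> ennreal ((K + 1) * (8 / r) * measure lborel (ball x0 (12 * r)))"
proof -
  obtain \<eta> D\<eta> where cut: "smooth_cutoff x0 (12 * r) (8 / (12 * r - 11 * r)) \<eta> D\<eta>"
    and one: "\<And>x. x \<in> cball x0 (11 * r) \<Longrightarrow> \<eta> x = 1" "\<And>x. x \<in> cball x0 (11 * r) \<Longrightarrow> D\<eta> x = 0"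
    using smooth_cutoff_exists[of "11 * r" "12 * r" x0] r(1) by auto
  define L where "L = 8 / r"
  have L: "8 / (12 * r - 11 * r) = L" "0 < L" "1 / r \<le> L" using r by (auto simp: L_def divide_right_mono)
  note cut' = cut[unfolded L(1)]
  interpret smooth_cutoff x0 "12 * r" L \<eta> D\<eta> by (rule cut')
  define F where "F t = ln (t + d)" for t
  define F' where "F' t = 1 / (t + d)" for t
  have [measurable]: "F \<in> borel_measurable borel" "F' \<in> borel_measurable borel"
    unfolding F_def[abs_def] F'_def[abs_def] by measurable
  have F1: "(F has_real_derivative F' t) (at t)" if "0 \<le> t" for t
    unfolding F_def F'_def using that d by (auto intro!: derivative_eq_intros)
  have F2: "continuous_on {0..} F'" unfolding F'_def using d by (intro continuous_intros) auto
  have F3: "\<bar>F' t\<bar> \<le> 1 / d" if "0 \<le> t" for t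
    unfolding F'_def using that d by (simp add: frac_le)
  define V where "V x = \<eta> x * F (w x)" for x
  define G where "G x = F (w x) *\<^sub>R D\<eta> x + (\<eta> x * F' (w x)) *\<^sub>R g x" for x
  note ch = chain[OF deriv cont supp' order_refl F1 F2 F3 \<open>F \<in> borel_measurable borel\<close> \<open>F' \<in> borel_measurable borel\<close>]
  have Vwg: "is_weak_gradient UNIV V G" unfolding V_def[abs_def] G_def[abs_def] by (rule ch(1))
  have Vint: "integrable lborel V" unfolding V_def[abs_def] by (rule ch(2))
  have Gint: "integrable lborel G" unfolding G_def[abs_def] by (rule ch(3))
  have Veq: "V x = ln (w x + d)" if "x \<in> ball x0 (11 * r)" for x
    using that one(1)[of x] by (simp add: V_def F_def)
  have Em: "energy_density \<eta> 0 \<in> borel_measurable borel"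
    unfolding energy_density_def[abs_def] by measurable
  let ?T = "ball x0 (11 * r)" and ?B = "ball x0 (12 * r)"
  have pt: "ennreal (norm (G x)) * indicator ?T x \<le> ennreal (L powr (1 - p)) * ennreal (energy_density \<eta> 0 x) + ennreal L * indicator ?T x" for x
  proof (cases "x \<in> ?T")
    case True
    then have xc: "x \<in> cball x0 (11 * r)" by simp
    have "x \<in> ball x0 R" using True r by auto
    then have s: "0 < w x + d" using w0[of x] d by linarith
    have "norm (G x) = \<eta> x * norm (g x) / (w x + d)"
      using one[OF xc] s by (simp add: G_def F'_def)
    also have "\<dots> \<le> L powr (1 - p) * (\<eta> x * norm (g x) / (w x + d)) powr p + L"
      using range(1)[of x] s by (intro le_powr_plus p L(2)) auto
    also have "(\<eta> x * norm (g x) / (w x + d)) powr p = energy_density \<eta> 0 x" by (simp add: energy_density_def)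
    finally have "ennreal (norm (G x)) \<le> ennreal (L powr (1 - p) * energy_density \<eta> 0 x + L)" by (rule ennreal_leI)
    also have "\<dots> = ennreal (L powr (1 - p)) * ennreal (energy_density \<eta> 0 x) + ennreal L"
      using L(2) by (subst ennreal_plus) (auto simp: energy_density_def ennreal_mult)
    finally show ?thesis using True by simp
  qed simp
  have "(\<integral>\<^sup>+x. ennreal (norm (G x)) * indicator ?T x \<partial>lborel)
     \<le> (\<integral>\<^sup>+x. ennreal (L powr (1 - p)) * ennreal (energy_density \<eta> 0 x) + ennreal L * indicator ?T x \<partial>lborel)"
    by (intro nn_integral_mono pt)
  also have "\<dots> = (\<integral>\<^sup>+x. ennreal (L powr (1 - p)) * ennreal (energy_density \<eta> 0 x) \<partial>lborel) + (\<integral>\<^sup>+x. ennreal L * indicator ?T x \<partial>lborel)"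
    using Em by (intro nn_integral_add borel_measurable_times_ennreal borel_measurable_indicator) auto
  also have "(\<integral>\<^sup>+x. ennreal (L powr (1 - p)) * ennreal (energy_density \<eta> 0 x) \<partial>lborel) = ennreal (L powr (1 - p)) * (\<integral>\<^sup>+x. ennreal (energy_density \<eta> 0 x) \<partial>lborel)"
    using Em by (intro nn_integral_cmult) auto
  also have "(\<integral>\<^sup>+x. ennreal L * indicator ?T x \<partial>lborel) = ennreal L * emeasure lborel ?T"
    by (rule nn_integral_cmult_indicator) simp
  also have "ennreal (L powr (1 - p)) * (\<integral>\<^sup>+x. ennreal (energy_density \<eta> 0 x) \<partial>lborel) + ennreal L * emeasure lborel ?T
      \<le> ennreal (L powr (1 - p)) * ennreal (K * L powr p * measure lborel ?B) + ennreal L * ennreal (measure lborel ?B)"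
  proof (intro add_mono mult_left_mono)
    have "{x \<in> ?B. 0 * (w x + d) < 1} = ?B" by auto
    then show "(\<integral>\<^sup>+x. ennreal (energy_density \<eta> 0 x) \<partial>lborel) \<le> ennreal (K * L powr p * measure lborel ?B)"
      using caccioppoli[OF cut' order_refl L(3), of 0] by simp
    have "emeasure lborel ?T \<le> emeasure lborel ?B" using r by (intro emeasure_mono subset_ball) auto
    then show "emeasure lborel ?T \<le> ennreal (measure lborel ?B)" by (simp only: ball_measure)
  qed auto
  also have "\<dots> = ennreal (L powr (1 - p) * (K * L powr p * measure lborel ?B) + L * measure lborel ?B)"
    using K0 L(2) by (subst ennreal_plus) (auto simp: ennreal_mult[symmetric])
  also have "L powr (1 - p) * (K * L powr p * measure lborel ?B) + L * measure lborel ?B = (K + 1) * (8 / r) * measure lborel ?B"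
  proof -
    have "L powr (1 - p) * L powr p = L" using L(2) by (simp add: powr_add[symmetric])
    then have "L powr (1 - p) * (K * L powr p * measure lborel ?B) = L * K * measure lborel ?B" by (metis mult.assoc mult.left_commute)
    then show ?thesis unfolding L_def[symmetric] by (simp add: algebra_simps)
  qed
  finally show thesis using that[OF Vwg Vint Gint Veq] by blast
qed

text \<open>
  For \<open>x\<close> with \<open>w x + d < 4 * d\<close> and \<open>z\<close> with \<open>w z \<ge> \<zeta>\<close> the values of \<open>ln (w + d)\<close> differ by at
  least \<open>M\<close>. Integrating over all these pairs, with \<open>z = x + h\<close>, and using the translation
  estimate bounds the product of the measures of the two sets by a multiple of \<open>1 / M\<close>; the second
  of them is at least \<open>\<sigma>\<close> times the measure of the ball. As \<open>x\<close> ranges over the ball of radius \<open>5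
  * r\<close> and \<open>z\<close> over that of radius \<open>r\<close>, the vectors \<open>h\<close> have length below \<open>6 * r\<close>, and the
  segments stay in the ball of radius \<open>11 * r\<close>. The constants are \<open>48 = 6 * 8\<close>, with \<open>8\<close> from the
  slope of the cutoff, and \<open>72 = 6 * 12\<close>, from the volumes.
\<close>

lemma log_step:
  assumes dens: "\<sigma> * measure lborel (ball x0 r) \<le> measure lborel ({x. \<zeta> \<le> w x} \<inter> ball x0 r)"
    and M: "0 < M" "4 * d * exp M \<le> \<zeta> + d" and \<sigma>: "0 < \<sigma>"
  shows "M * \<sigma> * measure lborel {x \<in> ball x0 (5 * r). w x + d < 4 * d} \<le> 48 * (K + 1) * 72 ^ DIM('a) * measure lborel (ball x0 r)"
proof -
  obtain V G where V: "is_weak_gradient UNIV V G" "integrable lborel V" "integrable lborel G"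
    "\<And>x. x \<in> ball x0 (11 * r) \<Longrightarrow> V x = ln (w x + d)"
    and Gb: "(\<integral>\<^sup>+x. ennreal (norm (G x)) * indicator (ball x0 (11 * r)) x \<partial>lborel) \<le> ennreal ((K + 1) * (8 / r) * measure lborel (ball x0 (12 * r)))"
    by (rule log_gradient_bound) blast
  have [measurable]: "V \<in> borel_measurable borel" using borel_measurable_integrable[OF V(2)] by simp
  define S where "S = ball x0 (5 * r)"
  define B where "B = ball (0::'a) (6 * r)"
  define E where "E = {x. \<zeta> \<le> w x} \<inter> ball x0 r"
  define A where "A = {x \<in> S. w x + d < 4 * d}"
  have [measurable]: "S \<in> sets borel" "B \<in> sets borel" by (simp_all add: S_def B_def)
  have Em[measurable]: "E \<in> sets borel" and Am[measurable]: "A \<in> sets borel"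
    unfolding E_def A_def S_def by measurable
  define \<Gamma> where "\<Gamma> = (K + 1) * (8 / r) * measure lborel (ball x0 (12 * r))"
  have \<Gamma>0: "0 \<le> \<Gamma>" using K0 r by (simp add: \<Gamma>_def)
  have Ee: "emeasure lborel E = ennreal (measure lborel E)" by (rule level_set_measure[of _ r]) (auto simp: E_def)
  have Ae: "emeasure lborel A = ennreal (measure lborel A)" by (rule level_set_measure[of _ "5 * r"]) (auto simp: A_def S_def)
  have Be: "emeasure lborel B = ennreal (measure lborel B)" unfolding B_def by (rule ball_measure)
  have tr: "(\<integral>\<^sup>+x. ennreal \<bar>V (x + h) - V x\<bar> * indicator S x \<partial>lborel) \<le> ennreal (norm h) * ennreal \<Gamma>" if "h \<in> B" for h
  proof -
    have "(\<integral>\<^sup>+x. ennreal \<bar>V (x + h) - V x\<bar> * indicator S x \<partial>lborel)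
      \<le> ennreal (norm h) * (\<integral>\<^sup>+x. ennreal (norm (G x)) * indicator (ball x0 (11 * r)) x \<partial>lborel)"
    proof (rule weak_translation_bound[OF V(1-3)])
      fix x t assume x: "x \<in> S" and t: "0 \<le> t" "t \<le> (1::real)"
      have "norm (t *\<^sub>R h) \<le> 1 * norm h" unfolding norm_scaleR using t by (intro mult_right_mono) auto
      then have "norm (t *\<^sub>R h) < 6 * r" using that by (simp add: B_def)
      moreover have "dist x0 (x + t *\<^sub>R h) \<le> dist x0 x + norm (t *\<^sub>R h)"
        using dist_triangle[of x0 "x + t *\<^sub>R h" x] by (simp add: dist_norm)
      ultimately show "x + t *\<^sub>R h \<in> ball x0 (11 * r)" using x by (simp add: S_def)
    qed auto
    also have "\<dots> \<le> ennreal (norm h) * ennreal \<Gamma>" using Gb unfolding \<Gamma>_def by (intro mult_left_mono) auto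
    finally show ?thesis .
  qed
  have "ennreal (M * measure lborel E * measure lborel A) = (\<integral>\<^sup>+x. ennreal (M * measure lborel E) * indicator A x \<partial>lborel)"
    using M(1) Ae by (subst nn_integral_cmult_indicator) (auto simp: ennreal_mult)
  also have "\<dots> \<le> (\<integral>\<^sup>+x. \<integral>\<^sup>+h. ennreal \<bar>V (x + h) - V x\<bar> * indicator S x * indicator B h \<partial>lborel \<partial>lborel)"
  proof (rule nn_integral_mono)
    fix x
    show "ennreal (M * measure lborel E) * indicator A x \<le> (\<integral>\<^sup>+h. ennreal \<bar>V (x + h) - V x\<bar> * indicator S x * indicator B h \<partial>lborel)"
    proof (cases "x \<in> A")
      case True
      have "ennreal (M * measure lborel E) = (\<integral>\<^sup>+h. ennreal M * indicator E (h + x) \<partial>lborel)"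
        using nn_integral_shift[of "\<lambda>h. ennreal M * indicator E h" x] Ee M(1)
        by (simp add: nn_integral_cmult_indicator ennreal_mult)
      also have "\<dots> \<le> (\<integral>\<^sup>+h. ennreal \<bar>V (x + h) - V x\<bar> * indicator S x * indicator B h \<partial>lborel)"
      proof (rule nn_integral_mono)
        fix h
        show "ennreal M * indicator E (h + x) \<le> ennreal \<bar>V (x + h) - V x\<bar> * indicator S x * indicator B h"
        proof (cases "h + x \<in> E")
          case hE: True
          have xS: "x \<in> S" "w x + d < 4 * d" using True by (auto simp: A_def)
          have z: "x + h \<in> ball x0 r" "\<zeta> \<le> w (x + h)" using hE by (auto simp: E_def add.commute)
          have "norm h = dist (x + h) x" by (simp add: dist_norm)
          also have "\<dots> \<le> dist x0 (x + h) + dist x0 x" using dist_triangle[of "x + h" x x0] by (simp add: dist_commute)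
          finally have "h \<in> B" using z(1) xS(1) by (simp add: B_def S_def)
          moreover have "M \<le> \<bar>V (x + h) - V x\<bar>"
          proof -
            have x11: "x \<in> ball x0 (11 * r)" "x + h \<in> ball x0 (11 * r)" using xS(1) z(1) r(1) by (auto simp: S_def)
            then have "x \<in> ball x0 R" using r by auto
            then have wx: "0 < w x + d" using w0[of x] d by linarith
            have "(w x + d) * exp M \<le> 4 * d * exp M" using xS(2) by (intro mult_right_mono) auto
            also have "\<dots> \<le> w (x + h) + d" using M(2) z(2) by linarith
            finally have le: "(w x + d) * exp M \<le> w (x + h) + d" .
            have "ln (w x + d) + M = ln ((w x + d) * exp M)" using wx by (simp add: ln_mult)
            also have "\<dots> \<le> ln (w (x + h) + d)" using le wx by (intro ln_mono) auto
            finally show ?thesis using V(4)[OF x11(1)] V(4)[OF x11(2)] by linarith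
          qed
          ultimately show ?thesis using xS(1) hE by (simp add: ennreal_leI)
        qed simp
      qed
      finally show ?thesis using True by simp
    qed simp
  qed
  also have "\<dots> = (\<integral>\<^sup>+h. \<integral>\<^sup>+x. ennreal \<bar>V (x + h) - V x\<bar> * indicator S x * indicator B h \<partial>lborel \<partial>lborel)"
    by (rule lborel_pair.Fubini'[symmetric]) measurable
  also have "\<dots> \<le> (\<integral>\<^sup>+h. ennreal (6 * r * \<Gamma>) * indicator B h \<partial>lborel)"
  proof (rule nn_integral_mono)
    fix h
    have "(\<integral>\<^sup>+x. ennreal \<bar>V (x + h) - V x\<bar> * indicator S x * indicator B h \<partial>lborel)
       = (\<integral>\<^sup>+x. ennreal \<bar>V (x + h) - V x\<bar> * indicator S x \<partial>lborel) * indicator B h"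
      by (rule nn_integral_multc) measurable
    also have "\<dots> \<le> ennreal (6 * r * \<Gamma>) * indicator B h"
    proof (cases "h \<in> B")
      case True
      have "ennreal (norm h) * ennreal \<Gamma> \<le> ennreal (6 * r * \<Gamma>)"
        using True \<Gamma>0 by (auto simp: B_def ennreal_mult[symmetric] intro!: ennreal_leI mult_right_mono)
      then show ?thesis using tr[OF True] True by (auto intro: order_trans)
    qed simp
    finally show "(\<integral>\<^sup>+x. ennreal \<bar>V (x + h) - V x\<bar> * indicator S x * indicator B h \<partial>lborel) \<le> ennreal (6 * r * \<Gamma>) * indicator B h" .
  qed
  also have "\<dots> = ennreal (6 * r * \<Gamma> * measure lborel B)"
    using Be \<Gamma>0 r by (subst nn_integral_cmult_indicator) (auto simp: ennreal_mult)
  finally have "M * measure lborel E * measure lborel A \<le> 6 * r * \<Gamma> * measure lborel B"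
    using \<Gamma>0 r by (subst (asm) ennreal_le_iff) auto
  moreover have "M * (\<sigma> * measure lborel (ball x0 r)) * measure lborel A \<le> M * measure lborel E * measure lborel A"
    using dens M(1) unfolding E_def by (intro mult_right_mono mult_left_mono) auto
  ultimately have 1: "M * (\<sigma> * measure lborel (ball x0 r)) * measure lborel A \<le> 6 * r * \<Gamma> * measure lborel B" by linarith
  have b: "measure lborel B = 6 ^ DIM('a) * measure lborel (ball x0 r)"
    "measure lborel (ball x0 (12 * r)) = 12 ^ DIM('a) * measure lborel (ball x0 r)"
    using r(1) by (simp_all add: B_def content_ball power_mult_distrib)
  have br: "0 < measure lborel (ball x0 r)" using r(1) by (rule content_ball_gt_0_iff[THEN iffD2])
  have "6 * r * \<Gamma> * measure lborel B = (48 * (K + 1) * 72 ^ DIM('a) * measure lborel (ball x0 r)) * measure lborel (ball x0 r)"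
    unfolding \<Gamma>_def b using r(1) power_mult_distrib[of "6::real" 12 "DIM('a)"] by (simp add: mult_ac)
  then have "(M * \<sigma> * measure lborel A) * measure lborel (ball x0 r) \<le> (48 * (K + 1) * 72 ^ DIM('a) * measure lborel (ball x0 r)) * measure lborel (ball x0 r)"
    using 1 by (simp add: mult_ac)
  then have "M * \<sigma> * measure lborel A \<le> 48 * (K + 1) * 72 ^ DIM('a) * measure lborel (ball x0 r)"
    using br by (rule mult_right_le_imp_le)
  then show ?thesis by (simp add: A_def S_def)
qed

text \<open>
  The Caccioppoli inequality with \<open>q = 1 / \<kappa>\<close> lives on the sublevel set \<open>A\<close> and bounds the
  gradient of \<open>V = \<eta> * (1 - q * (w + d))\<^sup>3\<close>, cut off at \<open>0\<close>: differentiating the cube leaves the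
  squared factor of the energy density, and \<open>q \<le> 1 / (w + d)\<close> on \<open>A\<close>. The Faber-Krahn inequality
  for \<open>V\<close>, supported in \<open>A\<close>, gains the factor \<open>|A|\<^bsup>1/N\<^esup>\<close>, while \<open>V \<ge> (1 - \<kappa>' / \<kappa>)\<^sup>3\<close> on \<open>A'\<close>.
\<close>

lemma de_giorgi_step:
  assumes \<rho>: "0 < \<rho>'" "\<rho>' < \<rho>" "\<rho> \<le> 5 * r" and \<kappa>: "0 < \<kappa>'" "\<kappa>' < \<kappa>"
  defines "A \<equiv> {x \<in> ball x0 \<rho>. w x + d < \<kappa>}" and "A' \<equiv> {x \<in> ball x0 \<rho>'. w x + d < \<kappa>'}"
  shows "(1 - \<kappa>' / \<kappa>) ^ 3 * measure lborel A' \<le>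
    2 * (2 * measure lborel A / unit_ball_vol (real DIM('a))) powr (1 / real DIM('a)) * ((3 * K + 4) * (8 / (\<rho> - \<rho>')) * measure lborel A)"
proof -
  define L where "L = 8 / (\<rho> - \<rho>')"
  obtain \<eta> D\<eta> where cut: "smooth_cutoff x0 \<rho> L \<eta> D\<eta>" and one: "\<And>x. x \<in> cball x0 \<rho>' \<Longrightarrow> \<eta> x = 1"
    unfolding L_def by (rule smooth_cutoff_exists[OF \<rho>(1,2), of x0]) blast
  interpret smooth_cutoff x0 \<rho> L \<eta> D\<eta> by (rule cut)
  have L: "0 < L" "1 / r \<le> L"
  proof -
    show "0 < L" using \<rho> by (simp add: L_def)
    have "1 / r = 8 / (8 * r)" by simp
    also have "\<dots> \<le> L" unfolding L_def using \<rho> r(1) by (intro divide_left_mono mult_pos_pos) auto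
    finally show "1 / r \<le> L" .
  qed
  define q where "q = 1 / \<kappa>"
  have q: "0 \<le> q" using \<kappa> by (simp add: q_def)
  have \<rho>12: "\<rho> \<le> 12 * r" using \<rho> r by simp
  have Aq: "{x \<in> ball x0 \<rho>. q * (w x + d) < 1} = A" using \<kappa> by (auto simp: A_def q_def field_simps)
  have Am[measurable]: "A \<in> sets borel" and A'm[measurable]: "A' \<in> sets borel" unfolding A_def A'_def by measurable
  define \<alpha> where "\<alpha> = measure lborel A"
  have Ae: "emeasure lborel A = ennreal \<alpha>" unfolding \<alpha>_def by (rule level_set_measure[of _ \<rho>]) (auto simp: A_def)
  have A'e: "emeasure lborel A' = ennreal (measure lborel A')" by (rule level_set_measure[of _ \<rho>']) (auto simp: A'_def)
  have A'A: "A' \<subseteq> A" using \<rho> \<kappa> by (auto simp: A_def A'_def)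
  show ?thesis
  proof (cases "\<alpha> = 0")
    case True
    have "emeasure lborel A' \<le> emeasure lborel A" using A'A by (intro emeasure_mono) auto
    then have "measure lborel A' = 0" using True by (simp add: Ae measure_def)
    then show ?thesis using True by (simp add: \<alpha>_def)
  next
    case False
    then have \<alpha>: "0 < \<alpha>" by (simp add: \<alpha>_def less_le)
    define F where "F t = (max 0 (1 - q * (t + d))) ^ 3" for t
    define F' where "F' t = (3 * (max 0 (1 - q * (t + d)))\<^sup>2) * (- q)" for t
    have Fm: "F \<in> borel_measurable borel" "F' \<in> borel_measurable borel"
      unfolding F_def[abs_def] F'_def[abs_def] by measurable
    have F1: "(F has_real_derivative F' t) (at t)" if "0 \<le> t" for t
      unfolding F_def F'_def
      by (rule DERIV_chain2[OF has_real_derivative_max_power[of 3, simplified]]) (auto intro!: derivative_eq_intros)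
    have F2: "continuous_on {0..} F'" unfolding F'_def by (intro continuous_intros)
    have F3: "\<bar>F' t\<bar> \<le> 3 * q" if "0 \<le> t" for t
    proof -
      have "(max 0 (1 - q * (t + d)))\<^sup>2 \<le> 1" using cutoff_slope_bounds[OF d q that] by (simp add: power_le_one)
      then have "3 * (max 0 (1 - q * (t + d)))\<^sup>2 * q \<le> 3 * 1 * q" using q by (intro mult_right_mono mult_left_mono) auto
      then show ?thesis using q by (simp add: F'_def abs_mult)
    qed
    define V where "V x = \<eta> x * F (w x)" for x
    define G where "G x = F (w x) *\<^sub>R D\<eta> x + (\<eta> x * F' (w x)) *\<^sub>R g x" for x
    note ch = chain[OF deriv cont supp' \<rho>12 F1 F2 F3 Fm]
    have Vwg: "is_weak_gradient UNIV V G" unfolding V_def[abs_def] G_def[abs_def] by (rule ch(1))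
    have Vint: "integrable lborel V" unfolding V_def[abs_def] by (rule ch(2))
    have Gint: "integrable lborel G" unfolding G_def[abs_def] by (rule ch(3))
    have Vm: "V \<in> borel_measurable borel" using borel_measurable_integrable[OF Vint] by simp
    have Em: "energy_density \<eta> q \<in> borel_measurable borel"
      unfolding energy_density_def[abs_def] by measurable
    have D0: "D\<eta> x = 0" if "\<eta> x = 0" for x
    proof -
      have "(\<lambda>h. D\<eta> x \<bullet> h) = (\<lambda>h. 0)"
        by (rule has_derivative_local_min[OF deriv]) (use range(1) that in auto)
      then have "D\<eta> x \<bullet> D\<eta> x = 0" by metis
      then show ?thesis by simp
    qed
    have pt: "ennreal (norm (G x)) \<le> ennreal (3 * L powr (1 - p)) * ennreal (energy_density \<eta> q x) + ennreal (4 * L) * indicator A x" for x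
    proof (cases "\<eta> x = 0 \<or> 1 - q * (w x + d) \<le> 0")
      case True
      then have "G x = 0" using D0 by (auto simp: G_def F_def F'_def)
      then show ?thesis by simp
    next
      case False
      then have xb: "x \<in> ball x0 \<rho>" using supp by blast
      then have xA: "x \<in> A" using False Aq by auto
      have "x \<in> ball x0 R" using xb \<rho> r by auto
      then have wx: "0 \<le> w x" by (rule w0)
      define s where "s = w x + d"
      define m where "m = max 0 (1 - q * s)"
      define Z where "Z = \<eta> x * norm (g x) / s"
      have s: "0 < s" using wx d by (simp add: s_def)
      have m: "0 \<le> m" "m \<le> 1" using cutoff_slope_bounds[OF d q wx] by (auto simp: m_def s_def)
      have Z: "0 \<le> Z" using range(1)[of x] s by (simp add: Z_def)
      have qs: "q \<le> 1 / s" using False s by (simp add: s_def field_simps)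
      have "norm (F (w x) *\<^sub>R D\<eta> x) \<le> 1 * L"
        unfolding norm_scaleR using m bound[of x] by (intro mult_mono) (auto simp: F_def m_def s_def power_le_one)
      moreover have "norm ((\<eta> x * F' (w x)) *\<^sub>R g x) \<le> 3 * (m\<^sup>2 * Z)"
      proof -
        have "norm ((\<eta> x * F' (w x)) *\<^sub>R g x) = 3 * m\<^sup>2 * (\<eta> x * norm (g x)) * q"
          using range(1)[of x] q by (simp add: F'_def m_def s_def abs_mult)
        also have "\<dots> \<le> 3 * m\<^sup>2 * (\<eta> x * norm (g x)) * (1 / s)"
          using qs range(1)[of x] by (intro mult_left_mono) auto
        finally show ?thesis by (simp add: Z_def)
      qed
      moreover have "m\<^sup>2 * Z \<le> L powr (1 - p) * energy_density \<eta> q x + L"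
      proof -
        have "m\<^sup>2 * Z \<le> m\<^sup>2 * (L powr (1 - p) * Z powr p + L)"
          by (intro mult_left_mono le_powr_plus p Z L) simp
        also have "\<dots> = L powr (1 - p) * (Z powr p * m\<^sup>2) + m\<^sup>2 * L" by (simp add: algebra_simps)
        also have "Z powr p * m\<^sup>2 = energy_density \<eta> q x" by (simp add: energy_density_def Z_def m_def s_def)
        also have "L powr (1 - p) * energy_density \<eta> q x + m\<^sup>2 * L \<le> L powr (1 - p) * energy_density \<eta> q x + 1 * L"
          using m L(1) by (intro add_left_mono mult_right_mono) (auto simp: power_le_one)
        finally show ?thesis by simp
      qed
      ultimately have "norm (G x) \<le> 3 * L powr (1 - p) * energy_density \<eta> q x + 4 * L"
        unfolding G_def using norm_triangle_ineq[of "F (w x) *\<^sub>R D\<eta> x" "(\<eta> x * F' (w x)) *\<^sub>R g x"] by linarith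
      then have "ennreal (norm (G x)) \<le> ennreal (3 * L powr (1 - p) * energy_density \<eta> q x + 4 * L)" by (rule ennreal_leI)
      also have "\<dots> = ennreal (3 * L powr (1 - p)) * ennreal (energy_density \<eta> q x) + ennreal (4 * L)"
        using L(1) by (subst ennreal_plus) (auto simp: energy_density_def ennreal_mult[symmetric])
      finally show ?thesis using xA by simp
    qed
    define \<Gamma> where "\<Gamma> = (3 * K + 4) * L * \<alpha>"
    have \<Gamma>0: "0 \<le> \<Gamma>" using K0 L \<alpha> by (simp add: \<Gamma>_def)
    have GG: "(\<integral>\<^sup>+x. ennreal (norm (G x)) \<partial>lborel) \<le> ennreal \<Gamma>"
    proof -
      have "(\<integral>\<^sup>+x. ennreal (norm (G x)) \<partial>lborel) \<le> (\<integral>\<^sup>+x. ennreal (3 * L powr (1 - p)) * ennreal (energy_density \<eta> q x) + ennreal (4 * L) * indicator A x \<partial>lborel)"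
        by (intro nn_integral_mono pt)
      also have "\<dots> = (\<integral>\<^sup>+x. ennreal (3 * L powr (1 - p)) * ennreal (energy_density \<eta> q x) \<partial>lborel) + (\<integral>\<^sup>+x. ennreal (4 * L) * indicator A x \<partial>lborel)"
        using Em Am by (intro nn_integral_add borel_measurable_times_ennreal borel_measurable_indicator) auto
      also have "(\<integral>\<^sup>+x. ennreal (3 * L powr (1 - p)) * ennreal (energy_density \<eta> q x) \<partial>lborel) = ennreal (3 * L powr (1 - p)) * (\<integral>\<^sup>+x. ennreal (energy_density \<eta> q x) \<partial>lborel)"
        using Em by (intro nn_integral_cmult) auto
      also have "(\<integral>\<^sup>+x. ennreal (4 * L) * indicator A x \<partial>lborel) = ennreal (4 * L) * ennreal \<alpha>"
        using Ae by (subst nn_integral_cmult_indicator) auto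
      also have "ennreal (3 * L powr (1 - p)) * (\<integral>\<^sup>+x. ennreal (energy_density \<eta> q x) \<partial>lborel) + ennreal (4 * L) * ennreal \<alpha>
         \<le> ennreal (3 * L powr (1 - p)) * ennreal (K * L powr p * \<alpha>) + ennreal (4 * L) * ennreal \<alpha>"
        using caccioppoli[OF cut \<rho>12 L(2) q] unfolding Aq \<alpha>_def by (intro add_right_mono mult_left_mono) auto
      also have "\<dots> = ennreal (3 * L powr (1 - p) * (K * L powr p * \<alpha>) + 4 * L * \<alpha>)"
        using K0 L(1) \<alpha> by (subst ennreal_plus) (auto simp: ennreal_mult[symmetric])
      also have "3 * L powr (1 - p) * (K * L powr p * \<alpha>) + 4 * L * \<alpha> = \<Gamma>"
      proof -
        have "L powr (1 - p) * L powr p = L" using L(1) by (simp add: powr_add[symmetric])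
        then have "3 * L powr (1 - p) * (K * L powr p * \<alpha>) = 3 * L * K * \<alpha>" by (metis mult.assoc mult.left_commute)
        then show ?thesis by (simp add: \<Gamma>_def algebra_simps)
      qed
      finally show ?thesis .
    qed
    have tr: "(\<integral>\<^sup>+x. ennreal \<bar>V (x + h) - V x\<bar> \<partial>lborel) \<le> ennreal (norm h) * ennreal \<Gamma>" for h
    proof -
      have "(\<integral>\<^sup>+x. ennreal \<bar>V (x + h) - V x\<bar> \<partial>lborel) \<le> ennreal (norm h) * (\<integral>\<^sup>+x. ennreal (norm (G x)) \<partial>lborel)"
        using weak_translation_bound[OF Vwg Vint Gint, of UNIV UNIV h] by simp
      also have "\<dots> \<le> ennreal (norm h) * ennreal \<Gamma>" using GG by (rule mult_left_mono) simp
      finally show ?thesis .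
    qed
    define om where "om = unit_ball_vol (real DIM('a))"
    have om: "0 < om" by (simp add: om_def)
    define \<rho>0 where "\<rho>0 = (2 * \<alpha> / om) powr (1 / real DIM('a))"
    have \<rho>0: "0 < \<rho>0" using \<alpha> om by (simp add: \<rho>0_def)
    have "\<rho>0 ^ DIM('a) = \<rho>0 powr real DIM('a)" using \<rho>0 by (simp add: powr_realpow)
    also have "\<dots> = 2 * \<alpha> / om" using \<alpha> om by (simp add: \<rho>0_def powr_powr)
    finally have mb: "measure lborel (ball (0::'a) \<rho>0) = 2 * \<alpha>" using \<rho>0 om by (simp add: content_ball om_def[symmetric])
    have Vsupp: "V x = 0" if "x \<notin> A" for x
    proof (cases "x \<in> ball x0 \<rho>")
      case True
      then have "\<not> q * (w x + d) < 1" using that Aq by blast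
      then show ?thesis by (simp add: V_def F_def)
    qed (simp add: V_def supp)
    have FK: "(\<integral>\<^sup>+x. ennreal \<bar>V x\<bar> \<partial>lborel) \<le> ennreal (2 * \<rho>0) * ennreal \<Gamma>"
      by (rule faber_krahn_translation[OF Vm Am Ae \<alpha> Vsupp tr \<rho>0 mb])
    define \<theta> where "\<theta> = 1 - \<kappa>' / \<kappa>"
    have \<theta>: "0 \<le> \<theta>" using \<kappa> by (simp add: \<theta>_def field_simps)
    have "ennreal (\<theta> ^ 3 * measure lborel A') = (\<integral>\<^sup>+x. ennreal (\<theta> ^ 3) * indicator A' x \<partial>lborel)"
      using A'e \<theta> by (subst nn_integral_cmult_indicator) (auto simp: ennreal_mult)
    also have "\<dots> \<le> (\<integral>\<^sup>+x. ennreal \<bar>V x\<bar> \<partial>lborel)"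
    proof (rule nn_integral_mono)
      fix x
      show "ennreal (\<theta> ^ 3) * indicator A' x \<le> ennreal \<bar>V x\<bar>"
      proof (cases "x \<in> A'")
        case True
        then have x: "x \<in> cball x0 \<rho>'" "w x + d < \<kappa>'" by (auto simp: A'_def)
        have "q * (w x + d) \<le> \<kappa>' / \<kappa>" using x(2) \<kappa> by (simp add: q_def divide_right_mono)
        then have "\<theta> \<le> max 0 (1 - q * (w x + d))" by (simp add: \<theta>_def)
        then have "\<theta> ^ 3 \<le> F (w x)" unfolding F_def using \<theta> by (rule power_mono)
        then show ?thesis using True one[OF x(1)] by (simp add: V_def ennreal_leI)
      qed simp
    qed
    also have "\<dots> \<le> ennreal (2 * \<rho>0 * \<Gamma>)" using FK \<rho>0 \<Gamma>0 by (simp add: ennreal_mult)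
    finally have "\<theta> ^ 3 * measure lborel A' \<le> 2 * \<rho>0 * \<Gamma>" using \<rho>0 \<Gamma>0 by (subst (asm) ennreal_le_iff) auto
    then show ?thesis by (simp add: \<theta>_def \<rho>0_def \<Gamma>_def \<alpha>_def L_def om_def)
  qed
qed

end

section \<open>From measure to pointwise bounds\<close>

text \<open>
  The ratio \<open>16\<^bsup>- N\<^esup>\<close> is chosen so that its \<open>N\<close>-th root \<open>1 / 16\<close> cancels the growth \<open>16\<^bsup>j\<^esup>\<close> of the
  recursion.
\<close>

lemma fast_geometric_convergence:
  fixes y :: "nat \<Rightarrow> real" and N :: nat
  assumes N: "0 < N" and y0: "\<And>j. 0 \<le> y j" and C: "0 \<le> C" and \<nu>: "0 < \<nu>" "C * \<nu> powr (1 / N) * 16 ^ N \<le> 1"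
    and start: "y 0 \<le> \<nu>" and step: "\<And>j. y (Suc j) \<le> C * 16 ^ j * (y j * y j powr (1 / N))"
  shows "y j \<le> \<nu> * (1 / 16 ^ N) ^ j"
proof (induction j)
  case 0
  then show ?case using start by simp
next
  case (Suc j)
  define c where "c = (1 / 16 ^ N :: real)"
  have l: "0 < c" by (simp add: c_def)
  have "c powr (1 / N) = 1 / 16"
  proof -
    have "c = (1 / 16) powr N" by (simp add: c_def powr_realpow power_divide)
    then show ?thesis using N by (simp add: powr_powr)
  qed
  moreover have "(c ^ j) powr (1 / N) = (c powr (1 / N)) ^ j"
    using l by (simp add: powr_realpow[symmetric] powr_powr mult.commute)
  ultimately have lj: "(c ^ j) powr (1 / N) = (1 / 16) ^ j" by (simp only:)
  have "y j powr (1 / N) \<le> (\<nu> * c ^ j) powr (1 / N)"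
    using Suc y0 by (intro powr_mono2) (auto simp: c_def)
  also have "\<dots> = \<nu> powr (1 / N) * (1 / 16) ^ j" using \<nu>(1) l by (simp add: powr_mult lj)
  finally have "y j * y j powr (1 / N) \<le> (\<nu> * c ^ j) * (\<nu> powr (1 / N) * (1 / 16) ^ j)"
    using Suc y0[of j] \<nu>(1) l by (intro mult_mono) (auto simp: c_def)
  then have "C * 16 ^ j * (y j * y j powr (1 / N)) \<le> C * 16 ^ j * ((\<nu> * c ^ j) * (\<nu> powr (1 / N) * (1 / 16) ^ j))"
    using C by (intro mult_left_mono) auto
  also have "\<dots> = (\<nu> * c ^ j) * (C * \<nu> powr (1 / N)) * (16 ^ j * (1 / 16) ^ j)" by (simp add: mult_ac)
  also have "(16::real) ^ j * (1 / 16) ^ j = 1" by (simp add: power_mult_distrib[symmetric])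
  also have "(\<nu> * c ^ j) * (C * \<nu> powr (1 / N)) * 1 \<le> (\<nu> * c ^ j) * c * 1"
  proof -
    have "C * \<nu> powr (1 / N) \<le> c" using \<nu>(2) by (simp add: c_def field_simps)
    then show ?thesis using \<nu>(1) l by (intro mult_right_mono mult_left_mono) auto
  qed
  finally show ?case using step[of j] by (simp add: c_def mult_ac)
qed

text \<open>
  The number \<open>2048 = 2 * 16 * 64\<close> collects the factor \<open>2\<close> of \<open>de_giorgi_step\<close>, the slope \<open>16 *
  2\<^bsup>j\<^esup> / r\<close> of the \<open>j\<close>-th cutoff, and \<open>(4 * 2\<^bsup>j\<^esup>)\<^sup>3\<close>, which bounds \<open>(1 - \<kappa>' / \<kappa>)\<^bsup>-3\<^esup>\<close> for
  consecutive levels; the powers of \<open>2\<^bsup>j\<^esup>\<close> make up \<open>16\<^bsup>j\<^esup>\<close>.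
\<close>

definition step_const :: "nat \<Rightarrow> real \<Rightarrow> real" where
  "step_const N k = 2048 * (3 * k + 4) * (2 / unit_ball_vol (real N)) powr (1 / real N)"

context supersolution_near
begin

text \<open>
  The radii shrink from \<open>5 * r\<close> to \<open>4 * r\<close> and the levels from \<open>4 * d\<close> to \<open>2 * d\<close>.
\<close>

definition level_measure :: "nat \<Rightarrow> real" where
  "level_measure j = measure lborel {x \<in> ball x0 (4 * r + r / 2 ^ j). w x + d < 2 * d * (1 + 1 / 2 ^ j)}"

lemma level_measure_step:
  "level_measure (Suc j) / r ^ DIM('a) \<le> step_const DIM('a) K * 16 ^ j
     * ((level_measure j / r ^ DIM('a)) * (level_measure j / r ^ DIM('a)) powr (1 / real DIM('a)))"
proof -
  define N where "N = DIM('a)"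
  define om where "om = unit_ball_vol (real N)"
  have om: "0 < om" by (simp add: om_def)
  have N: "0 < N" by (simp add: N_def)
  define P :: real where "P = 2 ^ j"
  have P: "1 \<le> P" "0 < P" by (simp_all add: P_def)
  let ?\<rho> = "4 * r + r / 2 ^ j" and ?\<rho>' = "4 * r + r / 2 ^ Suc j"
  let ?\<kappa> = "2 * d * (1 + 1 / 2 ^ j)" and ?\<kappa>' = "2 * d * (1 + 1 / 2 ^ Suc j)"
  have \<rho>: "0 < ?\<rho>'" "?\<rho>' < ?\<rho>" "?\<rho> \<le> 5 * r"
    using r(1) P by (auto simp: P_def[symmetric] field_simps add_pos_pos)
  have \<kappa>: "0 < ?\<kappa>'" "?\<kappa>' < ?\<kappa>" using d P by (auto simp: P_def[symmetric] field_simps add_pos_pos)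
  define a where "a = level_measure j"
  define b where "b = level_measure (Suc j)"
  have ab: "0 \<le> a" "0 \<le> b" by (simp_all add: a_def b_def level_measure_def)
  have st: "(1 - ?\<kappa>' / ?\<kappa>) ^ 3 * b \<le> 2 * (2 * a / om) powr (1 / N) * ((3 * K + 4) * (8 / (?\<rho> - ?\<rho>')) * a)"
    using de_giorgi_step[OF \<rho> \<kappa>] unfolding a_def b_def level_measure_def om_def N_def .
  have e1: "8 / (?\<rho> - ?\<rho>') = 16 * P / r" using r(1) P by (simp add: P_def[symmetric] field_simps)
  have th: "1 / (4 * P) \<le> 1 - ?\<kappa>' / ?\<kappa>"
  proof -
    have "1 - ?\<kappa>' / ?\<kappa> = (1 / (2 * P)) / (1 + 1 / P)"
    proof -
      have quot: "1 - (1 + x / 2) / (1 + x) = (x / 2) / (1 + x)" if "0 \<le> x" for x :: real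
        using that by (simp add: field_simps)
      have eq: "?\<kappa>' / ?\<kappa> = (1 + (1 / P) / 2) / (1 + 1 / P)" using d by (simp add: P_def mult.commute)
      have half: "1 / (2 * P) = (1 / P) / 2" by simp
      show ?thesis unfolding eq half by (rule quot) (use P in simp)
    qed
    moreover have "(1 / (2 * P)) / 2 \<le> (1 / (2 * P)) / (1 + 1 / P)"
      using P by (intro divide_left_mono) (auto simp: field_simps add_pos_pos)
    ultimately show ?thesis by simp
  qed
  have "(1 / (4 * P)) ^ 3 * b \<le> (1 - ?\<kappa>' / ?\<kappa>) ^ 3 * b"
    using th P ab by (intro mult_right_mono power_mono) auto
  from order_trans[OF this st[unfolded e1]]
  have "(1 / (4 * P)) ^ 3 * b \<le> 2 * (2 * a / om) powr (1 / N) * ((3 * K + 4) * (16 * P / r) * a)" .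
  moreover have "(1 / (4 * P)) ^ 3 * b = b / (64 * P ^ 3)" by (simp add: power_divide power_mult_distrib)
  ultimately have "b / (64 * P ^ 3) \<le> 2 * (2 * a / om) powr (1 / N) * ((3 * K + 4) * (16 * P / r) * a)"
    by (simp only:)
  then have "b \<le> (2 * (2 * a / om) powr (1 / N) * ((3 * K + 4) * (16 * P / r) * a)) * (64 * P ^ 3)"
    using P by (subst (asm) pos_divide_le_eq) auto
  also have "(2 * a / om) powr (1 / N) = (2 / om) powr (1 / N) * (a / r ^ N) powr (1 / N) * r"
  proof -
    have "2 * a / om = (2 / om) * (a / r ^ N) * r ^ N" using r(1) by simp
    also have "\<dots> powr (1 / N) = (2 / om) powr (1 / N) * (a / r ^ N) powr (1 / N) * (r ^ N) powr (1 / N)"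
    proof -
      have "(x * y * z) powr e = x powr e * y powr e * z powr e" if "0 \<le> x" "0 \<le> y" "0 \<le> z" for x y z e :: real
        using that by (simp add: powr_mult)
      note triple = this
      have "0 \<le> 2 / om" "0 \<le> a / r ^ N" "0 \<le> r ^ N" using om ab r(1) by auto
      then show ?thesis by (rule triple)
    qed
    also have "(r ^ N) powr (1 / N) = r" using r(1) N by (simp add: powr_realpow[symmetric] powr_powr)
    finally show ?thesis .
  qed
  finally have "b \<le> (2 * ((2 / om) powr (1 / N) * (a / r ^ N) powr (1 / N) * r) * ((3 * K + 4) * (16 * P / r) * a)) * (64 * P ^ 3)" .
  also have "\<dots> = (2048 * (3 * K + 4) * (2 / om) powr (1 / N)) * (P * P ^ 3) * (a * (a / r ^ N) powr (1 / N))"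
    using r(1) by (simp add: field_simps)
  also have "P * P ^ 3 = 16 ^ j"
  proof -
    have "P * P ^ 3 = P ^ 4" by (simp add: numeral_eq_Suc)
    also have "\<dots> = (2 ^ 4) ^ j" unfolding P_def by (simp only: power_mult[symmetric] mult.commute)
    finally show ?thesis by simp
  qed
  finally have "b \<le> step_const N K * 16 ^ j * (a * (a / r ^ N) powr (1 / N))" unfolding step_const_def om_def .
  then have "b / r ^ N \<le> (step_const N K * 16 ^ j * (a * (a / r ^ N) powr (1 / N))) / r ^ N"
    using r(1) by (intro divide_right_mono) auto
  then show ?thesis by (simp add: a_def b_def N_def)
qed

text \<open>
  If the sublevel set at height \<open>4 * d\<close> has small measure in the larger ball, the iteration drives
  the level measures to \<open>0\<close>, so the sublevel set at height \<open>2 * d\<close> is null in the smaller ball;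
  there \<open>w + d \<ge> 2 * d\<close>.
\<close>

lemma measure_to_pointwise:
  assumes \<nu>: "0 < \<nu>" "step_const DIM('a) K * \<nu> powr (1 / real DIM('a)) * 16 ^ DIM('a) \<le> 1"
    and start: "measure lborel {x \<in> ball x0 (5 * r). w x + d < 4 * d} \<le> \<nu> * r ^ DIM('a)"
  shows "AE x in lebesgue. x \<in> ball x0 (4 * r) \<longrightarrow> d \<le> w x"
proof -
  define y where "y j = level_measure j / r ^ DIM('a)" for j
  have rN: "0 < r ^ DIM('a)" using r(1) by simp
  have sc: "0 \<le> step_const DIM('a) K" using K0 by (simp add: step_const_def)
  have y: "y j \<le> \<nu> * (1 / 16 ^ DIM('a)) ^ j" for j
  proof (rule fast_geometric_convergence[OF _ _ sc \<nu>])
    show "0 \<le> y j" for j using rN by (simp add: y_def level_measure_def)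
    have "level_measure 0 \<le> \<nu> * r ^ DIM('a)" using start by (simp add: level_measure_def)
    then show "y 0 \<le> \<nu>" using rN by (simp add: y_def field_simps)
    show "y (Suc j) \<le> step_const DIM('a) K * 16 ^ j * (y j * y j powr (1 / real DIM('a)))" for j
      unfolding y_def by (rule level_measure_step)
  qed simp
  define S where "S = {x \<in> ball x0 (4 * r). w x + d < 2 * d}"
  have Sm: "S \<in> sets borel" unfolding S_def by measurable
  have "measure lborel S \<le> (\<nu> * (1 / 16 ^ DIM('a)) ^ j) * r ^ DIM('a)" for j
  proof -
    let ?A = "{x \<in> ball x0 (4 * r + r / 2 ^ j). w x + d < 2 * d * (1 + 1 / 2 ^ j)}"
    have Am: "?A \<in> sets borel" by measurable
    have sub: "S \<subseteq> ?A"
    proof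
      fix x assume x: "x \<in> S"
      have "0 \<le> r / 2 ^ j" "2 * d \<le> 2 * d * (1 + 1 / 2 ^ j)" using r(1) d by auto
      then show "x \<in> ?A" using x by (auto simp: S_def)
    qed
    have "measure lborel S \<le> level_measure j"
      unfolding level_measure_def measure_def
    proof (rule enn2real_mono)
      show "emeasure lborel S \<le> emeasure lborel ?A" using sub Am by (intro emeasure_mono) auto
      have "emeasure lborel ?A = ennreal (measure lborel ?A)" by (rule level_set_measure[OF _ Am]) auto
      then show "emeasure lborel ?A < top" by simp
    qed
    also have "\<dots> = y j * r ^ DIM('a)" using r(1) by (simp add: y_def)
    also have "\<dots> \<le> (\<nu> * (1 / 16 ^ DIM('a)) ^ j) * r ^ DIM('a)" using y[of j] rN by (intro mult_right_mono) auto
    finally show ?thesis .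
  qed
  moreover have "(\<lambda>j. (\<nu> * (1 / 16 ^ DIM('a)) ^ j) * r ^ DIM('a)) \<longlonglongrightarrow> (\<nu> * 0) * r ^ DIM('a)"
  proof (intro tendsto_intros LIMSEQ_power_zero)
    have "(1::real) < 16 ^ DIM('a)" by (intro one_less_power) auto
    then show "norm (1 / 16 ^ DIM('a) :: real) < 1" by simp
  qed
  ultimately have "measure lborel S \<le> (\<nu> * 0) * r ^ DIM('a)"
    by (intro LIMSEQ_le_const) auto
  then have "measure lborel S = 0" using measure_nonneg[of lborel S] by simp
  moreover have "emeasure lborel S = ennreal (measure lborel S)"
    by (rule level_set_measure[OF _ Sm]) (auto simp: S_def)
  ultimately have "S \<in> null_sets lborel" using Sm by (simp add: null_sets_def)
  then have "AE x in lborel. x \<notin> S" by (rule AE_not_in)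
  then have "AE x in lborel. x \<in> ball x0 (4 * r) \<longrightarrow> d \<le> w x"
    by (rule AE_mp) (auto simp: S_def)
  then show ?thesis by (rule AE_completion)
qed

text \<open>
  The logarithmic estimate provides the smallness that starts the iteration, once \<open>M\<close> is large in
  terms of \<open>\<sigma>\<close> and \<open>\<nu>\<close>.
\<close>

lemma expansion_of_positivity:
  assumes \<nu>: "0 < \<nu>" "step_const DIM('a) K * \<nu> powr (1 / real DIM('a)) * 16 ^ DIM('a) \<le> 1"
    and dens: "\<sigma> * measure lborel (ball x0 r) \<le> measure lborel ({x. \<zeta> \<le> w x} \<inter> ball x0 r)"
    and \<sigma>: "0 < \<sigma>" and M: "0 < M" "48 * (K + 1) * 72 ^ DIM('a) * unit_ball_vol (real DIM('a)) \<le> M * \<sigma> * \<nu>"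
      "4 * d * exp M \<le> \<zeta> + d"
  shows "AE x in lebesgue. x \<in> ball x0 (4 * r) \<longrightarrow> d \<le> w x"
proof (rule measure_to_pointwise[OF \<nu>])
  let ?a = "measure lborel {x \<in> ball x0 (5 * r). w x + d < 4 * d}"
  have "M * \<sigma> * ?a \<le> 48 * (K + 1) * 72 ^ DIM('a) * measure lborel (ball x0 r)"
    by (rule log_step[OF dens M(1,3) \<sigma>])
  also have "\<dots> = (48 * (K + 1) * 72 ^ DIM('a) * unit_ball_vol (real DIM('a))) * r ^ DIM('a)"
    using r(1) by (simp add: content_ball)
  also have "\<dots> \<le> (M * \<sigma> * \<nu>) * r ^ DIM('a)" using M(2) r(1) by (intro mult_right_mono) auto
  finally have "(M * \<sigma>) * ?a \<le> (M * \<sigma>) * (\<nu> * r ^ DIM('a))" by (simp add: mult.assoc)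
  from mult_left_le_imp_le[OF this mult_pos_pos[OF M(1) \<sigma>]] show "?a \<le> \<nu> * r ^ DIM('a)" .
qed

end

section \<open>Borel representatives and the essential infimum\<close>

text \<open>
  An open set is an increasing union of compact sets, on each of which the function is measurable.
\<close>

lemma Lp_loc_measurable:
  fixes f :: "'a::euclidean_space \<Rightarrow> 'b::euclidean_space"
  assumes "open U" "Lp_loc p U f"
  shows "(\<lambda>x. indicator U x *\<^sub>R f x) \<in> borel_measurable lebesgue"
proof -
  obtain C where C: "\<And>n. compact (C n)" "\<And>n. C n \<subseteq> U" "\<And>n. C n \<subseteq> interior (C (Suc n))" "\<Union>(range C) = U"
    using open_Union_compact_subsets[OF assms(1)] by metis
  have mono: "C n \<subseteq> C (Suc n)" for n using C(3)[of n] interior_subset by blast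
  show ?thesis
  proof (rule borel_measurable_LIMSEQ_metric)
    show "(\<lambda>x. indicator (C n) x *\<^sub>R f x) \<in> borel_measurable lebesgue" for n
      using assms(2) C(1,2)[of n] unfolding Lp_loc_def Lp_def set_borel_measurable_def by blast
    fix x
    show "(\<lambda>n. indicator (C n) x *\<^sub>R f x) \<longlonglongrightarrow> indicator U x *\<^sub>R f x"
    proof (cases "x \<in> U")
      case True
      then obtain n where n: "x \<in> C n" using C(4) by auto
      have "x \<in> C k" if "n \<le> k" for k using n lift_Suc_mono_le[of C, OF mono that] by blast
      then have "\<forall>\<^sub>F k in sequentially. indicator (C k) x *\<^sub>R f x = indicator U x *\<^sub>R f x"
        using True by (auto simp: eventually_sequentially indicator_def)
      then show ?thesis by (rule tendsto_eventually)
    next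
      case False
      then have "x \<notin> C n" for n using C(2) by blast
      then show ?thesis using False by simp
    qed
  qed
qed

lemma borel_representative:
  fixes f :: "'a::euclidean_space \<Rightarrow> 'b::euclidean_space"
  assumes "f \<in> borel_measurable lebesgue"
  obtains h where "h \<in> borel_measurable borel" "AE x in lebesgue. f x = h x"
proof -
  have "\<exists>h. h \<in> borel_measurable borel \<and> (AE x in lborel. f x \<bullet> i = h x)" for i
  proof -
    have "(\<lambda>x. f x \<bullet> i) \<in> borel_measurable (completion lborel)" using assms by measurable
    from completion_ex_borel_measurable_real[OF this] show ?thesis by auto
  qed
  then obtain h where h: "\<And>i. h i \<in> borel_measurable borel" "\<And>i. AE x in lborel. f x \<bullet> i = h i x" by metis
  have "AE x in lborel. \<forall>i\<in>Basis. f x \<bullet> i = h i x" using h(2) by (simp add: AE_ball_countable countable_finite)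
  then have "AE x in lborel. f x = (\<Sum>i\<in>Basis. h i x *\<^sub>R i)"
  proof eventually_elim
    case (elim x)
    have "f x = (\<Sum>i\<in>Basis. (f x \<bullet> i) *\<^sub>R i)" by (simp add: euclidean_representation)
    also have "\<dots> = (\<Sum>i\<in>Basis. h i x *\<^sub>R i)" using elim by (intro sum.cong) auto
    finally show ?case .
  qed
  then have "AE x in lebesgue. f x = (\<Sum>i\<in>Basis. h i x *\<^sub>R i)" by (rule AE_completion)
  moreover have "(\<lambda>x. \<Sum>i\<in>Basis. h i x *\<^sub>R i) \<in> borel_measurable borel"
    using h(1) by (intro borel_measurable_sum borel_measurable_scaleR) auto
  ultimately show thesis using that by blast
qed

lemma AE_lebesgue_measurable:
  fixes f h :: "'a::euclidean_space \<Rightarrow> 'b::euclidean_space"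
  assumes "f \<in> borel_measurable lebesgue" "AE x in lebesgue. f x = h x"
  shows "h \<in> borel_measurable lebesgue"
  using assms by (metis borel_measurable_AE)

lemma Lp_loc_cong_AE:
  fixes f h :: "'a::euclidean_space \<Rightarrow> 'b::euclidean_space"
  assumes "Lp_loc p U f" "AE x in lebesgue. x \<in> U \<longrightarrow> f x = h x"
  shows "Lp_loc p U h"
  unfolding Lp_loc_def Lp_def
proof (intro allI impI conjI)
  fix C assume C: "compact C \<and> C \<subseteq> U"
  then have f: "(\<lambda>x. indicator C x *\<^sub>R f x) \<in> borel_measurable lebesgue" "integrable lebesgue (\<lambda>x. indicator C x *\<^sub>R norm (f x) powr p)"
    using assms(1) unfolding Lp_loc_def Lp_def set_borel_measurable_def set_integrable_def by blast+
  have ae1: "AE x in lebesgue. indicator C x *\<^sub>R f x = indicator C x *\<^sub>R h x"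
    and ae2: "AE x in lebesgue. indicator C x *\<^sub>R norm (f x) powr p = indicator C x *\<^sub>R norm (h x) powr p"
    using assms(2) C by (auto elim!: eventually_mono simp: indicator_def)
  show "set_borel_measurable lebesgue C h"
    unfolding set_borel_measurable_def by (rule AE_lebesgue_measurable[OF f(1) ae1])
  show "set_integrable lebesgue C (\<lambda>x. norm (h x) powr p)"
    unfolding set_integrable_def
    using integrable_cong_AE[THEN iffD1, OF borel_measurable_integrable[OF f(2)] AE_lebesgue_measurable[OF borel_measurable_integrable[OF f(2)] ae2] ae2 f(2)] .
qed

lemma is_weak_gradient_cong_AE:
  assumes "is_weak_gradient U u g" "AE x in lebesgue. x \<in> U \<longrightarrow> u x = u' x" "AE x in lebesgue. x \<in> U \<longrightarrow> g x = g' x"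
    and U: "open U"
  shows "is_weak_gradient U u' g'"
  unfolding is_weak_gradient_def
proof (intro conjI ballI)
  show loc: "Lp_loc 1 U u'" "Lp_loc 1 U g'"
    using assms Lp_loc_cong_AE unfolding is_weak_gradient_def by blast+
  fix \<phi> assume \<phi>: "\<phi> \<in> test_functions U"
  then have s: "smooth \<phi>" by (rule test_functionsD)
  have \<phi>m: "\<phi> \<in> borel_measurable lebesgue" "grad \<phi> \<in> borel_measurable lebesgue"
    using smooth_borel[OF s] borel_measurable_continuous_onI[OF smooth_grad_continuous[OF s]] borel_imp_lebesgue by blast+
  have m: "(\<lambda>x. indicator U x *\<^sub>R u x) \<in> borel_measurable lebesgue" "(\<lambda>x. indicator U x *\<^sub>R g x) \<in> borel_measurable lebesgue"
    using assms(1) Lp_loc_measurable[OF U] unfolding is_weak_gradient_def by blast+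
  have m': "(\<lambda>x. indicator U x *\<^sub>R u' x) \<in> borel_measurable lebesgue" "(\<lambda>x. indicator U x *\<^sub>R g' x) \<in> borel_measurable lebesgue"
    using loc Lp_loc_measurable[OF U] by blast+
  have 1: "(LINT x:U|lebesgue. u x *\<^sub>R grad \<phi> x) = (LINT x:U|lebesgue. u' x *\<^sub>R grad \<phi> x)"
    unfolding set_lebesgue_integral_def
  proof (rule integral_cong_AE)
    show "AE x in lebesgue. indicator U x *\<^sub>R u x *\<^sub>R grad \<phi> x = indicator U x *\<^sub>R u' x *\<^sub>R grad \<phi> x"
      using assms(2) by eventually_elim (auto simp: indicator_def)
    show "(\<lambda>x. indicator U x *\<^sub>R u x *\<^sub>R grad \<phi> x) \<in> borel_measurable lebesgue"
      using borel_measurable_scaleR[OF m(1) \<phi>m(2)] by simp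
    show "(\<lambda>x. indicator U x *\<^sub>R u' x *\<^sub>R grad \<phi> x) \<in> borel_measurable lebesgue"
      using borel_measurable_scaleR[OF m'(1) \<phi>m(2)] by simp
  qed
  have sw: "indicator U x *\<^sub>R \<phi> x *\<^sub>R k x = \<phi> x *\<^sub>R indicator U x *\<^sub>R k x" for k :: "'a \<Rightarrow> 'a" and x by simp
  have 2: "(LINT x:U|lebesgue. \<phi> x *\<^sub>R g x) = (LINT x:U|lebesgue. \<phi> x *\<^sub>R g' x)"
    unfolding set_lebesgue_integral_def sw
  proof (rule integral_cong_AE)
    show "AE x in lebesgue. \<phi> x *\<^sub>R indicator U x *\<^sub>R g x = \<phi> x *\<^sub>R indicator U x *\<^sub>R g' x"
      using assms(3) by eventually_elim (auto simp: indicator_def)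
    show "(\<lambda>x. \<phi> x *\<^sub>R indicator U x *\<^sub>R g x) \<in> borel_measurable lebesgue"
      by (rule borel_measurable_scaleR[OF \<phi>m(1) m(2)])
    show "(\<lambda>x. \<phi> x *\<^sub>R indicator U x *\<^sub>R g' x) \<in> borel_measurable lebesgue"
      by (rule borel_measurable_scaleR[OF \<phi>m(1) m'(2)])
  qed
  show "(LINT x:U|lebesgue. u' x *\<^sub>R grad \<phi> x) = - (LINT x:U|lebesgue. \<phi> x *\<^sub>R g' x)"
    using assms(1) \<phi> unfolding 1[symmetric] 2[symmetric] is_weak_gradient_def by blast
qed

lemma ess_inf_on_ge:
  fixes f :: "'a::euclidean_space \<Rightarrow> real"
  assumes "f \<in> borel_measurable lebesgue" "S \<in> sets lebesgue" "AE x in lebesgue. x \<in> S \<longrightarrow> c \<le> f x"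
  shows "ereal c \<le> ess_inf_on S f"
proof -
  have "esssup (restrict_space lebesgue S) (\<lambda>x. - ereal (f x)) \<le> - ereal c"
  proof (rule esssup_I)
    have "(\<lambda>x. - ereal (f x)) \<in> borel_measurable lebesgue" using assms(1) by measurable
    then show "(\<lambda>x. - ereal (f x)) \<in> borel_measurable (restrict_space lebesgue S)" by (rule measurable_restrict_space1)
    have "AE x in lebesgue. x \<in> S \<longrightarrow> - ereal (f x) \<le> - ereal c" using assms(3) by eventually_elim auto
    then show "AE x in restrict_space lebesgue S. - ereal (f x) \<le> - ereal c"
      using assms(2) by (subst AE_restrict_space_iff) auto
  qed
  then show ?thesis unfolding ess_inf_on_def by (metis ereal_minus_le_minus ereal_uminus_uminus)
qed

section \<open>Expansion of positivity for weak supersolutions\<close>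

theorem lemma6p2:
  fixes p \<sigma> :: real
    and \<mu> :: "real measure"
    and \<Omega> :: "'a::euclidean_space set"
  assumes "1 < p"
    and "open \<Omega>" and "connected \<Omega>" and "\<Omega> \<noteq> {}" and "bounded \<Omega>"
    and "finite_measure \<mu>"
    and "sets \<mu> = sets (restrict_space borel {0..1})"
    and "emeasure \<mu> {0<..<1} > 0"
    and "emeasure \<mu> {0} = 0"
    and "emeasure \<mu> {1} > 0"
    and "0 < \<sigma>" and "\<sigma> \<le> 1"
  shows "\<exists>\<delta>. 0 < \<delta> \<and> \<delta> < 1 / 4 \<and>
    (\<forall>(u :: 'a \<Rightarrow> real) x0 R r \<zeta>.
       weak_supersolution \<mu> p \<Omega> u \<and>
       ball x0 R \<subseteq> \<Omega> \<and>
       (AE x in lebesgue. x \<in> ball x0 R \<longrightarrow> 0 \<le> u x) \<and>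
       0 \<le> \<zeta> \<and>
       0 < r \<and> r \<le> 1 \<and> 16 * r < R \<and>
       measure lebesgue ({x. \<zeta> \<le> u x} \<inter> ball x0 r) \<ge> \<sigma> * measure lebesgue (ball x0 r)
       \<longrightarrow>
       ess_inf_on (ball x0 (4 * r)) u \<ge>
         ereal (\<delta> * \<zeta>)
         - (SUP s\<in>measure_support \<mu>. ereal ((r / R) powr (s * p / (p - 1))))
           * enn2ereal (Tail \<mu> p (\<lambda>x. max (- u x) 0) x0 R))"
proof -
  note p = assms(1) and \<Omega> = assms(2) and fm = assms(6) and sets = assms(7) and \<sigma> = assms(11)
  interpret finite_measure \<mu> by (rule fm)
  have one: "{1} \<in> sets \<mu>"
  proof -
    have "{0..1} \<inter> {1::real} \<in> sets \<mu>" unfolding sets sets_restrict_space by (rule imageI) simp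
    then show ?thesis by simp
  qed
  have \<alpha>: "0 < measure \<mu> {1}" using assms(10) by (simp add: emeasure_eq_measure)
  obtain kc where kc: "0 \<le> kc" "\<And>s. 0 < s \<Longrightarrow> s < 1 \<Longrightarrow>
    ennreal (C_norm DIM('a) s p) * (\<integral>\<^sup>+z. ennreal (min 1 (norm z) powr p * norm (z::'a) powr (- (real DIM('a) + s * p))) \<partial>lborel) \<le> ennreal kc"
    by (rule kernel_constant[OF p, where 'a='a]) blast
  (* The constants below depend on p, \<mu>, \<sigma> and the dimension only: k is the Caccioppoli constant,
     \<nu> the smallness that starts the iteration, and M the logarithmic depth at which the sublevel
     set has become that small. *)
  define k where "k = cacc_const DIM('a) p \<mu> kc"
  have k: "0 \<le> k" unfolding k_def by (rule cacc_const_nonneg[OF p kc(1)])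
  define c where "c = step_const DIM('a) k"
  have c: "0 < c"
  proof -
    have "0 < unit_ball_vol (real DIM('a))" by simp
    then have "0 < 2 / unit_ball_vol (real DIM('a))" by (intro divide_pos_pos) auto
    then have "0 < (2 / unit_ball_vol (real DIM('a))) powr (1 / real DIM('a))"
      by (intro powr_gt_zero[THEN iffD2]) (rule less_imp_neq[THEN not_sym])
    then show ?thesis unfolding c_def step_const_def using k by (intro mult_pos_pos) auto
  qed
  define \<nu> where "\<nu> = (1 / (c * 16 ^ DIM('a))) powr real DIM('a)"
  have \<nu>: "0 < \<nu>" using c by (simp add: \<nu>_def)
  have \<nu>1: "c * \<nu> powr (1 / real DIM('a)) * 16 ^ DIM('a) \<le> 1"
    using c by (simp add: \<nu>_def powr_powr)
  define M where "M = 48 * (k + 1) * 72 ^ DIM('a) * unit_ball_vol (real DIM('a)) / (\<sigma> * \<nu>) + 1"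
  have M: "0 < M" unfolding M_def using k \<sigma> \<nu> by (intro add_nonneg_pos divide_nonneg_pos mult_nonneg_nonneg) auto
  have M1: "48 * (k + 1) * 72 ^ DIM('a) * unit_ball_vol (real DIM('a)) \<le> M * \<sigma> * \<nu>"
  proof -
    have "b \<le> (b / (\<sigma> * \<nu>) + 1) * (\<sigma> * \<nu>)" for b using \<sigma> \<nu> by (simp add: distrib_right)
    then show ?thesis unfolding M_def mult.assoc[of _ \<sigma>] .
  qed
  (* With this choice 4 * d * exp M = \<zeta> / 2 for d = \<delta> * \<zeta>. *)
  define \<delta> where "\<delta> = exp (- M) / 8"
  have \<delta>: "0 < \<delta>" "\<delta> < 1 / 4"
  proof -
    have "exp (- M) < 1" using M by simp
    then show "\<delta> < 1 / 4" unfolding \<delta>_def by linarith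
    show "0 < \<delta>" by (simp add: \<delta>_def)
  qed
  show ?thesis
  proof (intro exI[of _ \<delta>] conjI \<delta> allI impI, elim conjE)
    fix u :: "'a \<Rightarrow> real" and x0 :: 'a and R r \<zeta> :: real
    assume super: "weak_supersolution \<mu> p \<Omega> u" and ball: "ball x0 R \<subseteq> \<Omega>"
      and nonneg: "AE x in lebesgue. x \<in> ball x0 R \<longrightarrow> 0 \<le> u x" and \<zeta>: "0 \<le> \<zeta>"
      and r: "0 < r" "r \<le> 1" "16 * r < R"
      and dens: "\<sigma> * measure lebesgue (ball x0 r) \<le> measure lebesgue ({x. \<zeta> \<le> u x} \<inter> ball x0 r)"
    define S where "S = (SUP s\<in>measure_support \<mu>. ereal ((r / R) powr (s * p / (p - 1))))"
    define T where "T = enn2ereal (Tail \<mu> p (\<lambda>x. max (- u x) 0) x0 R)"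
    have "u \<in> W1p_loc p \<Omega>" and ut: "u \<in> tail_space \<mu> p"
      using super by (auto simp: weak_supersolution_def)
    then obtain G0 where G0: "is_weak_gradient \<Omega> u G0" "Lp_loc p \<Omega> G0" by (auto simp: W1p_loc_def)
    have um: "u \<in> borel_measurable lebesgue"
      using ut Lp_loc_measurable[of UNIV "p - 1" u] by (simp add: tail_space_def)
    have T0: "0 \<le> T" by (simp add: T_def)
    have S0: "0 \<le> S"
    proof -
      obtain s where "s \<in> measure_support \<mu>"
        using measure_support_nonempty[OF sets assms(10) one] by blast
      then have "ereal ((r / R) powr (s * p / (p - 1))) \<le> S" unfolding S_def by (rule SUP_upper)
      moreover have "0 \<le> ereal ((r / R) powr (s * p / (p - 1)))" by simp
      ultimately show ?thesis by (rule order_trans[rotated])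
    qed
    have ST: "0 \<le> S * T" using S0 T0 by simp
    have sub: "ball x0 (4 * r) \<subseteq> ball x0 R" using r by auto
    have "ereal (\<delta> * \<zeta>) - S * T \<le> ess_inf_on (ball x0 (4 * r)) u"
    proof (cases "ereal (\<delta> * \<zeta>) \<le> S * T")
      (* If the tail term is at least \<delta> * \<zeta>, the asserted lower bound is not positive. *)
      case True
      have "AE x in lebesgue. x \<in> ball x0 (4 * r) \<longrightarrow> 0 \<le> u x"
        using nonneg by eventually_elim (use sub in blast)
      then have "ereal 0 \<le> ess_inf_on (ball x0 (4 * r)) u" by (intro ess_inf_on_ge um) auto
      moreover have "ereal (\<delta> * \<zeta>) - S * T \<le> ereal 0" using True by (cases "S * T") auto
      ultimately show ?thesis by (rule order_trans[rotated])
    next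
      case False
      define d where "d = \<delta> * \<zeta>"
      have STd: "S * T \<le> ereal d" "S * T < ereal d" using False by (auto simp: d_def)
      then have d: "0 < d" using ST by (metis ereal_less_ereal_Ex leD less_ereal.simps(1) not_le order_le_less_trans zero_ereal_def)
      obtain u1 where u1: "u1 \<in> borel_measurable borel" "AE x in lebesgue. u x = u1 x"
        by (rule borel_representative[OF um])
      (* On the ball the Borel representative is modified on a null set to be nonnegative
         everywhere. *)
      define w where "w x = (if x \<in> ball x0 R then max 0 (u1 x) else u1 x)" for x
      have wm: "w \<in> borel_measurable borel" unfolding w_def[abs_def] using u1(1) by (intro measurable_If) auto
      have uw: "AE x in lebesgue. u x = w x"
        using u1(2) nonneg by eventually_elim (auto simp: w_def)
      have w0: "0 \<le> w x" if "x \<in> ball x0 R" for x using that by (simp add: w_def)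
      have "(\<lambda>x. indicator \<Omega> x *\<^sub>R G0 x) \<in> borel_measurable lebesgue" by (rule Lp_loc_measurable[OF \<Omega> G0(2)])
      then obtain g where g: "g \<in> borel_measurable borel" "AE x in lebesgue. indicator \<Omega> x *\<^sub>R G0 x = g x"
        by (rule borel_representative)
      have gG: "AE x in lebesgue. x \<in> \<Omega> \<longrightarrow> G0 x = g x" using g(2) by eventually_elim auto
      have wgu: "is_weak_gradient \<Omega> u g" by (rule is_weak_gradient_cong_AE[OF G0(1) _ gG \<Omega>]) simp
      have wgw: "is_weak_gradient \<Omega> w g"
        by (rule is_weak_gradient_cong_AE[OF G0(1) _ gG \<Omega>]) (use uw in eventually_elim, simp)
      have gp: "Lp_loc p \<Omega> g" by (rule Lp_loc_cong_AE[OF G0(2) gG])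
      note outer = outer_integral_lborel[OF uw]
      define X where "X = (\<integral>\<^sup>+s\<in>{0<..<1}. ennreal (C_norm DIM('a) s p)
        * (\<integral>\<^sup>+y. ennreal ((max (- w y) 0) powr (p - 1) / norm (y - x0) powr (real DIM('a) + s * p)) * indicator (- ball x0 R) y \<partial>lborel) \<partial>\<mu>)"
      have "ennreal (r powr p) * X \<le> ennreal (d powr (p - 1))"
        unfolding X_def outer[symmetric]
      proof (rule tail_scaling[OF p sets r(1,2)])
        show "r < R" using r by simp
        show "0 \<le> d" using d by simp
        have "Tail \<mu> p u x0 R < \<infinity>" using ut r by (simp add: tail_space_def)
        then show "Tail \<mu> p (\<lambda>x. max (- u x) 0) x0 R < \<infinity>" by (rule Tail_finite_mono[OF p, rotated]) auto
        show "(\<lambda>s. \<integral>\<^sup>+y\<in>- ball x0 R. ennreal (\<bar>max (- u y) 0\<bar> powr (p - 1) / norm (y - x0) powr (real DIM('a) + s * p)) \<partial>lebesgue) \<in> borel_measurable \<mu>"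
          unfolding outer by (rule outer_measurable[OF sets]) (use wm in auto)
        show "(\<lambda>s. C_norm DIM('a) s p) \<in> borel_measurable \<mu>" by (rule C_norm_measurable[OF sets p]) simp
        show "(SUP s\<in>measure_support \<mu>. ereal ((r / R) powr (s * p / (p - 1)))) * enn2ereal (Tail \<mu> p (\<lambda>x. max (- u x) 0) x0 R) \<le> ereal d"
          using STd(1) unfolding S_def T_def .
      qed
      then have "ennreal (r powr (- p)) * (ennreal (r powr p) * X) \<le> ennreal (r powr (- p)) * ennreal (d powr (p - 1))"
        by (rule mult_left_mono) simp
      moreover have "ennreal (r powr (- p)) * (ennreal (r powr p) * X) = X"
      proof -
        have "r powr (- p) * r powr p = 1" using r(1) by (simp add: powr_add[symmetric])
        then have "ennreal (r powr (- p)) * ennreal (r powr p) = 1" by (simp add: ennreal_mult[symmetric])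
        then show ?thesis by (simp add: mult.assoc[symmetric])
      qed
      ultimately have tail: "X \<le> ennreal (r powr (- p) * d powr (p - 1))" by (simp add: ennreal_mult)
      interpret supersolution_near p \<mu> \<Omega> u w g x0 R r d kc
        by unfold_locales (use p sets \<alpha> \<Omega> super ball wm uw w0 g(1) wgu wgw gp r d kc tail X_def in auto)
      have kk: "supersolution_near.K TYPE('a) p \<mu> kc = k" by (simp add: K_def k_def)
      have dM: "4 * d * exp M \<le> \<zeta> + d"
      proof -
        have "4 * d * exp M = \<zeta> / 2" by (simp add: d_def \<delta>_def exp_minus)
        then show ?thesis using \<zeta> d by linarith
      qed
      have "AE x in lebesgue. x \<in> ball x0 (4 * r) \<longrightarrow> d \<le> w x"
      proof (rule expansion_of_positivity)
        show "\<sigma> * measure lborel (ball x0 r) \<le> measure lborel ({x. \<zeta> \<le> w x} \<inter> ball x0 r)"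
        proof -
          have m: "{x. \<zeta> \<le> w x} \<inter> ball x0 r \<in> sets borel" using wm by measurable
          have "measure lebesgue ({x. \<zeta> \<le> u x} \<inter> ball x0 r) = measure lebesgue ({x. \<zeta> \<le> w x} \<inter> ball x0 r)"
          proof (rule measure_eq_AE)
            show "AE x in lebesgue. (x \<in> {x. \<zeta> \<le> u x} \<inter> ball x0 r) = (x \<in> {x. \<zeta> \<le> w x} \<inter> ball x0 r)"
              using uw by eventually_elim auto
            have "{x \<in> space lebesgue. \<zeta> \<le> u x} \<in> sets lebesgue" using um by measurable
            then show "{x. \<zeta> \<le> u x} \<inter> ball x0 r \<in> sets lebesgue" by (intro sets.Int) auto
            show "{x. \<zeta> \<le> w x} \<inter> ball x0 r \<in> sets lebesgue" using m by simp
          qed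
          then show ?thesis using dens m by (simp add: measure_completion)
        qed
      qed (use \<nu> \<nu>1 \<sigma> M M1 dM in \<open>simp_all add: kk c_def[symmetric]\<close>)
      then have "AE x in lebesgue. x \<in> ball x0 (4 * r) \<longrightarrow> d \<le> u x"
        using uw by eventually_elim auto
      then have "ereal d \<le> ess_inf_on (ball x0 (4 * r)) u" by (intro ess_inf_on_ge um) auto
      moreover have "ereal (\<delta> * \<zeta>) - S * T \<le> ereal d"
        using ST by (cases "S * T") (auto simp: d_def)
      ultimately show ?thesis by (rule order_trans[rotated])
    qed
    then show "ereal (\<delta> * \<zeta>) - (SUP s\<in>measure_support \<mu>. ereal ((r / R) powr (s * p / (p - 1)))) * enn2ereal (Tail \<mu> p (\<lambda>x. max (- u x) 0) x0 R)
      \<le> ess_inf_on (ball x0 (4 * r)) u" unfolding S_def T_def .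
  qed
qed

end
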